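(* If $\mu$ is any UMGW measure, with minimum degree $d_\star>2$ ($\mu$-almost surely), then $\beta\mapsto\mathsf U(\beta,0)$ is continuous (on $[0,\infty)$) except for possibly countably many values of $\beta\in(\beta_c,\beta_\star]$, where $\beta_\star=\operatorname{atanh}[(d_\star-1)^{-1}]$.
   Context: **UMGW measures.** Let $\mathcal Q=\{1,\dots,|\mathcal Q|\}$ be a finite type space, $p(\cdot)$ a strictly positive probability measure on $\mathcal Q$, $\mathbb Z_\ge$ the non-negative integers, and $P_i(\cdot)$, $i\in\mathcal Q$, probability measures on $\mathbb Z_\ge^{|\mathcal Q|}$ such that for all $i,j\in\mathcal Q$: $M(i,j):=\sum_{\underline k}P_i(\underline k)k_j<\infty$ and $p(i)M(i,j)=p(j)M(j,i)$. Put $\mathcal Q_M:=\{(i,j):M(i,j)>0\}$ and for $(i,j)\in\mathcal Q_M$ $$\widehat P_{i,j}(\underline k)=P_i(\underline k+e_j)\frac{k_j+1}{M(i,j)},$$ $e_j$ being the $j$-th unit vector. Assume non-singularity: $\widehat P_{i,j}(\underline k)>0$ for some $(i,j)$ and some $\underline k$ with $\|\underline k\|:=\sum_jk_j\ne1$. Assume also that the mean matrix on $\mathcal Q_M$, $\widehat M((i_1,j_1),(i_2,j_2)):=\mathbf 1_{\{j_2=i_1\}}\sum_{\underline k}\widehat P_{i_1,j_1}(\underline k)k_{i_2}$, is positive regular: for some finite positive integer $r$ all entries of $\widehat M^r$ are strictly positive (possibly infinite, with $\infty\times0=0$). The associated UMGW measure is the law (on rooted trees) of the following random tree: the root type is chosen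 according to $p(\cdot)$; given root type $i_0$, the numbers of offspring of each type of the root are chosen according to $P_{i_0}(\cdot)$; from the next generation onward, offspring numbers and types are chosen independently at each vertex according to $\widehat P_{i,j}$, where $i$ is the type of the vertex and $j$ the type of its parent. As a measure on rooted trees, types are forgotten. **Ising notation.** For a rooted tree $(T,o)$, let $T(t)$ be its subtree induced by vertices at distance at most $t$ from $o$, and $\partial o$ the neighbours of $o$. $\nu^{\beta,0,t}_{+,T}$ is the probability measure on $\{-1,1\}^{V(T(t))}$ with weights $\exp\{\beta\sum_{(i,j)\in E(T(t))}x_ix_j\}$, conditioned on all spins outside $T(t-1)$ being $+1$; as $t\to\infty$ it converges to a probability measure $\nu^{\beta,0}_{+,T}$ on $\{-1,1\}^{V(T)}$. For $\beta\ge0$, $$\mathsf U(\beta,0):=\tfrac12\,\mu\Big[\sum_{i\in\partial o}\nu^{\beta,0}_{+,T}\langle x_ox_i\rangle\Big],$$ where $\mu[\cdot]$ is expectation over $(T,o)\sim\mu$ and $\nu\langle f\rangle$ is the $\nu$-expectation of $f$. $\beta_c$ is the critical inverse temperature: for $B=0$ there is a unique Ising Gibbs measure on $T$ if $\beta<\beta_c$ and there are multiple ones if $\beta>\beta_c$ (this threshold is the same constant for $\mu$-a.e. $T$). *)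

theory Defs
  imports "HOL-Probability.Probability"
begin

section \<open>Locally finite rooted trees\<close>

text \<open>
  A vertex is named by its address, read from the vertex up to the root: the root is the empty
  list, and the children of \<open>v\<close> have the form \<open>a # v\<close>. A rooted tree is identified with its
  vertex set, so the distance of \<open>v\<close> from the root is \<open>length v\<close>. Everything defined below from
  a tree depends only on its structure as a rooted graph, not on the addresses.
\<close>

definition rooted_tree :: "'a list set \<Rightarrow> bool" where
  "rooted_tree T \<longleftrightarrow>
     [] \<in> T \<and> (\<forall>a v. a # v \<in> T \<longrightarrow> v \<in> T) \<and> (\<forall>v\<in>T. finite {a. a # v \<in> T})"

definition tree_space :: "'a list set measure" where
  "tree_space = sigma (Collect rooted_tree) {{T. rooted_tree T \<and> v \<in> T} | v. True}"

definition edges :: "'a list set \<Rightarrow> 'a list set set" where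
  "edges T = {{tl v, v} | v. v \<in> T \<and> v \<noteq> []}"

definition neighbours :: "'a list set \<Rightarrow> 'a list \<Rightarrow> 'a list set" where
  "neighbours T v = {w. {v, w} \<in> edges T}"

definition degree :: "'a list set \<Rightarrow> 'a list \<Rightarrow> nat" where
  "degree T v = card (neighbours T v)"

definition min_degree :: "'a list set \<Rightarrow> nat" where
  "min_degree T = (INF v\<in>T. degree T v)"

definition subtree :: "'a list set \<Rightarrow> nat \<Rightarrow> 'a list set" where
  "subtree T t = {v \<in> T. length v \<le> t}"


section \<open>UMGW measures\<close>

type_synonym 'q offspring_laws = "'q \<Rightarrow> ('q \<Rightarrow> nat) pmf"

definition mean :: "'q offspring_laws \<Rightarrow> 'q \<Rightarrow> 'q \<Rightarrow> ennreal" where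
  "mean P i j = (\<integral>\<^sup>+ k. of_nat (k j) \<partial>measure_pmf (P i))"

definition pos_pairs :: "'q offspring_laws \<Rightarrow> ('q \<times> 'q) set" where
  "pos_pairs P = {(i, j). mean P i j > 0}"

text \<open>
  The value outside \<open>pos_pairs\<close> is irrelevant: almost surely, no vertex of type \<open>i\<close> has a parent
  of type \<open>j\<close> when \<open>(i, j) \<notin> pos_pairs P\<close>.
\<close>

definition biased_law :: "'q offspring_laws \<Rightarrow> 'q \<Rightarrow> 'q \<Rightarrow> ('q \<Rightarrow> nat) pmf" where
  "biased_law P i j =
     (if (i, j) \<in> pos_pairs P
      then embed_pmf (\<lambda>k. pmf (P i) (k(j := k j + 1)) * real (k j + 1) / enn2real (mean P i j))
      else return_pmf (\<lambda>_. 0))"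

definition biased_mean :: "'q offspring_laws \<Rightarrow> 'q \<times> 'q \<Rightarrow> 'q \<times> 'q \<Rightarrow> ennreal" where
  "biased_mean P a b =
     (case (a, b) of ((i1, j1), (i2, j2)) \<Rightarrow>
        if j2 = i1 then \<integral>\<^sup>+ k. of_nat (k i2) \<partial>measure_pmf (biased_law P i1 j1) else 0)"

text \<open>Powers of the matrix \<open>biased_mean P\<close> on \<open>pos_pairs P\<close>; in \<open>ennreal\<close>, \<open>\<infinity> * 0 = 0\<close>.\<close>

primrec biased_mean_power ::
    "'q::finite offspring_laws \<Rightarrow> nat \<Rightarrow> 'q \<times> 'q \<Rightarrow> 'q \<times> 'q \<Rightarrow> ennreal" where
  "biased_mean_power P 0 a b = (if a = b then 1 else 0)"
| "biased_mean_power P (Suc r) a b =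
     (\<Sum>c\<in>pos_pairs P. biased_mean P a c * biased_mean_power P r c b)"

definition umgw_parameters :: "'q::finite pmf \<Rightarrow> 'q offspring_laws \<Rightarrow> bool" where
  "umgw_parameters p P \<longleftrightarrow>
     (\<forall>i. pmf p i > 0) \<and>
     (\<forall>i j. mean P i j < \<infinity>) \<and>
     (\<forall>i j. ennreal (pmf p i) * mean P i j = ennreal (pmf p j) * mean P j i) \<and>
     (\<exists>(i, j)\<in>pos_pairs P. \<exists>k. pmf (biased_law P i j) k > 0 \<and> (\<Sum>l\<in>UNIV. k l) \<noteq> 1) \<and>
     (\<exists>r>0. \<forall>a\<in>pos_pairs P. \<forall>b\<in>pos_pairs P. biased_mean_power P r a b > 0)"

text \<open>
  The address \<open>(j, m) # v\<close> names the \<open>m\<close>-th child of type \<open>j\<close> of \<open>v\<close>, counting from 0, so the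
  type of a vertex other than the root can be read off its address. Offspring vectors are sampled
  at all addresses; those of addresses outside the resulting tree are ignored.
\<close>

primrec vertex_type :: "'q \<Rightarrow> ('q \<times> nat) list \<Rightarrow> 'q" where
  "vertex_type i0 [] = i0"
| "vertex_type i0 (a # v) = fst a"

primrec vertex_law ::
    "'q offspring_laws \<Rightarrow> 'q \<Rightarrow> ('q \<times> nat) list \<Rightarrow> ('q \<Rightarrow> nat) pmf" where
  "vertex_law P i0 [] = P i0"
| "vertex_law P i0 (a # v) = biased_law P (fst a) (vertex_type i0 v)"

primrec in_tree :: "(('q \<times> nat) list \<Rightarrow> 'q \<Rightarrow> nat) \<Rightarrow> ('q \<times> nat) list \<Rightarrow> bool" where
  "in_tree K [] \<longleftrightarrow> True"
| "in_tree K (a # v) \<longleftrightarrow> in_tree K v \<and> snd a < K v (fst a)"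

definition umgw :: "'q::finite pmf \<Rightarrow> 'q offspring_laws \<Rightarrow> ('q \<times> nat) list set measure" where
  "umgw p P =
     measure_pmf p \<bind> (\<lambda>i0.
       distr (\<Pi>\<^sub>M v\<in>UNIV. measure_pmf (vertex_law P i0 v)) tree_space (\<lambda>K. Collect (in_tree K)))"

lemma pmf_biased_law:
  fixes P :: "'q::finite offspring_laws"
  assumes "(i, j) \<in> pos_pairs P" "mean P i j < \<infinity>"
  shows "pmf (biased_law P i j) k = pmf (P i) (k(j := k j + 1)) * real (k j + 1) / enn2real (mean P i j)"
proof -
  let ?f = "\<lambda>k. pmf (P i) (k(j := k j + 1)) * real (k j + 1) / enn2real (mean P i j)"
  have pos: "mean P i j > 0" using assms by (simp add: pos_pairs_def)
  let ?g = "\<lambda>k::'q \<Rightarrow> nat. k(j := k j + 1)"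
  have inj: "inj ?g"
  proof (rule injI, rule ext)
    fix x y l assume a: "?g x = ?g y"
    show "x l = y l" using fun_cong[OF a, of l] by (auto split: if_splits)
  qed
  have "mean P i j = (\<integral>\<^sup>+ k. ennreal (pmf (P i) k) * of_nat (k j) \<partial>count_space UNIV)"
    unfolding mean_def by (simp add: nn_integral_measure_pmf)
  also have "\<dots> = (\<integral>\<^sup>+ k. ennreal (pmf (P i) k) * of_nat (k j) \<partial>count_space (range ?g))"
  proof (rule nn_integral_count_space_eq)
    fix k assume "k \<in> UNIV - range ?g"
    then have "k j = 0"
    proof -
      have "k = ?g (k(j := k j - 1))" if "k j > 0" using that by auto
      then show ?thesis using \<open>k \<in> UNIV - range ?g\<close> by blast
    qed
    then show "ennreal (pmf (P i) k) * of_nat (k j) = 0" by simp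
  qed auto
  also have "\<dots> = (\<integral>\<^sup>+ k. ennreal (pmf (P i) (?g k)) * of_nat (k j + 1) \<partial>count_space UNIV)"
    by (subst nn_integral_bij_count_space[of ?g UNIV "range ?g", symmetric])
       (use inj in \<open>auto simp: bij_betw_def\<close>)
  finally have m: "(\<integral>\<^sup>+ k. ennreal (pmf (P i) (?g k)) * of_nat (k j + 1) \<partial>count_space UNIV) = mean P i j" ..
  have "(\<integral>\<^sup>+ k. ennreal (?f k) \<partial>count_space UNIV) =
     (\<integral>\<^sup>+ k. ennreal (pmf (P i) (?g k)) * of_nat (k j + 1) / mean P i j \<partial>count_space UNIV)"
  proof (intro nn_integral_cong)
    fix k
    show "ennreal (?f k) = ennreal (pmf (P i) (?g k)) * of_nat (k j + 1) / mean P i j"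
      using pos assms(2)
      by (metis divide_ennreal enn2real_positive_iff ennreal_enn2real ennreal_mult ennreal_of_nat_eq_real_of_nat infinity_ennreal_def mult_nonneg_nonneg of_nat_0_le_iff pmf_nonneg)
  qed
  also have "\<dots> = 1" using pos assms(2)
    by (simp only: nn_integral_divide[OF borel_measurable_count_space] m) (simp add: ennreal_divide_self)
  finally show ?thesis
    using assms by (simp add: biased_law_def pmf_embed_pmf)
qed

lemma rooted_tree_in_tree: "rooted_tree (Collect (in_tree (K :: ('q::finite \<times> nat) list \<Rightarrow> 'q \<Rightarrow> nat)))"
proof -
  have "finite {a. snd a < K v (fst a)}" for v
  proof (rule finite_subset)
    show "{a. snd a < K v (fst a)} \<subseteq> (SIGMA j:UNIV. {..<K v j})" by auto
  qed auto
  then have "finite {a. in_tree K (a # v)}" for v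
    by (rule rev_finite_subset) auto
  then show ?thesis unfolding rooted_tree_def by (simp del: in_tree.simps(2)) simp
qed

lemma measurable_in_tree:
  fixes Q :: "('q::finite \<times> nat) list \<Rightarrow> ('q \<Rightarrow> nat) pmf"
  shows "(\<lambda>K. Collect (in_tree K)) \<in> measurable (\<Pi>\<^sub>M v\<in>UNIV. measure_pmf (Q v)) tree_space"
proof -
  have *: "Measurable.pred (\<Pi>\<^sub>M v\<in>UNIV. measure_pmf (Q v)) (\<lambda>K. in_tree K v)" for v
  proof (induction v)
    case (Cons a v)
    have [measurable]: "(\<lambda>K. K v (fst a)) \<in> measurable (\<Pi>\<^sub>M v\<in>UNIV. measure_pmf (Q v)) (count_space UNIV)"
      by (rule measurable_compose[OF measurable_component_singleton]) auto
    show ?case using Cons by simp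
  qed simp
  show ?thesis unfolding tree_space_def
  proof (rule measurable_measure_of)
    fix A assume "A \<in> {{T. rooted_tree T \<and> v \<in> T} | v :: ('q \<times> nat) list. True}"
    then obtain v where A: "A = {T. rooted_tree T \<and> v \<in> T}" by auto
    have "(\<lambda>K. Collect (in_tree K)) -` A \<inter> space (\<Pi>\<^sub>M v\<in>UNIV. measure_pmf (Q v)) =
       {K \<in> space (\<Pi>\<^sub>M v\<in>UNIV. measure_pmf (Q v)). in_tree K v}"
      by (auto simp: A rooted_tree_in_tree)
    then show "(\<lambda>K. Collect (in_tree K)) -` A \<inter> space (\<Pi>\<^sub>M v\<in>UNIV. measure_pmf (Q v)) \<in> sets (\<Pi>\<^sub>M v\<in>UNIV. measure_pmf (Q v))"
      using *[of v] by simp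
  qed (auto simp: rooted_tree_in_tree)
qed

lemma prob_space_umgw: "prob_space (umgw p P)" and sets_umgw: "sets (umgw p P) = sets tree_space"
proof -
  let ?K = "\<lambda>i0. distr (\<Pi>\<^sub>M v\<in>UNIV. measure_pmf (vertex_law P i0 v)) tree_space (\<lambda>K. Collect (in_tree K))"
  have pr: "prob_space (?K i0)" for i0
    by (intro prob_space.prob_space_distr measurable_in_tree prob_space_PiM measure_pmf.prob_space_axioms)
  then have K: "?K \<in> measurable (measure_pmf p) (prob_algebra tree_space)"
    by (auto simp: space_prob_algebra)
  show "prob_space (umgw p P)"
    unfolding umgw_def
    by (rule measure_pmf.prob_space_bind[OF _ measurable_prob_algebraD[OF K]]) (simp add: pr)
  show "sets (umgw p P) = sets tree_space"
    unfolding umgw_def by (rule sets_bind) auto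
qed


section \<open>Ising measures without external field\<close>

text \<open>The product over an edge \<open>e = {i, j}\<close> is \<open>x i * x j\<close>.\<close>

definition ising_weight :: "real \<Rightarrow> 'a list set set \<Rightarrow> ('a list \<Rightarrow> real) \<Rightarrow> real" where
  "ising_weight \<beta> F x = exp (\<beta> * (\<Sum>e\<in>F. \<Prod>v\<in>e. x v))"

definition spin_space :: "'a list set \<Rightarrow> ('a list \<Rightarrow> real) measure" where
  "spin_space T = (\<Pi>\<^sub>M v\<in>T. count_space {-1, 1})"

definition plus_configs :: "'a list set \<Rightarrow> nat \<Rightarrow> ('a list \<Rightarrow> real) set" where
  "plus_configs T t =
     {x \<in> subtree T t \<rightarrow>\<^sub>E {-1, 1}. \<forall>v\<in>subtree T t. length v = t \<longrightarrow> x v = 1}"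

definition ising_plus_upto :: "real \<Rightarrow> 'a list set \<Rightarrow> nat \<Rightarrow> ('a list \<Rightarrow> real) measure" where
  "ising_plus_upto \<beta> T t =
     point_measure (plus_configs T t)
       (\<lambda>x. ennreal (ising_weight \<beta> (edges (subtree T t)) x /
              (\<Sum>y\<in>plus_configs T t. ising_weight \<beta> (edges (subtree T t)) y)))"

text \<open>
  The weak limit of \<open>ising_plus_upto \<beta> T t\<close> as \<open>t \<rightarrow> \<infinity>\<close>. On \<open>{-1, 1}\<^bsup>V(T)\<^esup>\<close>, weak convergence is
  convergence of the probabilities of all cylinders.
\<close>

definition ising_plus :: "real \<Rightarrow> 'a list set \<Rightarrow> ('a list \<Rightarrow> real) measure" where
  "ising_plus \<beta> T =
     (THE \<nu>. prob_space \<nu> \<and> sets \<nu> = sets (spin_space T) \<and>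
        (\<forall>A s. finite A \<and> A \<subseteq> T \<longrightarrow>
           (\<lambda>t. measure (ising_plus_upto \<beta> T t) {x \<in> plus_configs T t. \<forall>v\<in>A. x v = s v})
             \<longlonglongrightarrow> measure \<nu> {x \<in> space \<nu>. \<forall>v\<in>A. x v = s v}))"

definition internal_energy :: "('a list set) measure \<Rightarrow> real \<Rightarrow> real" where
  "internal_energy \<mu> \<beta> =
     1 / 2 * (\<integral>T. (\<Sum>i\<in>neighbours T []. \<integral>x. x [] * x i \<partial>ising_plus \<beta> T) \<partial>\<mu>)"

text \<open>
  The probability of \<open>E\<close> under the Ising measure on the finite set \<open>L\<close> with boundary condition
  given by \<open>x\<close> off \<open>L\<close>.
\<close>

definition ising_specification ::
    "real \<Rightarrow> 'a list set \<Rightarrow> 'a list set \<Rightarrow> ('a list \<Rightarrow> real) \<Rightarrow> ('a list \<Rightarrow> real) set \<Rightarrow> real" where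
  "ising_specification \<beta> T L x E =
     (\<Sum>s\<in>L \<rightarrow>\<^sub>E {-1, 1}.
        ising_weight \<beta> {e \<in> edges T. e \<inter> L \<noteq> {}} (override_on x s L) *
        indicator E (override_on x s L)) /
     (\<Sum>s\<in>L \<rightarrow>\<^sub>E {-1, 1}.
        ising_weight \<beta> {e \<in> edges T. e \<inter> L \<noteq> {}} (override_on x s L))"

text \<open>Gibbs measures are characterized by the DLR equations.\<close>

definition ising_gibbs :: "real \<Rightarrow> 'a list set \<Rightarrow> ('a list \<Rightarrow> real) measure \<Rightarrow> bool" where
  "ising_gibbs \<beta> T \<nu> \<longleftrightarrow>
     prob_space \<nu> \<and> sets \<nu> = sets (spin_space T) \<and>
     (\<forall>L E. finite L \<and> L \<subseteq> T \<and> E \<in> sets \<nu> \<longrightarrow>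
        measure \<nu> E = (\<integral>x. ising_specification \<beta> T L x E \<partial>\<nu>))"

definition critical_inverse_temperature :: "('a list set) measure \<Rightarrow> real \<Rightarrow> bool" where
  "critical_inverse_temperature \<mu> \<beta>\<^sub>c \<longleftrightarrow>
     0 \<le> \<beta>\<^sub>c \<and>
     (AE T in \<mu>. \<forall>\<beta>\<ge>0.
        (\<beta> < \<beta>\<^sub>c \<longrightarrow> (\<exists>!\<nu>. ising_gibbs \<beta> T \<nu>)) \<and>
        (\<beta> > \<beta>\<^sub>c \<longrightarrow> (\<exists>\<nu> \<nu>'. ising_gibbs \<beta> T \<nu> \<and> ising_gibbs \<beta> T \<nu>' \<and> \<nu> \<noteq> \<nu>')))"

end

theory Submission
  imports Defs
begin

text \<open>
  On a tree, summing out the spins below a vertex \<open>v\<close> turns them into a field that \<open>v\<close> exerts on its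
  parent; for the plus measure this field is \<open>plus_message \<beta> T v\<close>. These fields solve the cavity
  equations \<open>u v = cavity \<beta> (\<Sum> u (child of v))\<close>, the plus measure is the Markov chain that they
  determine (\<open>ising_plus_eq_tree_chain\<close>), and the correlation of the root with a neighbour is a
  continuous increasing function of \<open>\<beta>\<close> and of finitely many of them.

  Since the fields increase with \<open>\<beta>\<close>, so does the internal energy, which therefore has at most
  countably many discontinuities. They are decreasing limits of continuous increasing functions of
  \<open>\<beta>\<close>, namely of the fields of finite volumes, hence continuous from the right. Only continuity from
  the left at \<open>\<beta> > \<beta>\<^sub>s\<close> and at \<open>\<beta> \<le> \<beta>\<^sub>c\<close> is left.

  Let \<open>\<beta> > \<beta>\<^sub>s\<close>. Every vertex has at least \<open>d\<^sub>s - 1\<close> children and \<open>(d\<^sub>s - 1) * tanh \<beta> > 1\<close>, so the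
  iteration of the cavity equations from a small positive field increases. Its limit is the plus
  field, because by concavity the ratio of two solutions that are bounded away from 0 contracts to 1
  (\<open>message_tendsto_from_below\<close>). Thus the plus field is also an increasing limit of continuous
  functions.

  Let \<open>\<beta> \<le> \<beta>\<^sub>c\<close>. It suffices that the fields vanish almost surely, since the internal energy is then
  \<open>tanh \<beta>\<close> times half the mean degree of the root. As \<open>cavity \<beta>\<close> is odd, a nonzero solution \<open>h\<close> gives
  two Gibbs measures, the chains of \<open>h\<close> and \<open>- h\<close> (\<open>ising_gibbs_tree_chain\<close>), so the fields vanish
  below \<open>\<beta>\<^sub>c\<close>. At \<open>\<beta>\<^sub>c\<close> the growth of the tree enters. Write \<open>t = tanh \<beta>\<close> and let \<open>M\<close> be the mean matrix
  of the non-root offspring.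
    \<^item> If the fields vanish at \<open>\<beta>\<close>, then \<open>t ^ n * (M ^ n) a a \<le> 1\<close> for all \<open>n\<close> and all pairs of types \<open>a\<close>.
      Otherwise the second moment method provides random flows of strength 1 and bounded energy through
      the first levels, and Thomson's principle bounds the fields from below
      (\<open>trunc_mean_power_le_of_root_message_0\<close>).
    \<^item> This inequality passes from \<open>\<beta> < \<beta>\<^sub>c\<close> to \<open>\<beta>\<^sub>c\<close> by continuity of \<open>tanh\<close>.
    \<^item> Conversely, it forces the fields to vanish: it bounds \<open>t ^ n * M ^ n\<close>, while by strict concavity
      of \<open>cavity \<beta>\<close> the vector \<open>y\<close> of expected fields satisfies \<open>y \<le> \<rho> * t * M y\<close> for some \<open>\<rho> < 1\<close>
      (\<open>root_message_0_of_biased_mean_power_le\<close>).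
\<close>


section \<open>The cavity map\<close>

text \<open>
  The field that a spin in the field \<open>x\<close> exerts on a neighbour to which it is coupled with strength
  \<open>\<beta>\<close>.
\<close>

definition cavity :: "real \<Rightarrow> real \<Rightarrow> real" where
  "cavity \<beta> x = artanh (tanh \<beta> * tanh x)"

lemma tanh_mult_bounds:
  fixes a b :: real
  shows "\<bar>tanh a * tanh b\<bar> < 1" and "-1 < tanh a * tanh b" and "tanh a * tanh b < 1"
proof -
  have "\<bar>tanh a\<bar> < 1" "\<bar>tanh b\<bar> < 1"
    using tanh_real_bounds[of a] tanh_real_bounds[of b] by (auto simp: abs_less_iff)
  then show "\<bar>tanh a * tanh b\<bar> < 1"
    by (simp add: abs_mult del: tanh_real_abs) (metis abs_ge_zero mult_strict_mono' mult_1)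
  then show "-1 < tanh a * tanh b" "tanh a * tanh b < 1" by (auto simp: abs_less_iff)
qed

lemma tanh_artanh_real:
  fixes x :: real
  assumes "-1 < x" "x < 1"
  shows "tanh (artanh x) = x"
proof -
  define y where "y = (1 + x) / (1 - x)"
  have y: "0 < y" using assms by (simp add: y_def)
  have "tanh (artanh x) = (1 - exp (- ln y)) / (1 + exp (- ln y))"
    by (simp add: artanh_def y_def tanh_real_altdef)
  also have "exp (- ln y) = 1 / y" using y by (simp add: exp_minus inverse_eq_divide)
  also have "(1 - 1 / y) / (1 + 1 / y) = ((y - 1) / y) / ((y + 1) / y)"
    using y by (simp add: diff_divide_distrib add_divide_distrib)
  also have "\<dots> = (y - 1) / (y + 1)" using y by simp
  also have "\<dots> = x" using assms by (simp add: y_def divide_simps)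
  finally show ?thesis .
qed

lemma tanh_cavity: "tanh (cavity \<beta> x) = tanh \<beta> * tanh x"
  unfolding cavity_def by (rule tanh_artanh_real[OF tanh_mult_bounds(2,3)])

lemma cavity_0 [simp]: "cavity \<beta> 0 = 0"
  by (simp add: cavity_def)

lemma cavity_uminus: "cavity \<beta> (- x) = - cavity \<beta> x"
  unfolding cavity_def using tanh_mult_bounds(1)[of \<beta> x] by simp

lemma cavity_mono:
  assumes "0 \<le> \<beta>" "\<beta> \<le> \<beta>'" "0 \<le> x" "x \<le> y"
  shows "cavity \<beta> x \<le> cavity \<beta>' y"
proof -
  have "tanh (cavity \<beta> x) \<le> tanh (cavity \<beta>' y)"
    unfolding tanh_cavity using assms by (intro mult_mono) auto
  then show ?thesis by simp
qed

lemma cavity_nonneg: "0 \<le> \<beta> \<Longrightarrow> 0 \<le> x \<Longrightarrow> 0 \<le> cavity \<beta> x"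
  using cavity_mono[of \<beta> \<beta> 0 x] by simp

lemma cavity_pos: "0 < \<beta> \<Longrightarrow> 0 < x \<Longrightarrow> 0 < cavity \<beta> x"
  using tanh_cavity[of \<beta> x] by (metis mult_pos_pos tanh_real_pos_iff)

lemma cavity_le: "0 \<le> \<beta> \<Longrightarrow> 0 \<le> x \<Longrightarrow> cavity \<beta> x \<le> \<beta>"
proof -
  assume "0 \<le> \<beta>" "0 \<le> x"
  then have "tanh (cavity \<beta> x) \<le> tanh \<beta>"
    unfolding tanh_cavity using tanh_real_lt_1[of x] by (simp add: mult_left_le)
  then show ?thesis by simp
qed

lemma tendsto_cavity [tendsto_intros]:
  assumes "(f \<longlongrightarrow> \<beta>) F" "(g \<longlongrightarrow> x) F"
  shows "((\<lambda>n. cavity (f n) (g n)) \<longlongrightarrow> cavity \<beta> x) F"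
  unfolding cavity_def using assms tanh_mult_bounds[of \<beta> x]
  by (intro tendsto_intros) auto

lemma measurable_cavity [measurable]: "cavity \<beta> \<in> borel_measurable borel"
proof (intro borel_measurable_continuous_onI continuous_at_imp_continuous_on ballI)
  fix x
  show "isCont (cavity \<beta>) x"
    unfolding isCont_def by (intro tendsto_intros)
qed

text \<open>
  Up to the factor 2, the two left-hand sides are the sums over a spin \<open>y\<close> of \<open>exp (x * y + \<beta> * s * y)\<close>
  for \<open>s = 1\<close> and \<open>s = -1\<close>. So summing out \<open>y\<close> leaves its neighbour \<open>s\<close> in the field \<open>cavity \<beta> x\<close>.
\<close>

lemma cosh_add_cavity:
  obtains A where "A > 0" "cosh (\<beta> + x) = A * exp (cavity \<beta> x)" "cosh (- \<beta> + x) = A * exp (- cavity \<beta> x)"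
proof -
  let ?y = "cavity \<beta> x"
  define A where "A = cosh \<beta> * cosh x / cosh ?y"
  have s: "sinh ?y * (cosh \<beta> * cosh x) = cosh ?y * (sinh \<beta> * sinh x)"
    using tanh_cavity[of \<beta> x] by (simp add: tanh_def field_simps)
  have e: "exp ?y = cosh ?y + sinh ?y" "exp (- ?y) = cosh ?y - sinh ?y"
    by (simp_all add: cosh_plus_sinh cosh_minus_sinh)
  show ?thesis
  proof (rule that[of A])
    show "A > 0" by (simp add: A_def cosh_real_pos)
    have c: "cosh ?y \<noteq> 0" by simp
    show "cosh (\<beta> + x) = A * exp ?y"
      unfolding A_def e cosh_add using s c by (simp add: field_simps)
    show "cosh (-\<beta> + x) = A * exp (- ?y)"
      unfolding A_def e cosh_add using s c by (simp add: field_simps)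
  qed
qed

text \<open>
  The derivative of \<open>cavity \<beta>\<close>. For \<open>\<beta> \<ge> 0\<close> it is, in this form, visibly decreasing on the positive
  half-line, where \<open>cavity \<beta>\<close> is therefore concave.
\<close>

definition cavity_deriv :: "real \<Rightarrow> real \<Rightarrow> real" where
  "cavity_deriv \<beta> x = tanh \<beta> / (1 + (1 - (tanh \<beta>)\<^sup>2) * (sinh x)\<^sup>2)"

lemma has_real_derivative_cavity:
  "(cavity \<beta> has_real_derivative cavity_deriv \<beta> x) (at x within A)"
proof -
  have t: "(tanh \<beta> * tanh x)\<^sup>2 < 1"
    using tanh_mult_bounds(1)[of \<beta> x] by (simp add: abs_square_less_1)
  have c: "cosh x \<noteq> 0" by simp
  have "(cavity \<beta> has_real_derivative (tanh \<beta> * (1 - (tanh x)\<^sup>2)) * (1 / (1 - (tanh \<beta> * tanh x)\<^sup>2))) (at x within A)"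
  proof -
    have d: "((\<lambda>x. tanh \<beta> * tanh x) has_real_derivative tanh \<beta> * (1 - (tanh x)\<^sup>2)) (at x within A)"
      by (auto intro!: derivative_eq_intros)
    show ?thesis unfolding cavity_def[abs_def]
      using DERIV_chain2[OF artanh_real_has_field_derivative[OF tanh_mult_bounds(1)] d]
      by (simp only: mult.commute)
  qed
  also have "(tanh \<beta> * (1 - (tanh x)\<^sup>2)) * (1 / (1 - (tanh \<beta> * tanh x)\<^sup>2)) = cavity_deriv \<beta> x"
  proof -
    have d: "1 - (tanh \<beta> * tanh x)\<^sup>2 > 0" using t by simp
    have b: "(tanh \<beta>)\<^sup>2 < 1" using tanh_real_bounds[of \<beta>] by (simp add: abs_square_less_1 abs_less_iff del: tanh_real_abs)
    have e: "1 + (1 - (tanh \<beta>)\<^sup>2) * (sinh x)\<^sup>2 > 0"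
      using b by (intro add_pos_nonneg mult_nonneg_nonneg) auto
    have sx: "sinh x = tanh x * cosh x" by (simp add: tanh_def)
    have cc: "(cosh x)\<^sup>2 * (1 - (tanh x)\<^sup>2) = 1"
      using hyperbolic_pythagoras[of x] unfolding sx by (simp add: algebra_simps power_mult_distrib)
    have "tanh \<beta> * (1 - (tanh x)\<^sup>2) * (1 + (1 - (tanh \<beta>)\<^sup>2) * (sinh x)\<^sup>2) = tanh \<beta> * (1 - (tanh \<beta> * tanh x)\<^sup>2)"
      using cc unfolding sx power_mult_distrib by algebra
    then show ?thesis unfolding cavity_deriv_def using d e by (simp add: field_simps)
  qed
  finally show ?thesis .
qed

lemma tanh_sq_lt_1: "(tanh (\<beta>::real))\<^sup>2 < 1"
  using tanh_real_bounds[of \<beta>] by (simp add: abs_square_less_1 abs_less_iff del: tanh_real_abs)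

lemma cavity_deriv_antimono:
  assumes "0 \<le> \<beta>" "0 \<le> x" "x \<le> y"
  shows "cavity_deriv \<beta> y \<le> cavity_deriv \<beta> x"
proof -
  have "(sinh x)\<^sup>2 \<le> (sinh y)\<^sup>2" using assms by (intro power_mono) auto
  then show ?thesis unfolding cavity_deriv_def using assms tanh_sq_lt_1[of \<beta>]
    by (intro divide_left_mono add_left_mono mult_left_mono mult_pos_pos add_pos_nonneg) auto
qed

lemma cavity_deriv_strict_antimono:
  assumes "0 < \<beta>" "0 \<le> x" "x < y"
  shows "cavity_deriv \<beta> y < cavity_deriv \<beta> x"
proof -
  have "(sinh x)\<^sup>2 < (sinh y)\<^sup>2" using assms by (intro power_strict_mono) auto
  then show ?thesis unfolding cavity_deriv_def using assms tanh_sq_lt_1[of \<beta>]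
    by (intro divide_strict_left_mono add_strict_left_mono mult_strict_left_mono mult_pos_pos add_pos_nonneg) auto
qed

lemma cavity_mvt:
  assumes "x < y"
  obtains z where "x < z" "z < y" "cavity \<beta> y - cavity \<beta> x = (y - x) * cavity_deriv \<beta> z"
  using MVT2[OF assms, of "cavity \<beta>" "cavity_deriv \<beta>"] has_real_derivative_cavity by blast

lemma cavity_less:
  assumes "0 < \<beta>" "0 < x"
  shows "cavity \<beta> x < tanh \<beta> * x"
proof -
  obtain z where z: "0 < z" "cavity \<beta> x - cavity \<beta> 0 = (x - 0) * cavity_deriv \<beta> z"
    using cavity_mvt[OF assms(2)] by metis
  have "cavity_deriv \<beta> z < cavity_deriv \<beta> 0"
    using assms z by (intro cavity_deriv_strict_antimono) auto
  then have "x * cavity_deriv \<beta> z < x * cavity_deriv \<beta> 0" using assms by (intro mult_strict_left_mono)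
  then have "x * cavity_deriv \<beta> z < x * tanh \<beta>" by (simp add: cavity_deriv_def)
  then show ?thesis using z by (simp add: mult.commute)
qed

lemma cavity_le_linear:
  assumes "0 \<le> \<beta>" "0 \<le> x"
  shows "cavity \<beta> x \<le> tanh \<beta> * x"
  using assms cavity_less[of \<beta> x] by (cases "\<beta> = 0"; cases "x = 0") (auto simp: cavity_def)

lemma cavity_ge_linear:
  assumes "0 \<le> \<beta>" "0 \<le> x"
  shows "x * cavity_deriv \<beta> x \<le> cavity \<beta> x"
proof (cases "x = 0")
  case False
  then have "0 < x" using assms by simp
  then obtain z where z: "0 < z" "z < x" "cavity \<beta> x - cavity \<beta> 0 = (x - 0) * cavity_deriv \<beta> z"
    using cavity_mvt by metis
  have "cavity_deriv \<beta> x \<le> cavity_deriv \<beta> z"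
    using assms z by (intro cavity_deriv_antimono) auto
  then show ?thesis using z assms by (simp add: mult_left_mono)
qed simp

text \<open>
  Read as conductances, this says that applying \<open>cavity \<beta>\<close> costs at most a factor \<open>tanh \<beta>\<close> and a
  constant resistance \<open>c\<close> in series.
\<close>

lemma cavity_series_law:
  assumes "0 < \<beta>"
  obtains c where "c > 0" "\<And>x. 0 < x \<Longrightarrow> 1 / cavity \<beta> x \<le> 1 / (tanh \<beta> * x) + c"
proof -
  let ?t = "tanh \<beta>"
  have t: "0 < ?t" using assms by simp
  have F1: "0 < cavity \<beta> 1" using assms by (simp add: cavity_pos)
  define c where "c = 1 / cavity \<beta> 1 + (cosh 1)\<^sup>2 / ?t"
  show ?thesis
  proof (rule that[of c])
    show "c > 0" using F1 t by (auto simp: c_def intro!: add_pos_nonneg)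
    fix x :: real assume x: "0 < x"
    show "1 / cavity \<beta> x \<le> 1 / (?t * x) + c"
    proof (cases "x \<le> 1")
      case True
      have "(sinh has_real_derivative cosh y) (at y)" for y :: real
        using has_field_derivative_sinh[OF DERIV_ident] by simp
      then obtain z where z: "0 < z" "z < x" "sinh x - sinh 0 = (x - 0) * cosh z"
        using MVT2[OF x, of sinh cosh] by blast
      have "cosh z \<le> cosh 1" using z True by (intro cosh_real_nonneg_le_iff[THEN iffD2]) auto
      then have "sinh x \<le> x * cosh 1" using z x by simp
      then have "(sinh x)\<^sup>2 \<le> (x * cosh 1)\<^sup>2" using x by (intro power_mono) auto
      also have "\<dots> \<le> x * (cosh 1)\<^sup>2" using x True
        by (simp add: power_mult_distrib power2_eq_square mult_right_le_one_le)
      finally have s: "(sinh x)\<^sup>2 \<le> x * (cosh 1)\<^sup>2" .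
      have "(1 - ?t\<^sup>2) * (sinh x)\<^sup>2 \<le> 1 * (x * (cosh 1)\<^sup>2)"
        using s tanh_sq_lt_1[of \<beta>] by (intro mult_mono) auto
      then have d: "1 + (1 - ?t\<^sup>2) * (sinh x)\<^sup>2 \<le> 1 + x * (cosh 1)\<^sup>2" by simp
      have d0: "0 < 1 + (1 - ?t\<^sup>2) * (sinh x)\<^sup>2"
        using tanh_sq_lt_1[of \<beta>] by (intro add_pos_nonneg) auto
      have p: "0 < x * cavity_deriv \<beta> x" unfolding cavity_deriv_def using x t d0 by simp
      have "1 / cavity \<beta> x \<le> 1 / (x * cavity_deriv \<beta> x)"
        using cavity_ge_linear[of \<beta> x] assms x p by (intro divide_left_mono) (auto simp: cavity_pos)
      also have "\<dots> = (1 + (1 - ?t\<^sup>2) * (sinh x)\<^sup>2) / (x * ?t)"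
        unfolding cavity_deriv_def by simp
      also have "\<dots> \<le> (1 + x * (cosh 1)\<^sup>2) / (x * ?t)"
        using d x t by (intro divide_right_mono) auto
      also have "\<dots> = 1 / (?t * x) + (cosh 1)\<^sup>2 / ?t" using x t by (simp add: field_simps)
      also have "\<dots> \<le> 1 / (?t * x) + c" using F1 by (simp add: c_def)
      finally show ?thesis .
    next
      case False
      have "1 / cavity \<beta> x \<le> 1 / cavity \<beta> 1"
        using False assms F1 by (intro divide_left_mono cavity_mono) (auto simp: cavity_pos)
      also have "\<dots> \<le> 1 / (?t * x) + c" using x t by (simp add: c_def)
      finally show ?thesis .
    qed
  qed
qed

text \<open>
  Concavity gives \<open>cavity \<beta> (R * y) \<le> R * cavity \<beta> y\<close>; away from 0 the inequality is strict by a fixed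
  proportion, which makes the ratio of two solutions of the cavity equations contract towards 1.
\<close>

lemma cavity_ratio_contraction:
  assumes "0 < \<beta>" "0 < l"
  obtains \<delta> where "0 < \<delta>" "\<delta> \<le> 1"
    "\<And>R y. 1 \<le> R \<Longrightarrow> l \<le> y \<Longrightarrow> cavity \<beta> (R * y) \<le> (1 + (1 - \<delta>) * (R - 1)) * cavity \<beta> y"
proof -
  define g where "g = cavity \<beta> l - l * cavity_deriv \<beta> l"
  obtain z where z: "0 < z" "z < l" "cavity \<beta> l - cavity \<beta> 0 = (l - 0) * cavity_deriv \<beta> z"
    using cavity_mvt[OF assms(2)] by metis
  have "cavity_deriv \<beta> l < cavity_deriv \<beta> z"
    using assms z by (intro cavity_deriv_strict_antimono) auto
  then have g: "0 < g" using z assms by (simp add: g_def mult_strict_left_mono)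
  have "0 \<le> cavity_deriv \<beta> l" unfolding cavity_deriv_def using assms tanh_sq_lt_1[of \<beta>]
    by (intro divide_nonneg_pos add_pos_nonneg) auto
  then have g1: "g \<le> \<beta>" using cavity_le[of \<beta> l] assms unfolding g_def
    by (smt (verit) mult_nonneg_nonneg)
  show ?thesis
  proof (rule that[of "g / \<beta>"])
    show "0 < g / \<beta>" "g / \<beta> \<le> 1" using g g1 assms by auto
    fix R y :: real assume R: "1 \<le> R" and y: "l \<le> y"
    have gap: "g \<le> cavity \<beta> y - y * cavity_deriv \<beta> y"
    proof (cases "y = l")
      case False
      then have "l < y" using y by simp
      then obtain z where z: "l < z" "z < y" "cavity \<beta> y - cavity \<beta> l = (y - l) * cavity_deriv \<beta> z"
        using cavity_mvt by metis
      have "(y - l) * cavity_deriv \<beta> y \<le> (y - l) * cavity_deriv \<beta> z"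
        using z y assms by (intro mult_left_mono cavity_deriv_antimono) auto
      moreover have "l * cavity_deriv \<beta> y \<le> l * cavity_deriv \<beta> l"
        using y assms by (intro mult_left_mono cavity_deriv_antimono) auto
      ultimately show ?thesis using z unfolding g_def by (simp add: algebra_simps)
    qed (simp add: g_def)
    have "cavity \<beta> (R * y) - cavity \<beta> y \<le> (R - 1) * (y * cavity_deriv \<beta> y)"
    proof (cases "R = 1")
      case False
      then have "y < R * y" using R y assms by auto
      then obtain z where z: "y < z" "cavity \<beta> (R * y) - cavity \<beta> y = (R * y - y) * cavity_deriv \<beta> z"
        using cavity_mvt by metis
      have "(R * y - y) * cavity_deriv \<beta> z \<le> (R * y - y) * cavity_deriv \<beta> y"
        using z y assms \<open>y < R * y\<close> by (intro mult_left_mono cavity_deriv_antimono) auto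
      then show ?thesis using z by (simp add: algebra_simps)
    qed simp
    also have "\<dots> \<le> (R - 1) * (cavity \<beta> y - g)"
      using gap R by (intro mult_left_mono) auto
    also have "\<dots> \<le> (R - 1) * (cavity \<beta> y - g / \<beta> * cavity \<beta> y)"
    proof -
      have "cavity \<beta> y \<le> \<beta>" using assms y by (intro cavity_le) auto
      then have "g / \<beta> * cavity \<beta> y \<le> g / \<beta> * \<beta>" using g assms by (intro mult_left_mono) auto
      then show ?thesis using assms R by (intro mult_left_mono) auto
    qed
    finally show "cavity \<beta> (R * y) \<le> (1 + (1 - g / \<beta>) * (R - 1)) * cavity \<beta> y"
      by (simp add: algebra_simps)
  qed
qed

section \<open>Markov chains indexed by a tree\<close>

definition children :: "'a list set \<Rightarrow> 'a list \<Rightarrow> 'a set" where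
  "children T v = {a. a # v \<in> T}"

definition level :: "'a list set \<Rightarrow> nat \<Rightarrow> 'a list set" where
  "level T r = {v \<in> T. length v = r}"

text \<open>
  For these sets of vertices the joint law of the spins is a product of transition probabilities,
  without any summation over the spins of ancestors.
\<close>

definition ancestor_closed :: "'a list set \<Rightarrow> bool" where
  "ancestor_closed S \<longleftrightarrow> (\<forall>a v. a # v \<in> S \<longrightarrow> v \<in> S)"

lemma ancestor_closed_tl: "ancestor_closed S \<Longrightarrow> v \<in> S \<Longrightarrow> tl v \<in> S"
  by (cases v) (auto simp: ancestor_closed_def)

lemma rooted_tree_Nil: "rooted_tree T \<Longrightarrow> [] \<in> T"
  by (simp add: rooted_tree_def)

lemma rooted_tree_parent: "rooted_tree T \<Longrightarrow> a # v \<in> T \<Longrightarrow> v \<in> T"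
  by (auto simp: rooted_tree_def)

lemma finite_children: "rooted_tree T \<Longrightarrow> finite (children T v)"
proof (cases "v \<in> T")
  case False
  moreover assume "rooted_tree T"
  ultimately have "children T v = {}" by (auto simp: children_def dest: rooted_tree_parent)
  then show ?thesis by simp
qed (simp add: rooted_tree_def children_def)

lemma subtree_mono: "r \<le> t \<Longrightarrow> subtree T r \<subseteq> subtree T t"
  by (auto simp: subtree_def)

lemma subtree_subset: "subtree T r \<subseteq> T"
  by (auto simp: subtree_def)

lemma ancestor_closed_subtree: "rooted_tree T \<Longrightarrow> ancestor_closed (subtree T r)"
  by (auto simp: ancestor_closed_def subtree_def dest: rooted_tree_parent)

lemma subtree_Suc: "subtree T (Suc r) = subtree T r \<union> level T (Suc r)" "subtree T r \<inter> level T (Suc r) = {}"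
  by (auto simp: subtree_def level_def)

lemma level_Suc:
  assumes "rooted_tree T"
  shows "level T (Suc r) = (\<lambda>(v, a). a # v) ` (SIGMA v:level T r. children T v)"
proof -
  have "w \<in> (\<lambda>(v, a). a # v) ` (SIGMA v:level T r. children T v)" if "w \<in> level T (Suc r)" for w
  proof -
    have "length w = Suc r" using that by (simp add: level_def)
    then obtain a v where w: "w = a # v" by (auto simp: length_Suc_conv)
    then have "(v, a) \<in> (SIGMA v:level T r. children T v)"
      using that assms by (auto simp: level_def children_def dest: rooted_tree_parent)
    then show ?thesis using w by force
  qed
  then show ?thesis by (auto simp: level_def children_def)
qed

lemma finite_subtree: "rooted_tree T \<Longrightarrow> finite (subtree T r)"
proof (induction r)
  case 0
  have "subtree T 0 \<subseteq> {[]}" by (auto simp: subtree_def)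
  then show ?case by (rule finite_subset) simp
next
  case (Suc r)
  have "finite (level T r)" by (rule finite_subset[OF _ Suc.IH[OF Suc.prems]]) (auto simp: subtree_def level_def)
  then have "finite (level T (Suc r))"
    unfolding level_Suc[OF Suc.prems] by (intro finite_imageI finite_SigmaI finite_children[OF Suc.prems])
  then show ?case using Suc by (simp add: subtree_Suc)
qed

lemma finite_level: "rooted_tree T \<Longrightarrow> finite (level T r)"
  by (rule finite_subset[OF _ finite_subtree[of T r]]) (auto simp: subtree_def level_def)

lemma sum_level_Suc:
  assumes "rooted_tree T"
  shows "(\<Sum>w\<in>level T (Suc r). f w) = (\<Sum>v\<in>level T r. \<Sum>a\<in>children T v. f (a # v))"
proof -
  have "inj_on (\<lambda>(v, a). a # v) (SIGMA v:level T r. children T v)" by (auto simp: inj_on_def)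
  then have "(\<Sum>w\<in>level T (Suc r). f w) = (\<Sum>(v, a)\<in>(SIGMA v:level T r. children T v). f (a # v))"
    unfolding level_Suc[OF assms] by (subst sum.reindex) (auto simp: case_prod_beta intro!: sum.cong)
  also have "\<dots> = (\<Sum>v\<in>level T r. \<Sum>a\<in>children T v. f (a # v))"
    using assms by (subst sum.Sigma) (auto simp: finite_level finite_children)
  finally show ?thesis .
qed

lemma finite_subset_subtree:
  assumes "finite A" "A \<subseteq> T"
  obtains r where "A \<subseteq> subtree T r"
proof
  show "A \<subseteq> subtree T (Max (length ` A))" using assms by (auto simp: subtree_def)
qed

text \<open>
  A single spin in the field \<open>b\<close>, and the field that a vertex feels when its parent has spin \<open>s\<close> and
  its descendants contribute \<open>h v\<close>. The root has no parent.
\<close>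

definition spin_prob :: "real \<Rightarrow> real \<Rightarrow> real" where
  "spin_prob b y = exp (b * y) / (2 * cosh b)"

definition local_field :: "real \<Rightarrow> ('a list \<Rightarrow> real) \<Rightarrow> 'a list \<Rightarrow> real \<Rightarrow> real" where
  "local_field \<beta> h v s = (if v = [] then h v else \<beta> * s + h v)"

definition parent_spin :: "('a list \<Rightarrow> real) \<Rightarrow> 'a list \<Rightarrow> real" where
  "parent_spin x v = (if v = [] then 1 else x (tl v))"

definition chain_weight :: "real \<Rightarrow> ('a list \<Rightarrow> real) \<Rightarrow> 'a list set \<Rightarrow> ('a list \<Rightarrow> real) \<Rightarrow> real" where
  "chain_weight \<beta> h S x = (\<Prod>v\<in>S. spin_prob (local_field \<beta> h v (parent_spin x v)) (x v))"

lemma spin_prob_pos: "0 < spin_prob b y"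
  by (simp add: spin_prob_def cosh_real_pos)

lemma spin_prob_sum: "spin_prob b 1 + spin_prob b (-1) = 1"
proof -
  have "spin_prob b 1 + spin_prob b (-1) = (exp b + exp (- b)) / (2 * cosh b)"
    by (simp add: spin_prob_def add_divide_distrib)
  also have "exp b + exp (- b) = 2 * cosh b" by (simp add: cosh_def)
  finally show ?thesis using cosh_real_pos[of b] by simp
qed

lemma spin_prob_le_1: "spin_prob b 1 \<le> 1"
  using spin_prob_sum[of b] spin_prob_pos[of b "-1"] by simp

lemma chain_weight_cong:
  assumes "ancestor_closed S" "\<And>v. v \<in> S \<Longrightarrow> x v = y v"
  shows "chain_weight \<beta> h S x = chain_weight \<beta> h S y"
  unfolding chain_weight_def parent_spin_def
  using assms ancestor_closed_tl[OF assms(1)] by (intro prod.cong) auto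

text \<open>
  The Markov chain with these transition probabilities is run from independent coins: each vertex
  tosses one coin for either value of its parent's spin.
\<close>

definition coins :: "real \<Rightarrow> ('a list \<Rightarrow> real) \<Rightarrow> 'a list \<Rightarrow> (bool \<times> bool) pmf" where
  "coins \<beta> h v =
     pair_pmf (bernoulli_pmf (spin_prob (local_field \<beta> h v 1) 1))
              (bernoulli_pmf (spin_prob (local_field \<beta> h v (-1)) 1))"

primrec chain_spin :: "('a list \<Rightarrow> bool \<times> bool) \<Rightarrow> 'a list \<Rightarrow> real" where
  "chain_spin \<omega> [] = (if fst (\<omega> []) then 1 else -1)"
| "chain_spin \<omega> (a # v) =
     (if (if chain_spin \<omega> v = 1 then fst (\<omega> (a # v)) else snd (\<omega> (a # v))) then 1 else -1)"

definition tree_chain :: "real \<Rightarrow> 'a list set \<Rightarrow> ('a list \<Rightarrow> real) \<Rightarrow> ('a list \<Rightarrow> real) measure" where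
  "tree_chain \<beta> T h =
     distr (\<Pi>\<^sub>M v\<in>T. measure_pmf (coins \<beta> h v)) (spin_space T) (\<lambda>\<omega>. restrict (chain_spin \<omega>) T)"

lemma space_spin_space: "space (spin_space T) = T \<rightarrow>\<^sub>E {-1, 1}"
  by (simp add: spin_space_def space_PiM)

lemma chain_spin_values: "chain_spin \<omega> v = 1 \<or> chain_spin \<omega> v = -1"
  by (cases v) auto

lemma measurable_chain_spin:
  assumes "rooted_tree T"
  shows "(\<lambda>\<omega>. restrict (chain_spin \<omega>) T) \<in> measurable (\<Pi>\<^sub>M v\<in>T. measure_pmf (coins \<beta> h v)) (spin_space T)"
proof -
  let ?M = "\<Pi>\<^sub>M v\<in>T. measure_pmf (coins \<beta> h v)"
  have coin: "(\<lambda>\<omega>. \<omega> v) \<in> measurable ?M (count_space UNIV)" if "v \<in> T" for v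
    using measurable_component_singleton[OF that, of "\<lambda>v. measure_pmf (coins \<beta> h v)"] by simp
  have *: "(\<lambda>\<omega>. chain_spin \<omega> v) \<in> measurable ?M (count_space {-1, 1})" if "v \<in> T" for v
    using that
  proof (induction v)
    case Nil
    have "(\<lambda>\<omega>. (\<lambda>b. if fst b then 1 else -1) (\<omega> [])) \<in> measurable ?M (count_space {-1, 1 :: real})"
      by (rule measurable_compose[OF coin[OF Nil]]) auto
    then show ?case by simp
  next
    case (Cons a v)
    have v: "(\<lambda>\<omega>. chain_spin \<omega> v) \<in> measurable ?M (count_space {-1, 1})"
      using Cons rooted_tree_parent[OF assms] by blast
    have "(\<lambda>\<omega>. (\<lambda>(s, b). if (if s = 1 then fst b else snd b) then 1 else -1) (chain_spin \<omega> v, \<omega> (a # v)))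
        \<in> measurable ?M (count_space {-1, 1 :: real})"
    proof (rule measurable_compose[OF measurable_Pair[OF v coin[OF Cons.prems]]])
      show "(\<lambda>(s, b). if (if s = 1 then fst b else snd b) then 1 else -1)
          \<in> measurable (count_space {-1, 1 :: real} \<Otimes>\<^sub>M count_space (UNIV :: (bool \<times> bool) set)) (count_space {-1, 1 :: real})"
        by (subst pair_measure_countable) (auto split: if_splits)
    qed
    then show ?case by simp
  qed
  show ?thesis unfolding spin_space_def
    by (rule measurable_restrict) (rule *)
qed

lemma prob_space_tree_chain: "rooted_tree T \<Longrightarrow> prob_space (tree_chain \<beta> T h)"
  unfolding tree_chain_def
  by (intro prob_space.prob_space_distr measurable_chain_spin prob_space_PiM measure_pmf.prob_space_axioms)

lemma sets_tree_chain [simp]: "sets (tree_chain \<beta> T h) = sets (spin_space T)"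
  by (simp add: tree_chain_def)

lemma space_tree_chain: "space (tree_chain \<beta> T h) = T \<rightarrow>\<^sub>E {-1, 1}"
  by (simp add: tree_chain_def space_spin_space)

lemma measure_coins:
  assumes "s \<in> {-1, 1}" "y \<in> {-1, 1}"
  shows "measure (measure_pmf (coins \<beta> h v)) {b. (if (if s = 1 then fst b else snd b) then 1 else -1) = y} =
    spin_prob (local_field \<beta> h v s) y"
proof -
  let ?q = "\<lambda>s. spin_prob (local_field \<beta> h v s) 1"
  have q: "0 \<le> ?q s" "?q s \<le> 1" for s
    using spin_prob_le_1 spin_prob_pos less_imp_le by blast+
  have b: "pmf (bernoulli_pmf (?q s)) (y = 1) = spin_prob (local_field \<beta> h v s) y" for s
    using assms q[of s] spin_prob_sum[of "local_field \<beta> h v s"] by auto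
  have y: "((if c then 1 else - 1) = y) = (c = (y = 1))" for c using assms by auto
  show ?thesis
  proof (cases "s = 1")
    case True
    have "measure (measure_pmf (coins \<beta> h v)) {b. fst b = (y = 1)} = measure (measure_pmf (map_pmf fst (coins \<beta> h v))) {y = 1}"
      by (simp add: vimage_def)
    also have "\<dots> = pmf (bernoulli_pmf (?q 1)) (y = 1)"
      unfolding coins_def map_fst_pair_pmf by (simp only: pmf.rep_eq)
    finally show ?thesis using True b y by simp
  next
    case False
    have "measure (measure_pmf (coins \<beta> h v)) {b. snd b = (y = 1)} = measure (measure_pmf (map_pmf snd (coins \<beta> h v))) {y = 1}"
      by (simp add: vimage_def)
    also have "\<dots> = pmf (bernoulli_pmf (?q (-1))) (y = 1)"
      unfolding coins_def map_snd_pair_pmf by (simp only: pmf.rep_eq)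
    finally show ?thesis using False b y assms by auto
  qed
qed

abbreviation cylinder :: "'a list set \<Rightarrow> 'a list set \<Rightarrow> ('a list \<Rightarrow> real) \<Rightarrow> ('a list \<Rightarrow> real) set" where
  "cylinder T A s \<equiv> {x \<in> T \<rightarrow>\<^sub>E {-1, 1}. \<forall>v\<in>A. x v = s v}"

lemma cylinder_in_sets:
  assumes "finite S" "S \<subseteq> T"
  shows "cylinder T S s \<in> sets (spin_space T)"
proof -
  have "cylinder T S s = {x \<in> space (spin_space T). \<forall>v\<in>S. x v \<in> {s v} \<inter> {-1, 1}}"
    using assms unfolding space_spin_space by (auto dest: PiE_mem)
  also have "\<dots> \<in> sets (spin_space T)"
    unfolding spin_space_def
  proof (rule sets.sets_Collect_finite_All[OF _ assms(1)])
    fix v assume "v \<in> S"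
    then have "(\<lambda>x. x v) \<in> measurable (PiM T (\<lambda>v. count_space {-1, 1})) (count_space {-1, 1 :: real})"
      using measurable_component_singleton[of v T "\<lambda>_. count_space {-1, 1}"] assms by auto
    then show "{x \<in> space (PiM T (\<lambda>v. count_space {-1, 1})). x v \<in> {s v} \<inter> {-1, 1}} \<in> sets (PiM T (\<lambda>v. count_space {-1, 1}))"
      by (rule measurable_sets_Collect) auto
  qed
  finally show ?thesis .
qed

lemma measure_tree_chain_cylinder:
  assumes T: "rooted_tree T" and S: "finite S" "S \<subseteq> T" "ancestor_closed S" and s: "\<And>v. v \<in> S \<Longrightarrow> s v \<in> {-1, 1}"
  shows "measure (tree_chain \<beta> T h) (cylinder T S s) = chain_weight \<beta> h S s"
proof -
  let ?M = "\<Pi>\<^sub>M v\<in>T. measure_pmf (coins \<beta> h v)"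
  interpret product_prob_space "\<lambda>v. measure_pmf (coins \<beta> h v)" T
    by unfold_locales
  define B where "B v = {b. (if (if parent_spin s v = 1 then fst b else snd b) then 1 else -1) = s v}" for v
  have rec: "chain_spin \<omega> v =
      (if (if parent_spin (chain_spin \<omega>) v = 1 then fst (\<omega> v) else snd (\<omega> v)) then 1 else -1)" for \<omega> :: "'a list \<Rightarrow> bool \<times> bool" and v
    by (cases v) (auto simp: parent_spin_def)
  \<comment> \<open>given the prescribed spin of the parent, only one of the two coins of \<open>v\<close> matters\<close>
  have eq: "(\<forall>v\<in>S. chain_spin \<omega> v = s v) \<longleftrightarrow> (\<forall>v\<in>S. \<omega> v \<in> B v)" for \<omega>
  proof
    assume l: "\<forall>v\<in>S. chain_spin \<omega> v = s v"
    show "\<forall>v\<in>S. \<omega> v \<in> B v"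
    proof
      fix v assume v: "v \<in> S"
      have "parent_spin (chain_spin \<omega>) v = parent_spin s v"
        using l ancestor_closed_tl[OF S(3) v] by (simp add: parent_spin_def)
      then show "\<omega> v \<in> B v" using l v rec[of \<omega> v] by (simp add: B_def)
    qed
  next
    assume r: "\<forall>v\<in>S. \<omega> v \<in> B v"
    show "\<forall>v\<in>S. chain_spin \<omega> v = s v"
    proof
      fix v show "v \<in> S \<Longrightarrow> chain_spin \<omega> v = s v"
      proof (induction v rule: length_induct)
        case (1 v)
        have "parent_spin (chain_spin \<omega>) v = parent_spin s v"
          using 1 ancestor_closed_tl[OF S(3) 1(2)] by (cases v) (auto simp: parent_spin_def)
        then show ?case using r 1(2) rec[of \<omega> v] by (simp add: B_def)
      qed
    qed
  qed
  let ?C = "cylinder T S s"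
  have "(\<lambda>\<omega>. restrict (chain_spin \<omega>) T) -` ?C \<inter> space ?M = {\<omega> \<in> space ?M. \<forall>v\<in>S. \<omega> v \<in> B v}"
    using S(2) chain_spin_values by (auto simp: eq[symmetric] subset_iff PiE_iff)
  then have "measure (tree_chain \<beta> T h) ?C = measure ?M {\<omega> \<in> space ?M. \<forall>v\<in>S. \<omega> v \<in> B v}"
    unfolding tree_chain_def by (subst measure_distr[OF measurable_chain_spin[OF T] cylinder_in_sets[OF S(1,2)]]) simp
  also have "\<dots> = (\<Prod>v\<in>S. measure (measure_pmf (coins \<beta> h v)) (B v))"
    using emeasure_PiM_Collect[OF S(2,1), of B]
    by (simp add: emeasure_eq_measure measure_pmf.emeasure_eq_measure prod_ennreal prod_nonneg)
  also have "\<dots> = chain_weight \<beta> h S s"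
    unfolding chain_weight_def B_def
  proof (intro prod.cong refl measure_coins s)
    fix v assume "v \<in> S"
    then show "parent_spin s v \<in> {-1, 1}" using s ancestor_closed_tl[OF S(3)] by (auto simp: parent_spin_def)
  qed
  finally show ?thesis .
qed

lemma integral_tree_chain:
  fixes g :: "('a list \<Rightarrow> real) \<Rightarrow> real"
  assumes T: "rooted_tree T" and S: "finite S" "S \<subseteq> T" "ancestor_closed S"
  shows "(\<integral>x. g (restrict x S) \<partial>tree_chain \<beta> T h) = (\<Sum>y\<in>S \<rightarrow>\<^sub>E {-1, 1}. g y * chain_weight \<beta> h S y)"
proof -
  interpret prob_space "tree_chain \<beta> T h" by (rule prob_space_tree_chain[OF T])
  let ?C = "\<lambda>y. cylinder T S y"
  have fin: "finite (S \<rightarrow>\<^sub>E {-1, 1 :: real})" using S by (intro finite_PiE) auto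
  have [measurable]: "?C y \<in> sets (tree_chain \<beta> T h)" for y
    using cylinder_in_sets[OF S(1,2)] by simp
  have "(\<integral>x. g (restrict x S) \<partial>tree_chain \<beta> T h) =
      (\<integral>x. (\<Sum>y\<in>S \<rightarrow>\<^sub>E {-1, 1}. g y * indicator (?C y) x) \<partial>tree_chain \<beta> T h)"
  proof (rule Bochner_Integration.integral_cong[OF refl])
    fix x assume "x \<in> space (tree_chain \<beta> T h)"
    then have x: "x \<in> T \<rightarrow>\<^sub>E {-1, 1}" by (simp add: space_tree_chain)
    have r: "restrict x S \<in> S \<rightarrow>\<^sub>E {-1, 1}" using x S by (auto dest: PiE_mem)
    have "(\<Sum>y\<in>S \<rightarrow>\<^sub>E {-1, 1}. g y * indicator (?C y) x) = (\<Sum>y\<in>S \<rightarrow>\<^sub>E {-1, 1}. if y = restrict x S then g y else 0)"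
    proof (intro sum.cong refl)
      fix y assume y: "y \<in> S \<rightarrow>\<^sub>E {-1, 1 :: real}"
      have "(\<forall>v\<in>S. x v = y v) \<longleftrightarrow> y = restrict x S"
        using PiE_ext[OF y r] by auto
      then show "g y * indicator (?C y) x = (if y = restrict x S then g y else 0)"
        using x by (auto simp: indicator_def)
    qed
    then show "g (restrict x S) = (\<Sum>y\<in>S \<rightarrow>\<^sub>E {-1, 1}. g y * indicator (?C y) x)"
      using fin r by simp
  qed
  also have "\<dots> = (\<Sum>y\<in>S \<rightarrow>\<^sub>E {-1, 1}. g y * measure (tree_chain \<beta> T h) (?C y))"
  proof -
    have i: "integrable (tree_chain \<beta> T h) (indicator (?C y) :: _ \<Rightarrow> real)" for y
      by (rule integrable_real_indicator) (use cylinder_in_sets[OF S(1,2)] in \<open>auto simp: emeasure_eq_measure\<close>)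
    have c: "?C y \<inter> space (tree_chain \<beta> T h) = ?C y" for y
      unfolding space_tree_chain by blast
    show ?thesis
      by (subst Bochner_Integration.integral_sum) (simp_all add: i c)
  qed
  also have "\<dots> = (\<Sum>y\<in>S \<rightarrow>\<^sub>E {-1, 1}. g y * chain_weight \<beta> h S y)"
    by (intro sum.cong refl arg_cong2[where f = "(*)"] measure_tree_chain_cylinder T S) (auto dest: PiE_mem)
  finally show ?thesis .
qed

lemma sum_chain_weight:
  assumes "rooted_tree T" "finite S" "S \<subseteq> T" "ancestor_closed S"
  shows "(\<Sum>y\<in>S \<rightarrow>\<^sub>E {-1, 1}. chain_weight \<beta> h S y) = 1"
  using integral_tree_chain[OF assms, where g = "\<lambda>_. 1" and \<beta> = \<beta> and h = h] prob_space.prob_space[OF prob_space_tree_chain[OF assms(1), of \<beta> h]]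
  by simp

lemma measure_tree_chain:
  assumes T: "rooted_tree T" and S: "finite S" "S \<subseteq> T" "ancestor_closed S" and A: "A \<subseteq> S"
  shows "measure (tree_chain \<beta> T h) (cylinder T A s) =
    (\<Sum>y\<in>cylinder S A s. chain_weight \<beta> h S y)"
proof -
  interpret prob_space "tree_chain \<beta> T h" by (rule prob_space_tree_chain[OF T])
  let ?C = "cylinder T A s"
  have C: "?C \<in> events" using cylinder_in_sets[of A T s] S A finite_subset by auto
  have fin: "finite (S \<rightarrow>\<^sub>E {-1, 1 :: real})" using S by (intro finite_PiE) auto
  have "measure (tree_chain \<beta> T h) ?C = (\<integral>x. (if \<forall>v\<in>A. restrict x S v = s v then 1 else 0) \<partial>tree_chain \<beta> T h)"
  proof -
    have "measure (tree_chain \<beta> T h) ?C = (\<integral>x. indicator ?C x \<partial>tree_chain \<beta> T h)"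
      using C sets.sets_into_space[OF C] by (simp add: Int_absorb2 space_tree_chain)
    also have "\<dots> = (\<integral>x. (if \<forall>v\<in>A. restrict x S v = s v then 1 else 0) \<partial>tree_chain \<beta> T h)"
      using A by (intro Bochner_Integration.integral_cong) (auto simp: space_tree_chain indicator_def subset_iff)
    finally show ?thesis .
  qed
  also have "\<dots> = (\<Sum>y\<in>S \<rightarrow>\<^sub>E {-1, 1}. (if \<forall>v\<in>A. y v = s v then 1 else 0) * chain_weight \<beta> h S y)"
    by (rule integral_tree_chain[OF T S])
  also have "\<dots> = (\<Sum>y\<in>S \<rightarrow>\<^sub>E {-1, 1}. if \<forall>v\<in>A. y v = s v then chain_weight \<beta> h S y else 0)"
    by (intro sum.cong) auto
  also have "\<dots> = (\<Sum>y\<in>cylinder S A s. chain_weight \<beta> h S y)"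
    by (rule sum.inter_filter[symmetric, OF fin])
  finally show ?thesis .
qed

section \<open>Ising measures on trees are Markov chains\<close>

lemma measure_eqI_cylinders:
  assumes sets: "sets \<mu> = sets (spin_space T)" "sets \<nu> = sets (spin_space T)"
    and prob: "prob_space \<mu>" "prob_space \<nu>"
    and cyl: "\<And>A s. finite A \<Longrightarrow> A \<subseteq> T \<Longrightarrow>
      measure \<mu> (cylinder T A s) = measure \<nu> (cylinder T A s)"
  shows "\<mu> = \<nu>"
proof (rule measure_eqI_PiM_infinite[where I = T and M = "\<lambda>_. count_space {-1, 1 :: real}"])
  interpret \<mu>: prob_space \<mu> by fact
  interpret \<nu>: prob_space \<nu> by fact
  show "sets \<mu> = sets (PiM T (\<lambda>_. count_space {-1, 1}))" "sets \<nu> = sets (PiM T (\<lambda>_. count_space {-1, 1}))"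
    using sets by (simp_all add: spin_space_def)
  show "finite_measure \<mu>" by unfold_locales
  fix B J assume J: "finite J" "J \<subseteq> T" and B: "\<And>i. i \<in> J \<Longrightarrow> B i \<in> sets (count_space {-1, 1 :: real})"
  let ?C = "\<lambda>s. {x \<in> T \<rightarrow>\<^sub>E {-1, 1 :: real}. \<forall>v\<in>J. x v = s v}"
  have fin: "finite (Pi\<^sub>E J B)"
    using J B by (intro finite_PiE) (auto intro: finite_subset)
  have eq: "prod_emb T (\<lambda>_. count_space {-1, 1}) J (Pi\<^sub>E J B) = (\<Union>s\<in>Pi\<^sub>E J B. ?C s)"
  proof (intro set_eqI iffI)
    fix x assume "x \<in> prod_emb T (\<lambda>_. count_space {-1, 1 :: real}) J (Pi\<^sub>E J B)"
    then have "x \<in> T \<rightarrow>\<^sub>E {-1, 1}" "restrict x J \<in> Pi\<^sub>E J B" by (auto simp: prod_emb_def space_PiM)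
    then show "x \<in> (\<Union>s\<in>Pi\<^sub>E J B. ?C s)" by (intro UN_I[of "restrict x J"]) auto
  next
    fix x assume "x \<in> (\<Union>s\<in>Pi\<^sub>E J B. ?C s)"
    then show "x \<in> prod_emb T (\<lambda>_. count_space {-1, 1 :: real}) J (Pi\<^sub>E J B)"
      by (auto simp: prod_emb_def space_PiM PiE_iff)
  qed
  have disj: "disjoint_family_on ?C (Pi\<^sub>E J B)"
    unfolding disjoint_family_on_def
  proof (intro ballI impI)
    fix s t assume st: "s \<in> Pi\<^sub>E J B" "t \<in> Pi\<^sub>E J B" "s \<noteq> t"
    then obtain v where "v \<in> J" "s v \<noteq> t v" by (meson PiE_ext)
    then show "?C s \<inter> ?C t = {}" by auto
  qed
  have C: "?C s \<in> sets (spin_space T)" for s by (rule cylinder_in_sets[OF J])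
  have "measure \<mu> (\<Union>s\<in>Pi\<^sub>E J B. ?C s) = (\<Sum>s\<in>Pi\<^sub>E J B. measure \<mu> (?C s))"
    using fin disj C sets by (intro \<mu>.finite_measure_finite_Union) auto
  also have "\<dots> = (\<Sum>s\<in>Pi\<^sub>E J B. measure \<nu> (?C s))" by (intro sum.cong refl cyl J)
  also have "\<dots> = measure \<nu> (\<Union>s\<in>Pi\<^sub>E J B. ?C s)"
    using fin disj C sets by (intro \<nu>.finite_measure_finite_Union[symmetric]) auto
  finally show "emeasure \<mu> (prod_emb T (\<lambda>_. count_space {-1, 1}) J (Pi\<^sub>E J B)) =
      emeasure \<nu> (prod_emb T (\<lambda>_. count_space {-1, 1}) J (Pi\<^sub>E J B))"
    unfolding eq by (simp add: \<mu>.emeasure_eq_measure \<nu>.emeasure_eq_measure)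
qed

lemma sum_prod_edges:
  assumes "[] \<notin> V"
  shows "(\<Sum>e\<in>(\<lambda>v. {tl v, v}) ` V. \<Prod>w\<in>e. x w) = (\<Sum>v\<in>V. x (tl v) * x v :: real)"
proof -
  have ne: "tl v \<noteq> v" if "v \<noteq> []" for v :: "'a list" using that by (cases v) auto
  have "inj_on (\<lambda>v. {tl v, v}) V"
  proof (rule inj_onI)
    fix v w assume vw: "v \<in> V" "w \<in> V" "{tl v, v} = {tl w, w}"
    have "length (tl v) < length v" "length (tl w) < length w"
    proof -
      have "v \<noteq> []" "w \<noteq> []" using vw assms by auto
      then show "length (tl v) < length v" "length (tl w) < length w" by simp_all
    qed
    then show "v = w" using vw(3) by (metis doubleton_eq_iff less_asym)
  qed
  moreover have "prod x {tl v, v} = x (tl v) * x v" if "v \<in> V" for v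
    using that assms ne[of v] by (cases "v = []") auto
  ultimately show ?thesis by (simp add: sum.reindex)
qed

lemma edges_eq_image: "edges S = (\<lambda>v. {tl v, v}) ` (S - {[]})"
  by (auto simp: edges_def)

lemma ising_weight_edges:
  "ising_weight \<beta> (edges S) x = exp (\<beta> * (\<Sum>v\<in>S - {[]}. x (tl v) * x v))"
  unfolding ising_weight_def edges_eq_image by (subst sum_prod_edges) auto

definition incoming :: "'a list set \<Rightarrow> ('a list \<Rightarrow> real) \<Rightarrow> 'a list \<Rightarrow> real" where
  "incoming T f v = (\<Sum>a\<in>children T v. f (a # v))"

text \<open>
  Summing out the spin of a child in the field \<open>h\<close> multiplies the weight of its parent's spin \<open>s\<close>
  by a constant times \<open>exp (s * cavity \<beta> h)\<close>. If \<open>h\<close> solves the cavity equations, the normalizing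
  factors of the chain therefore cancel against the fields of the parents, and only the fields on
  the last level survive.
\<close>

lemma chain_weight_subtree:
  assumes T: "rooted_tree T"
    and h: "\<And>v. v \<in> T \<Longrightarrow> length v < r \<Longrightarrow> h v = incoming T (\<lambda>w. cavity \<beta> (h w)) v"
  obtains C where "C > 0"
    "\<And>s. (\<And>v. v \<in> subtree T r \<Longrightarrow> s v \<in> {-1, 1}) \<Longrightarrow> chain_weight \<beta> h (subtree T r) s =
       C * exp (\<beta> * (\<Sum>v\<in>subtree T r - {[]}. s (tl v) * s v) + (\<Sum>v\<in>level T r. h v * s v))"
proof -
  have "\<exists>C>0. \<forall>s. (\<forall>v\<in>subtree T r. s v \<in> {-1, 1}) \<longrightarrow> chain_weight \<beta> h (subtree T r) s =
       C * exp (\<beta> * (\<Sum>v\<in>subtree T r - {[]}. s (tl v) * s v) + (\<Sum>v\<in>level T r. h v * s v))"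
    using h
  proof (induction r)
    case 0
    have "subtree T 0 = {[]}" "level T 0 = {[]}"
      using rooted_tree_Nil[OF T] by (auto simp: subtree_def level_def)
    then show ?case
      by (intro exI[of _ "1 / (2 * cosh (h []))"])
        (simp add: chain_weight_def spin_prob_def local_field_def cosh_real_pos)
  next
    case (Suc r)
    then have "\<exists>C>0. \<forall>s. (\<forall>v\<in>subtree T r. s v \<in> {-1, 1}) \<longrightarrow> chain_weight \<beta> h (subtree T r) s =
       C * exp (\<beta> * (\<Sum>v\<in>subtree T r - {[]}. s (tl v) * s v) + (\<Sum>v\<in>level T r. h v * s v))"
      using less_SucI by blast
    then obtain C where C: "C > 0" "\<And>s. (\<forall>v\<in>subtree T r. s v \<in> {-1, 1}) \<Longrightarrow> chain_weight \<beta> h (subtree T r) s =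
       C * exp (\<beta> * (\<Sum>v\<in>subtree T r - {[]}. s (tl v) * s v) + (\<Sum>v\<in>level T r. h v * s v))"
      by blast
    have "\<forall>v. \<exists>A>0. cosh (\<beta> + h v) = A * exp (cavity \<beta> (h v)) \<and> cosh (- \<beta> + h v) = A * exp (- cavity \<beta> (h v))"
      by (metis cosh_add_cavity)
    then obtain A where A: "\<And>v. A v > 0" "\<And>v. cosh (\<beta> + h v) = A v * exp (cavity \<beta> (h v))"
      "\<And>v. cosh (- \<beta> + h v) = A v * exp (- cavity \<beta> (h v))" by metis
    let ?L = "level T (Suc r)"
    define D where "D = (\<Prod>v\<in>?L. 2 * A v)"
    have D: "D > 0" unfolding D_def by (intro prod_pos ballI) (simp add: A)
    have "chain_weight \<beta> h (subtree T (Suc r)) s = C / D *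
        exp (\<beta> * (\<Sum>v\<in>subtree T (Suc r) - {[]}. s (tl v) * s v) + (\<Sum>v\<in>?L. h v * s v))"
      if s: "\<forall>v\<in>subtree T (Suc r). s v \<in> {-1, 1}" for s
    proof -
      have p: "s (tl v) \<in> {-1, 1}" if "v \<in> ?L" for v
        using s that ancestor_closed_tl[OF ancestor_closed_subtree[OF T], of v "Suc r"]
        by (auto simp: subtree_Suc)
      have one: "spin_prob (local_field \<beta> h v (parent_spin s v)) (s v) =
          exp (\<beta> * (s (tl v) * s v) + h v * s v - s (tl v) * cavity \<beta> (h v)) / (2 * A v)" if "v \<in> ?L" for v
      proof -
        have v: "v \<noteq> []" using that by (auto simp: level_def)
        have "cosh (\<beta> * s (tl v) + h v) = A v * exp (s (tl v) * cavity \<beta> (h v))"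
          using p[OF that] A(2,3)[of v] by auto
        then show ?thesis using v
          by (simp add: spin_prob_def local_field_def parent_spin_def exp_diff algebra_simps)
      qed
      have "(\<Prod>v\<in>?L. spin_prob (local_field \<beta> h v (parent_spin s v)) (s v)) =
          exp (\<Sum>v\<in>?L. \<beta> * (s (tl v) * s v) + h v * s v - s (tl v) * cavity \<beta> (h v)) / D"
        unfolding D_def exp_sum[OF finite_level[OF T]] prod_dividef[symmetric]
        by (intro prod.cong refl one)
      also have "(\<Sum>v\<in>?L. \<beta> * (s (tl v) * s v) + h v * s v - s (tl v) * cavity \<beta> (h v)) =
          \<beta> * (\<Sum>v\<in>?L. s (tl v) * s v) + (\<Sum>v\<in>?L. h v * s v) - (\<Sum>v\<in>?L. s (tl v) * cavity \<beta> (h v))"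
        by (simp add: sum.distrib sum_subtractf sum_distrib_left)
      also have "(\<Sum>v\<in>?L. s (tl v) * cavity \<beta> (h v)) = (\<Sum>v\<in>level T r. h v * s v)"
        unfolding sum_level_Suc[OF T]
      proof (intro sum.cong refl)
        fix v assume "v \<in> level T r"
        then show "(\<Sum>a\<in>children T v. s (tl (a # v)) * cavity \<beta> (h (a # v))) = h v * s v"
          using Suc.prems[of v] by (simp add: level_def incoming_def sum_distrib_left sum_distrib_right mult.commute)
      qed
      finally have new: "(\<Prod>v\<in>?L. spin_prob (local_field \<beta> h v (parent_spin s v)) (s v)) =
          exp (\<beta> * (\<Sum>v\<in>?L. s (tl v) * s v) + (\<Sum>v\<in>?L. h v * s v) - (\<Sum>v\<in>level T r. h v * s v)) / D" .
      have old: "chain_weight \<beta> h (subtree T r) s =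
          C * exp (\<beta> * (\<Sum>v\<in>subtree T r - {[]}. s (tl v) * s v) + (\<Sum>v\<in>level T r. h v * s v))"
        using s by (intro C(2)) (auto simp: subtree_Suc)
      have split: "(\<Sum>v\<in>subtree T (Suc r) - {[]}. s (tl v) * s v) =
          (\<Sum>v\<in>subtree T r - {[]}. s (tl v) * s v) + (\<Sum>v\<in>?L. s (tl v) * s v)"
      proof -
        have "subtree T (Suc r) - {[]} = (subtree T r - {[]}) \<union> ?L"
          by (auto simp: subtree_Suc level_def)
        then show ?thesis using subtree_Suc(2)[of T r]
          by (simp add: sum.union_disjoint finite_subtree[OF T] finite_level[OF T] Diff_Int_distrib2)
      qed
      have "chain_weight \<beta> h (subtree T (Suc r)) s = chain_weight \<beta> h (subtree T r) s *
          (\<Prod>v\<in>?L. spin_prob (local_field \<beta> h v (parent_spin s v)) (s v))"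
        unfolding chain_weight_def subtree_Suc(1)
        by (rule prod.union_disjoint[OF finite_subtree[OF T] finite_level[OF T] subtree_Suc(2)])
      then show ?thesis
        unfolding new old split by (simp add: exp_add exp_diff algebra_simps)
    qed
    then show ?case using C(1) D by (intro exI[of _ "C / D"]) auto
  qed
  then show ?thesis using that by blast
qed

text \<open>
  \<open>message w \<beta> T n v\<close> is the field that \<open>v\<close> exerts on its parent when the vertices \<open>n\<close> levels
  further down exert the field \<open>w\<close>. For \<open>w = \<beta>\<close> these vertices have spin 1.
\<close>

primrec message :: "real \<Rightarrow> real \<Rightarrow> 'a list set \<Rightarrow> nat \<Rightarrow> 'a list \<Rightarrow> real" where
  "message w \<beta> T 0 = (\<lambda>v. w)"
| "message w \<beta> T (Suc n) = (\<lambda>v. cavity \<beta> (incoming T (message w \<beta> T n) v))"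

definition plus_message :: "real \<Rightarrow> 'a list set \<Rightarrow> 'a list \<Rightarrow> real" where
  "plus_message \<beta> T v = lim (\<lambda>n. message \<beta> \<beta> T n v)"

lemma incoming_nonneg: "(\<And>v. 0 \<le> f v) \<Longrightarrow> 0 \<le> incoming T f v"
  unfolding incoming_def by (intro sum_nonneg)

lemma message_nonneg: "0 \<le> w \<Longrightarrow> 0 \<le> \<beta> \<Longrightarrow> 0 \<le> message w \<beta> T n v"
  by (induction n arbitrary: v) (auto intro!: cavity_nonneg incoming_nonneg)

lemma message_le: "0 \<le> w \<Longrightarrow> w \<le> \<beta> \<Longrightarrow> message w \<beta> T n v \<le> \<beta>"
  by (cases n) (auto intro!: cavity_le incoming_nonneg message_nonneg)

lemma incoming_mono:
  assumes "rooted_tree T'" "T \<subseteq> T'" "\<And>v. f v \<le> g v" "\<And>v. 0 \<le> g v"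
  shows "incoming T f v \<le> incoming T' g v"
proof -
  have "incoming T f v \<le> incoming T g v" unfolding incoming_def using assms by (intro sum_mono)
  also have "\<dots> \<le> incoming T' g v" unfolding incoming_def using assms
    by (intro sum_mono2 finite_children) (auto simp: children_def)
  finally show ?thesis .
qed

text \<open>
  The case of the Griffiths inequalities that is needed: larger trees, couplings and boundary fields
  increase the fields.
\<close>

lemma message_mono:
  assumes "rooted_tree T'" "T \<subseteq> T'" "0 \<le> w" "w \<le> w'" "0 \<le> \<beta>" "\<beta> \<le> \<beta>'"
  shows "message w \<beta> T n v \<le> message w' \<beta>' T' n v"
  using assms
  by (induction n arbitrary: v)
    (auto intro!: cavity_mono incoming_mono incoming_nonneg message_nonneg)

lemma decseq_message:
  assumes "rooted_tree T" "0 \<le> \<beta>"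
  shows "decseq (\<lambda>n. message \<beta> \<beta> T n v)"
proof (rule decseq_SucI)
  fix n show "message \<beta> \<beta> T (Suc n) v \<le> message \<beta> \<beta> T n v"
  proof (induction n arbitrary: v)
    case 0
    show ?case using assms by (simp add: cavity_le incoming_nonneg)
  next
    case (Suc n)
    show ?case
      unfolding message.simps(2)[of _ _ _ "Suc n"] message.simps(2)[of _ _ _ n]
      using assms Suc by (intro cavity_mono incoming_mono) (auto intro!: incoming_nonneg message_nonneg cavity_nonneg)
  qed
qed

lemma message_tendsto:
  assumes "rooted_tree T" "0 \<le> \<beta>"
  shows "(\<lambda>n. message \<beta> \<beta> T n v) \<longlonglongrightarrow> plus_message \<beta> T v"
proof -
  have "convergent (\<lambda>n. message \<beta> \<beta> T n v)"
    using decseq_message[OF assms] message_nonneg[OF assms(2,2)]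
    by (intro Bseq_monoseq_convergent decseq_imp_monoseq decseq_bounded) auto
  then show ?thesis by (simp add: plus_message_def convergent_LIMSEQ_iff)
qed

lemma plus_message_le_message:
  "rooted_tree T \<Longrightarrow> 0 \<le> \<beta> \<Longrightarrow> plus_message \<beta> T v \<le> message \<beta> \<beta> T n v"
  by (rule decseq_ge[OF decseq_message message_tendsto])

lemma plus_message_nonneg: "rooted_tree T \<Longrightarrow> 0 \<le> \<beta> \<Longrightarrow> 0 \<le> plus_message \<beta> T v"
  by (rule LIMSEQ_le_const[OF message_tendsto]) (auto simp: message_nonneg)

lemma plus_message_le: "rooted_tree T \<Longrightarrow> 0 \<le> \<beta> \<Longrightarrow> plus_message \<beta> T v \<le> \<beta>"
  using plus_message_le_message[of T \<beta> v 0] by simp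

lemma incoming_tendsto:
  "(\<And>v. (\<lambda>n. f n v) \<longlonglongrightarrow> g v) \<Longrightarrow> (\<lambda>n. incoming T (f n) v) \<longlonglongrightarrow> incoming T g v"
  unfolding incoming_def by (intro tendsto_sum)

lemma plus_message_eq:
  assumes "rooted_tree T" "0 \<le> \<beta>"
  shows "plus_message \<beta> T v = cavity \<beta> (incoming T (plus_message \<beta> T) v)"
proof (rule LIMSEQ_unique)
  show "(\<lambda>n. message \<beta> \<beta> T (Suc n) v) \<longlonglongrightarrow> plus_message \<beta> T v"
    by (rule LIMSEQ_Suc[OF message_tendsto[OF assms]])
  show "(\<lambda>n. message \<beta> \<beta> T (Suc n) v) \<longlonglongrightarrow> cavity \<beta> (incoming T (plus_message \<beta> T) v)"
    using message_tendsto[OF assms] by (auto intro!: tendsto_intros incoming_tendsto)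
qed

text \<open>
  A vertex on level \<open>r\<close> receives the field \<open>\<beta>\<close> from each of its children, which carry the spins 1 of
  the boundary condition on level \<open>r + 1\<close>.
\<close>

definition plus_field_upto :: "real \<Rightarrow> 'a list set \<Rightarrow> nat \<Rightarrow> 'a list \<Rightarrow> real" where
  "plus_field_upto \<beta> T r v = incoming T (message \<beta> \<beta> T (r - length v)) v"

lemma finite_plus_configs: "rooted_tree T \<Longrightarrow> finite (plus_configs T t)"
  by (rule finite_subset[of _ "subtree T t \<rightarrow>\<^sub>E {-1, 1}"])
    (auto simp: plus_configs_def intro!: finite_PiE finite_subtree)

text \<open>
  Plus spins on level \<open>r + 1\<close> act on level \<open>r\<close> as the fields \<open>plus_field_upto\<close>, so the weight of a plus
  configuration is proportional to the weight that the chain gives to its restriction to \<open>subtree T r\<close>.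
\<close>

lemma measure_ising_plus_upto:
  assumes T: "rooted_tree T" and A: "A \<subseteq> subtree T r"
  shows "measure (ising_plus_upto \<beta> T (Suc r)) {x \<in> plus_configs T (Suc r). \<forall>v\<in>A. x v = s v} =
    measure (tree_chain \<beta> T (plus_field_upto \<beta> T r)) (cylinder T A s)"
proof -
  let ?h = "plus_field_upto \<beta> T r" and ?S = "subtree T r" and ?P = "plus_configs T (Suc r)"
  let ?w = "ising_weight \<beta> (edges (subtree T (Suc r)))"
  obtain C where C: "C > 0" "\<And>s. (\<And>v. v \<in> ?S \<Longrightarrow> s v \<in> {-1, 1}) \<Longrightarrow> chain_weight \<beta> ?h ?S s =
       C * exp (\<beta> * (\<Sum>v\<in>?S - {[]}. s (tl v) * s v) + (\<Sum>v\<in>level T r. ?h v * s v))"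
  proof (rule chain_weight_subtree[OF T, of r ?h \<beta>])
    fix v assume "v \<in> T" "length v < r"
    moreover have "r - length v = Suc (r - Suc (length v))" using \<open>length v < r\<close> by simp
    ultimately show "?h v = incoming T (\<lambda>w. cavity \<beta> (?h w)) v"
      by (simp add: plus_field_upto_def) (simp add: incoming_def)
  qed blast
  have w: "?w x = chain_weight \<beta> ?h ?S x / C" if x: "x \<in> ?P" for x
  proof -
    have "(\<Sum>v\<in>level T (Suc r). x (tl v) * x v) = (\<Sum>v\<in>level T (Suc r). x (tl v))"
      using x by (intro sum.cong) (auto simp: plus_configs_def level_def subtree_def)
    also have "\<dots> = (\<Sum>v\<in>level T r. real (card (children T v)) * x v)"
      unfolding sum_level_Suc[OF T] by simp
    finally have "\<beta> * (\<Sum>v\<in>level T (Suc r). x (tl v) * x v) = (\<Sum>v\<in>level T r. ?h v * x v)"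
      by (simp add: plus_field_upto_def level_def sum_distrib_left incoming_def mult_ac)
    moreover have "(\<Sum>v\<in>subtree T (Suc r) - {[]}. x (tl v) * x v) =
        (\<Sum>v\<in>?S - {[]}. x (tl v) * x v) + (\<Sum>v\<in>level T (Suc r). x (tl v) * x v)"
    proof -
      have "subtree T (Suc r) - {[]} = (?S - {[]}) \<union> level T (Suc r)"
        by (auto simp: subtree_Suc level_def)
      then show ?thesis using subtree_Suc(2)[of T r]
        by (simp add: sum.union_disjoint finite_subtree[OF T] finite_level[OF T] Diff_Int_distrib2)
    qed
    moreover have "x v \<in> {-1, 1}" if "v \<in> ?S" for v
      using x that by (auto simp: plus_configs_def subtree_def dest!: PiE_mem)
    ultimately show ?thesis
      using C by (simp add: ising_weight_edges algebra_simps)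
  qed
  \<comment> \<open>extension by the boundary condition, inverse to restriction\<close>
  define ext where "ext y = (\<lambda>v\<in>subtree T (Suc r). if length v = Suc r then 1 else y v)" for y :: "'a list \<Rightarrow> real"
  have bij: "(\<Sum>x\<in>{x \<in> ?P. \<forall>v\<in>B. x v = s v}. chain_weight \<beta> ?h ?S x) =
      (\<Sum>y\<in>cylinder ?S B s. chain_weight \<beta> ?h ?S y)" if B: "B \<subseteq> ?S" for B
  proof (rule sum.reindex_bij_witness[where i = ext and j = "\<lambda>x. restrict x ?S"])
    fix x assume x: "x \<in> {x \<in> ?P. \<forall>v\<in>B. x v = s v}"
    then have xE: "x \<in> subtree T (Suc r) \<rightarrow>\<^sub>E {-1, 1}" by (simp add: plus_configs_def)
    show "ext (restrict x ?S) = x"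
    proof (rule ext)
      fix v show "ext (restrict x ?S) v = x v"
        using x PiE_arb[OF xE, of v] by (auto simp: ext_def plus_configs_def subtree_def)
    qed
    show "restrict x ?S \<in> cylinder ?S B s"
      using x B PiE_mem[OF xE] subtree_mono[of r "Suc r" T] by (auto simp: subset_iff)
    show "chain_weight \<beta> ?h ?S (restrict x ?S) = chain_weight \<beta> ?h ?S x"
      by (rule chain_weight_cong[OF ancestor_closed_subtree[OF T]]) simp
  next
    fix y assume y: "y \<in> cylinder ?S B s"
    then have yE: "y \<in> ?S \<rightarrow>\<^sub>E {-1, 1}" by simp
    have e: "ext y v = y v" if "v \<in> ?S" for v using that by (auto simp: ext_def subtree_def)
    show "restrict (ext y) ?S = y"
      using e PiE_arb[OF yE] by (auto simp: fun_eq_iff restrict_def)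
    have "ext y \<in> ?P"
      using PiE_mem[OF yE] by (auto simp: plus_configs_def ext_def subtree_def)
    then show "ext y \<in> {x \<in> ?P. \<forall>v\<in>B. x v = s v}" using e y B by auto
  qed
  let ?X = "{x \<in> ?P. \<forall>v\<in>A. x v = s v}"
  have Z: "(\<Sum>y\<in>?P. ?w y) = 1 / C"
  proof -
    have "(\<Sum>y\<in>?P. ?w y) = (\<Sum>y\<in>?P. chain_weight \<beta> ?h ?S y / C)" by (intro sum.cong refl w)
    also have "\<dots> = (\<Sum>y\<in>?P. chain_weight \<beta> ?h ?S y) / C" by (simp add: sum_divide_distrib)
    also have "(\<Sum>y\<in>?P. chain_weight \<beta> ?h ?S y) = 1"
      using bij[of "{}"] sum_chain_weight[OF T finite_subtree[OF T] subtree_subset ancestor_closed_subtree[OF T]]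
      by simp
    finally show ?thesis .
  qed
  have "measure (ising_plus_upto \<beta> T (Suc r)) ?X = (\<Sum>x\<in>?X. ?w x / (\<Sum>y\<in>?P. ?w y))"
    unfolding ising_plus_upto_def
    by (subst measure_point_measure_finite_if[OF finite_plus_configs[OF T]])
      (auto intro!: sum_nonneg divide_nonneg_nonneg simp: ising_weight_def)
  also have "\<dots> = (\<Sum>x\<in>?X. chain_weight \<beta> ?h ?S x)"
    unfolding Z using C(1) w by (intro sum.cong) auto
  also have "\<dots> = measure (tree_chain \<beta> T ?h) (cylinder T A s)"
    unfolding bij[OF A]
    by (rule measure_tree_chain[OF T finite_subtree[OF T] subtree_subset ancestor_closed_subtree[OF T] A, symmetric])
  finally show ?thesis .
qed

lemma tendsto_measure_tree_chain:
  assumes T: "rooted_tree T" and A: "finite A" "A \<subseteq> T" and h: "\<And>v. (\<lambda>n. h n v) \<longlonglongrightarrow> h' v"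
  shows "(\<lambda>n. measure (tree_chain \<beta> T (h n)) (cylinder T A s))
    \<longlonglongrightarrow> measure (tree_chain \<beta> T h') (cylinder T A s)"
proof -
  obtain r where r: "A \<subseteq> subtree T r" using finite_subset_subtree[OF A] .
  have "(\<lambda>n. local_field \<beta> (h n) v p) \<longlonglongrightarrow> local_field \<beta> h' v p" for v p
    unfolding local_field_def using h by (auto intro!: tendsto_intros)
  then have "(\<lambda>n. chain_weight \<beta> (h n) S y) \<longlonglongrightarrow> chain_weight \<beta> h' S y" for S y
    unfolding chain_weight_def spin_prob_def
    by (intro tendsto_prod tendsto_divide tendsto_intros) auto
  then show ?thesis
    unfolding measure_tree_chain[OF T finite_subtree[OF T] subtree_subset ancestor_closed_subtree[OF T] r]
    by (intro tendsto_sum)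
qed

definition plus_field :: "real \<Rightarrow> 'a list set \<Rightarrow> 'a list \<Rightarrow> real" where
  "plus_field \<beta> T = incoming T (plus_message \<beta> T)"

text \<open>
  The fields of finite volumes converge, and with them the transition probabilities of the chain and
  the probabilities of all cylinders.
\<close>

theorem ising_plus_eq_tree_chain:
  assumes T: "rooted_tree T" and \<beta>: "0 \<le> \<beta>"
  shows "ising_plus \<beta> T = tree_chain \<beta> T (plus_field \<beta> T)"
  unfolding ising_plus_def
proof (rule the_equality)
  let ?\<nu> = "tree_chain \<beta> T (plus_field \<beta> T)"
  have lim: "(\<lambda>t. measure (ising_plus_upto \<beta> T t) {x \<in> plus_configs T t. \<forall>v\<in>A. x v = s v})
        \<longlonglongrightarrow> measure ?\<nu> (cylinder T A s)" if A: "finite A" "A \<subseteq> T" for A s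
  proof -
    obtain r0 where r0: "A \<subseteq> subtree T r0" using finite_subset_subtree[OF A] .
    have "(\<lambda>r. plus_field_upto \<beta> T r v) \<longlonglongrightarrow> plus_field \<beta> T v" for v
      unfolding plus_field_upto_def plus_field_def
    proof (rule incoming_tendsto)
      fix w
      have "filterlim (\<lambda>r. r - length v) at_top sequentially"
        by (rule filterlim_minus_const_nat_at_top)
      then show "(\<lambda>r. message \<beta> \<beta> T (r - length v) w) \<longlonglongrightarrow> plus_message \<beta> T w"
        by (rule filterlim_compose[OF message_tendsto[OF T \<beta>]])
    qed
    then have "(\<lambda>r. measure (tree_chain \<beta> T (plus_field_upto \<beta> T r)) (cylinder T A s))
        \<longlonglongrightarrow> measure ?\<nu> (cylinder T A s)"
      by (rule tendsto_measure_tree_chain[OF T A])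
    moreover have "\<forall>\<^sub>F r in sequentially.
        measure (tree_chain \<beta> T (plus_field_upto \<beta> T r)) (cylinder T A s) =
        measure (ising_plus_upto \<beta> T (Suc r)) {x \<in> plus_configs T (Suc r). \<forall>v\<in>A. x v = s v}"
      using eventually_ge_at_top[of r0]
    proof eventually_elim
      case (elim r)
      have "A \<subseteq> subtree T r" using r0 subtree_mono[OF elim, of T] by blast
      then show ?case by (rule measure_ising_plus_upto[OF T, symmetric])
    qed
    ultimately have "(\<lambda>r. measure (ising_plus_upto \<beta> T (Suc r)) {x \<in> plus_configs T (Suc r). \<forall>v\<in>A. x v = s v})
        \<longlonglongrightarrow> measure ?\<nu> (cylinder T A s)"
      by (rule Lim_transform_eventually)
    then show ?thesis by (rule LIMSEQ_imp_Suc)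
  qed
  then show "prob_space ?\<nu> \<and> sets ?\<nu> = sets (spin_space T) \<and> (\<forall>A s. finite A \<and> A \<subseteq> T \<longrightarrow>
      (\<lambda>t. measure (ising_plus_upto \<beta> T t) {x \<in> plus_configs T t. \<forall>v\<in>A. x v = s v})
      \<longlonglongrightarrow> measure ?\<nu> {x \<in> space ?\<nu>. \<forall>v\<in>A. x v = s v})"
    using prob_space_tree_chain[OF T] by (simp add: space_tree_chain)
  fix \<nu> assume \<nu>: "prob_space \<nu> \<and> sets \<nu> = sets (spin_space T) \<and> (\<forall>A s. finite A \<and> A \<subseteq> T \<longrightarrow>
      (\<lambda>t. measure (ising_plus_upto \<beta> T t) {x \<in> plus_configs T t. \<forall>v\<in>A. x v = s v})
      \<longlonglongrightarrow> measure \<nu> {x \<in> space \<nu>. \<forall>v\<in>A. x v = s v})"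
  then have sp: "space \<nu> = T \<rightarrow>\<^sub>E {-1, 1}" using sets_eq_imp_space_eq[of \<nu> "spin_space T"] space_spin_space[of T] by simp
  show "\<nu> = ?\<nu>"
  proof (rule measure_eqI_cylinders)
    fix A s assume A: "finite A" "A \<subseteq> T"
    have "(\<lambda>t. measure (ising_plus_upto \<beta> T t) {x \<in> plus_configs T t. \<forall>v\<in>A. x v = s v})
      \<longlonglongrightarrow> measure \<nu> (cylinder T A s)" using \<nu> A sp by auto
    then show "measure \<nu> (cylinder T A s) = measure ?\<nu> (cylinder T A s)"
      using lim[OF A] by (rule LIMSEQ_unique)
  qed (use \<nu> prob_space_tree_chain[OF T] in auto)
qed

section \<open>Phase transition from a positive cavity field\<close>

lemma measurable_finite_coordinates:
  fixes g :: "('a list \<Rightarrow> real) \<Rightarrow> real"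
  assumes S: "finite S" "S \<subseteq> T"
  shows "(\<lambda>x. g (restrict x S)) \<in> borel_measurable (spin_space T)"
proof -
  have "finite (S \<rightarrow>\<^sub>E {-1, 1 :: real})" using S by (intro finite_PiE) auto
  moreover have "(\<lambda>x. restrict x S) \<in> measurable (spin_space T) (PiM S (\<lambda>_. count_space {-1, 1 :: real}))"
    unfolding spin_space_def by (rule measurable_restrict_subset[OF S(2)])
  moreover have "PiM S (\<lambda>_. count_space {-1, 1 :: real}) = count_space (S \<rightarrow>\<^sub>E {-1, 1})"
    using S by (intro count_space_PiM_finite) auto
  ultimately have "(\<lambda>x. restrict x S) \<in> measurable (spin_space T) (count_space (S \<rightarrow>\<^sub>E {-1, 1}))"
    by simp
  then show ?thesis by (rule measurable_compose) simp
qed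

lemma override_on_PiE:
  assumes "L \<subseteq> S" "y \<in> S \<rightarrow>\<^sub>E B" "s \<in> L \<rightarrow>\<^sub>E B"
  shows "override_on y s L \<in> S \<rightarrow>\<^sub>E B"
proof (rule PiE_I)
  show "override_on y s L v \<in> B" if "v \<in> S" for v
    using PiE_mem[OF assms(2) that] PiE_mem[OF assms(3), of v] by (cases "v \<in> L") auto
  show "override_on y s L v = undefined" if "v \<notin> S" for v
  proof -
    have "v \<notin> L" using that assms(1) by blast
    then show ?thesis using PiE_arb[OF assms(2) that] by simp
  qed
qed

text \<open>
  The identity behind the DLR equations, for a measure \<open>c\<close> on the spins of a finite set \<open>S\<close> whose
  dependence on the spins in \<open>L\<close> is through the factor \<open>w\<close> only.
\<close>

lemma sum_resample:
  fixes w c I :: "('a list \<Rightarrow> real) \<Rightarrow> real"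
  assumes S: "finite S" "L \<subseteq> S"
    and w: "\<And>y. 0 < w y"
    and c: "\<And>y s. y \<in> S \<rightarrow>\<^sub>E {-1, 1} \<Longrightarrow> s \<in> L \<rightarrow>\<^sub>E {-1, 1} \<Longrightarrow>
        c (override_on y s L) * w y = c y * w (override_on y s L)"
  shows "(\<Sum>y\<in>S \<rightarrow>\<^sub>E {-1, 1}. (\<Sum>s\<in>L \<rightarrow>\<^sub>E {-1, 1}. w (override_on y s L) * I (override_on y s L)) /
        (\<Sum>s\<in>L \<rightarrow>\<^sub>E {-1, 1}. w (override_on y s L)) * c y) = (\<Sum>y\<in>S \<rightarrow>\<^sub>E {-1, 1}. I y * c y)"
proof -
  let ?U = "S \<rightarrow>\<^sub>E {-1, 1 :: real}" and ?W = "L \<rightarrow>\<^sub>E {-1, 1 :: real}"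
  define D where "D y = (\<Sum>s\<in>?W. w (override_on y s L))" for y
  have fin: "finite ?U" "finite ?W" using S finite_subset[OF S(2,1)] by (auto intro!: finite_PiE)
  have "restrict (\<lambda>_. 1) L \<in> ?W" by auto
  then have "?W \<noteq> {}" by blast
  then have D: "0 < D y" for y unfolding D_def using fin w by (intro sum_pos)
  have U: "override_on y s L \<in> ?U" if "y \<in> ?U" "s \<in> ?W" for y s
    using that S by (intro override_on_PiE)
  have W: "restrict y L \<in> ?W" if "y \<in> ?U" for y using that S by (auto simp: PiE_iff)
  have undo: "override_on (override_on y s L) (restrict y L) L = y" for y s
    by (auto simp: override_on_def)
  have rs: "restrict (override_on y s L) L = s" if "s \<in> ?W" for y s
  proof
    show "restrict (override_on y s L) L v = s v" for v
      using PiE_arb[OF that, of v] by (cases "v \<in> L") auto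
  qed
  have oo: "override_on (override_on y s L) s' L = override_on y s' L" for y s s'
    by (auto simp: override_on_def)
  have DD: "D (override_on y s L) = D y" for y s unfolding D_def oo ..
  have "(\<Sum>y\<in>?U. (\<Sum>s\<in>?W. w (override_on y s L) * I (override_on y s L)) / D y * c y) =
      (\<Sum>(y, s)\<in>?U \<times> ?W. w (override_on y s L) * I (override_on y s L) / D y * c y)"
    by (simp add: sum.cartesian_product sum_divide_distrib sum_distrib_right)
  also have "\<dots> = (\<Sum>(y, s)\<in>?U \<times> ?W. w y * I y / D y * c (override_on y s L))"
  proof (rule sum.reindex_bij_witness[where i = "\<lambda>(y, s). (override_on y s L, restrict y L)"
          and j = "\<lambda>(y, s). (override_on y s L, restrict y L)"], goal_cases)
    case (1 p)
    then show ?case by (cases p) (simp only: prod.case SigmaE2 mem_Times_iff fst_conv snd_conv undo rs)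
  next
    case (2 p)
    then show ?case by (cases p) (simp only: prod.case mem_Times_iff fst_conv snd_conv U W)
  next
    case (3 p)
    then show ?case by (cases p) (simp only: prod.case mem_Times_iff fst_conv snd_conv undo rs)
  next
    case (4 p)
    then show ?case by (cases p) (simp only: prod.case mem_Times_iff fst_conv snd_conv U W)
  next
    case (5 p)
    then show ?case by (cases p) (simp only: prod.case mem_Times_iff fst_conv snd_conv undo rs DD)
  qed
  also have "\<dots> = (\<Sum>(y, s)\<in>?U \<times> ?W. I y * c y * (w (override_on y s L) / D y))"
  proof (intro sum.cong refl)
    fix p assume "p \<in> ?U \<times> ?W"
    then obtain y s where p: "p = (y, s)" "y \<in> ?U" "s \<in> ?W" by auto
    have "w y * I y / D y * c (override_on y s L) = I y / D y * (c (override_on y s L) * w y)" by simp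
    also have "\<dots> = I y * c y * (w (override_on y s L) / D y)" unfolding c[OF p(2,3)] by simp
    finally show "(case p of (y, s) \<Rightarrow> w y * I y / D y * c (override_on y s L)) =
        (case p of (y, s) \<Rightarrow> I y * c y * (w (override_on y s L) / D y))"
      by (simp add: p(1))
  qed
  also have "\<dots> = (\<Sum>y\<in>?U. \<Sum>s\<in>?W. I y * c y * (w (override_on y s L) / D y))"
    by (simp only: sum.cartesian_product)
  also have "\<dots> = (\<Sum>y\<in>?U. I y * c y * (D y / D y))"
    by (simp only: sum_distrib_left[symmetric] sum_divide_distrib[symmetric] D_def)
  also have "\<dots> = (\<Sum>y\<in>?U. I y * c y)" using D by (intro sum.cong) (auto simp: less_imp_neq[symmetric])
  finally show ?thesis unfolding D_def .
qed

text \<open>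
  On a subtree that reaches at least one level below \<open>L\<close>, the weight of the chain is the Ising weight
  of the edges that meet \<open>L\<close> times a factor that does not involve the spins in \<open>L\<close>, by
  \<open>chain_weight_subtree\<close>. So resampling these spins according to the specification preserves the chain.
\<close>

theorem ising_gibbs_tree_chain:
  assumes T: "rooted_tree T"
    and h: "\<And>v. v \<in> T \<Longrightarrow> h v = incoming T (\<lambda>w. cavity \<beta> (h w)) v"
  shows "ising_gibbs \<beta> T (tree_chain \<beta> T h)"
  unfolding ising_gibbs_def
proof (intro conjI allI impI)
  let ?\<nu> = "tree_chain \<beta> T h"
  interpret prob_space ?\<nu> by (rule prob_space_tree_chain[OF T])
  show "prob_space ?\<nu>" by unfold_locales
  show "sets ?\<nu> = sets (spin_space T)" by simp
  fix L E assume LE: "finite L \<and> L \<subseteq> T \<and> E \<in> sets ?\<nu>"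
  then have L: "finite L" "L \<subseteq> T" by auto
  let ?W = "L \<rightarrow>\<^sub>E {-1, 1 :: real}"
  have finW: "finite ?W" using L by (intro finite_PiE) auto
  define F where "F = {e \<in> edges T. e \<inter> L \<noteq> {}}"
  define w where "w x = ising_weight \<beta> F x" for x
  define D where "D x = (\<Sum>s\<in>?W. w (override_on x s L))" for x
  define \<pi> where "\<pi> s x = w (override_on x s L) / D x" for s x
  have w_pos: "0 < w x" for x by (simp add: w_def ising_weight_def)
  have "restrict (\<lambda>_. 1) L \<in> ?W" by auto
  then have "?W \<noteq> {}" by blast
  then have D_pos: "0 < D x" for x unfolding D_def using finW w_pos by (intro sum_pos)
  have \<pi>_nonneg: "0 \<le> \<pi> s x" for s x
    unfolding \<pi>_def using w_pos D_pos by (intro divide_nonneg_nonneg) (auto intro: less_imp_le)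
  have \<pi>_sum: "(\<Sum>s\<in>?W. \<pi> s x) = 1" for x
    unfolding \<pi>_def using D_pos[of x] by (simp add: sum_divide_distrib[symmetric] D_def)
  have spec: "ising_specification \<beta> T L x E = (\<Sum>s\<in>?W. \<pi> s x * indicator E (override_on x s L))" for x E
    unfolding ising_specification_def \<pi>_def D_def w_def F_def by (simp add: sum_divide_distrib)
  have F: "F = (\<lambda>v. {tl v, v}) ` {v \<in> subtree T (Suc r) - {[]}. {tl v, v} \<inter> L \<noteq> {}}"
    if r: "L \<subseteq> subtree T r" for r
  proof -
    have "v \<in> subtree T (Suc r)" if "v \<in> T" "{tl v, v} \<inter> L \<noteq> {}" for v
      using that r by (cases v) (auto simp: subtree_def)
    then show ?thesis unfolding F_def edges_eq_image by (auto simp: subtree_def)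
  qed
  have w: "w x = exp (\<beta> * (\<Sum>v\<in>{v \<in> subtree T (Suc r) - {[]}. {tl v, v} \<inter> L \<noteq> {}}. x (tl v) * x v))"
    if r: "L \<subseteq> subtree T r" for r x
    unfolding w_def ising_weight_def F[OF r] by (subst sum_prod_edges) auto
  have w_cong: "w x = w y" if r: "L \<subseteq> subtree T r" and "\<And>v. v \<in> subtree T (Suc r) \<Longrightarrow> x v = y v" for r x y
    unfolding w[OF r] using that ancestor_closed_tl[OF ancestor_closed_subtree[OF T]]
    by (intro arg_cong[where f = exp] arg_cong2[where f = "(*)"] refl sum.cong) auto
  have \<pi>_cong: "\<pi> s x = \<pi> s (restrict x (subtree T (Suc r)))" if r: "L \<subseteq> subtree T r" for r s x
    unfolding \<pi>_def D_def
    by (intro arg_cong2[where f = "(/)"] sum.cong refl w_cong[OF r]) (auto simp: override_on_def)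
  obtain r0 where r0: "L \<subseteq> subtree T r0" using finite_subset_subtree[OF L] .
  have ov_space: "override_on x s L \<in> T \<rightarrow>\<^sub>E {-1, 1}" if "x \<in> T \<rightarrow>\<^sub>E {-1, 1}" "s \<in> ?W" for x s
    using that L by (intro override_on_PiE)
  have \<pi>_meas [measurable]: "\<pi> s \<in> borel_measurable (spin_space T)" for s
    by (subst \<pi>_cong[OF r0, abs_def]) (intro measurable_finite_coordinates finite_subtree[OF T] subtree_subset)
  have ov_meas [measurable]: "(\<lambda>x. override_on x s L) \<in> measurable (spin_space T) (spin_space T)"
    if s: "s \<in> ?W" for s
    unfolding spin_space_def
  proof (rule measurable_PiM_single')
    fix v assume v: "v \<in> T"
    show "(\<lambda>x. override_on x s L v) \<in> measurable (PiM T (\<lambda>v. count_space {-1, 1})) (count_space {-1, 1 :: real})"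
    proof (cases "v \<in> L")
      case True
      then show ?thesis using PiE_mem[OF s True] by (simp add: override_on_def)
    next
      case False
      then show ?thesis using measurable_component_singleton[OF v, of "\<lambda>_. count_space {-1, 1 :: real}"]
        by (simp add: override_on_def)
    qed
  next
    show "(\<lambda>x. override_on x s L) \<in> space (PiM T (\<lambda>v. count_space {-1, 1})) \<rightarrow> T \<rightarrow>\<^sub>E space (count_space {-1, 1 :: real})"
      using ov_space[OF _ s] by (simp add: space_PiM)
  qed
  \<comment> \<open>the law of a sample of the chain whose spins in \<open>L\<close> are resampled\<close>
  define \<rho> where "\<rho> = distr (density (count_space ?W \<Otimes>\<^sub>M ?\<nu>) (\<lambda>(s, x). ennreal (\<pi> s x)))
      (spin_space T) (\<lambda>(s, x). override_on x s L)"
  have m1: "(\<lambda>(s, x). ennreal (\<pi> s x)) \<in> borel_measurable (count_space ?W \<Otimes>\<^sub>M ?\<nu>)"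
  proof (rule measurable_pair_measure_countable1)
    show "countable ?W" using finW by (rule countable_finite)
    fix s show "(\<lambda>x. case (s, x) of (s, x) \<Rightarrow> ennreal (\<pi> s x)) \<in> borel_measurable ?\<nu>"
      by (simp add: measurable_cong_sets[OF sets_tree_chain refl]) measurable
  qed
  have m2: "(\<lambda>(s, x). override_on x s L) \<in> measurable (count_space ?W \<Otimes>\<^sub>M ?\<nu>) (spin_space T)"
  proof (rule measurable_pair_measure_countable1)
    show "countable ?W" using finW by (rule countable_finite)
    fix s assume "s \<in> ?W"
    then show "(\<lambda>x. case (s, x) of (s, x) \<Rightarrow> override_on x s L) \<in> measurable ?\<nu> (spin_space T)"
      using ov_meas by (simp add: measurable_cong_sets[OF sets_tree_chain refl])
  qed
  have em: "emeasure \<rho> E = ennreal (\<integral>x. ising_specification \<beta> T L x E \<partial>?\<nu>)" if E: "E \<in> sets (spin_space T)" for E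
  proof -
    have m3: "(\<lambda>x. \<pi> s x * indicator E (override_on x s L)) \<in> borel_measurable ?\<nu>" if "s \<in> ?W" for s
    proof -
      have "(\<lambda>x. indicator E (override_on x s L) :: real) \<in> borel_measurable (spin_space T)"
        by (rule measurable_compose[OF ov_meas[OF that]]) (simp add: E borel_measurable_indicator)
      then have "(\<lambda>x. \<pi> s x * indicator E (override_on x s L)) \<in> borel_measurable (spin_space T)"
        by (intro borel_measurable_times \<pi>_meas)
      then show ?thesis by (simp only: measurable_cong_sets[OF sets_tree_chain refl])
    qed
    have b: "norm (\<pi> s x * indicator E (override_on x s L)) \<le> 1" if "s \<in> ?W" for s x
    proof -
      have "\<pi> s x \<le> (\<Sum>s\<in>?W. \<pi> s x)" using that finW \<pi>_nonneg by (intro member_le_sum) auto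
      then show ?thesis using \<pi>_sum[of x] \<pi>_nonneg[of s x] by (auto simp: indicator_def)
    qed
    have int: "integrable ?\<nu> (\<lambda>x. \<pi> s x * indicator E (override_on x s L))" if "s \<in> ?W" for s
      by (rule integrable_const_bound[where B = 1]) (use b[OF that] m3[OF that] in auto)
    have pre: "(\<lambda>(s, x). override_on x s L) -` E \<inter> space (count_space ?W \<Otimes>\<^sub>M ?\<nu>) \<in> sets (count_space ?W \<Otimes>\<^sub>M ?\<nu>)"
      by (rule measurable_sets[OF m2 E])
    have "emeasure \<rho> E = (\<integral>\<^sup>+p. (case p of (s, x) \<Rightarrow> ennreal (\<pi> s x)) *
        indicator ((\<lambda>(s, x). override_on x s L) -` E \<inter> space (count_space ?W \<Otimes>\<^sub>M ?\<nu>)) p \<partial>(count_space ?W \<Otimes>\<^sub>M ?\<nu>))"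
      unfolding \<rho>_def using m1 m2 E pre
      by (subst emeasure_distr) (auto simp: emeasure_density)
    also have "\<dots> = (\<integral>\<^sup>+s. \<integral>\<^sup>+x. ennreal (\<pi> s x) *
        indicator ((\<lambda>(s, x). override_on x s L) -` E \<inter> space (count_space ?W \<Otimes>\<^sub>M ?\<nu>)) (s, x) \<partial>?\<nu> \<partial>count_space ?W)"
      using m1 pre by (subst nn_integral_fst[symmetric]) auto
    also have "\<dots> = (\<Sum>s\<in>?W. \<integral>\<^sup>+x. ennreal (\<pi> s x * indicator E (override_on x s L)) \<partial>?\<nu>)"
      using finW by (subst nn_integral_count_space_finite)
        (auto intro!: sum.cong nn_integral_cong simp: indicator_def space_pair_measure)
    also have "\<dots> = (\<Sum>s\<in>?W. ennreal (\<integral>x. \<pi> s x * indicator E (override_on x s L) \<partial>?\<nu>))"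
      using int \<pi>_nonneg by (intro sum.cong refl nn_integral_eq_integral) auto
    also have "\<dots> = ennreal (\<Sum>s\<in>?W. \<integral>x. \<pi> s x * indicator E (override_on x s L) \<partial>?\<nu>)"
      using \<pi>_nonneg by (intro sum_ennreal Bochner_Integration.integral_nonneg) auto
    also have "(\<Sum>s\<in>?W. \<integral>x. \<pi> s x * indicator E (override_on x s L) \<partial>?\<nu>) = (\<integral>x. ising_specification \<beta> T L x E \<partial>?\<nu>)"
      unfolding spec using int by (intro Bochner_Integration.integral_sum[symmetric])
    finally show ?thesis .
  qed
  have spec_nonneg: "0 \<le> (\<integral>x. ising_specification \<beta> T L x E \<partial>?\<nu>)" for E
    unfolding spec using \<pi>_nonneg by (intro Bochner_Integration.integral_nonneg sum_nonneg) auto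
  have me: "measure \<rho> E = (\<integral>x. ising_specification \<beta> T L x E \<partial>?\<nu>)" if "E \<in> sets (spin_space T)" for E
    using em[OF that] spec_nonneg by (simp add: measure_def)
  have prob: "prob_space \<rho>"
  proof
    have "(\<integral>x. ising_specification \<beta> T L x (space (spin_space T)) \<partial>?\<nu>) = (\<integral>x. 1 \<partial>?\<nu>)"
      unfolding spec using \<pi>_sum ov_space
      by (intro Bochner_Integration.integral_cong) (auto simp: space_tree_chain space_spin_space)
    then have "emeasure \<rho> (space (spin_space T)) = 1" using em[of "space (spin_space T)"] prob_space by simp
    then show "emeasure \<rho> (space \<rho>) = 1" by (simp add: \<rho>_def)
  qed
  have "?\<nu> = \<rho>"
  proof (rule measure_eqI_cylinders)
    show "sets ?\<nu> = sets (spin_space T)" "sets \<rho> = sets (spin_space T)" by (simp_all add: \<rho>_def)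
    show "prob_space ?\<nu>" by (rule prob_space_axioms)
    show "prob_space \<rho>" by (rule prob)
    fix A and \<sigma> :: "'a list \<Rightarrow> real" assume A: "finite A" "A \<subseteq> T"
    let ?C = "cylinder T A \<sigma>"
    obtain r where r: "A \<union> L \<subseteq> subtree T r" using finite_subset_subtree[of "A \<union> L" T] A L by auto
    then have rL: "L \<subseteq> subtree T r" by auto
    let ?S = "subtree T (Suc r)"
    have S: "finite ?S" "?S \<subseteq> T" "ancestor_closed ?S"
      by (auto intro: finite_subtree[OF T] subtree_subset[THEN subsetD] ancestor_closed_subtree[OF T])
    have rS: "subtree T r \<subseteq> ?S" by (rule subtree_mono) simp
    define I where "I y = (if \<forall>v\<in>A. y v = \<sigma> v then 1 else 0 :: real)" for y :: "'a list \<Rightarrow> real"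
    define G where "G y = (\<Sum>s\<in>?W. w (override_on y s L) * I (override_on y s L)) / (\<Sum>s\<in>?W. w (override_on y s L))" for y
    obtain K where K: "K > 0" "\<And>s. (\<And>v. v \<in> ?S \<Longrightarrow> s v \<in> {-1, 1}) \<Longrightarrow> chain_weight \<beta> h ?S s =
       K * exp (\<beta> * (\<Sum>v\<in>?S - {[]}. s (tl v) * s v) + (\<Sum>v\<in>level T (Suc r). h v * s v))"
    proof (rule chain_weight_subtree[OF T, of "Suc r" h \<beta>])
      fix v assume "v \<in> T"
      then show "h v = incoming T (\<lambda>w. cavity \<beta> (h w)) v" by (rule h)
    qed blast
    define k where "k y = K * exp (\<beta> * (\<Sum>v\<in>{v \<in> ?S - {[]}. {tl v, v} \<inter> L = {}}. y (tl v) * y v)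
        + (\<Sum>v\<in>level T (Suc r). h v * y v))" for y
    have cw: "chain_weight \<beta> h ?S y = w y * k y" if "y \<in> ?S \<rightarrow>\<^sub>E {-1, 1}" for y
    proof -
      have "(\<Sum>v\<in>?S - {[]}. y (tl v) * y v) = (\<Sum>v\<in>{v \<in> ?S - {[]}. {tl v, v} \<inter> L \<noteq> {}}. y (tl v) * y v) +
          (\<Sum>v\<in>{v \<in> ?S - {[]}. {tl v, v} \<inter> L = {}}. y (tl v) * y v)"
        using S(1) by (subst sum.union_disjoint[symmetric]) (auto intro!: sum.cong)
      moreover have "y v \<in> {-1, 1}" if "v \<in> ?S" for v using that \<open>y \<in> _\<close> by (rule PiE_mem[rotated])
      ultimately show ?thesis
        unfolding w[OF rL] k_def using K(2)[of y] by (simp add: exp_add algebra_simps)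
    qed
    have k: "k (override_on y s L) = k y" for y s
    proof -
      have "override_on y s L v = y v" if "v \<in> level T (Suc r)" for v
        using that rL by (auto simp: level_def subtree_def override_on_def)
      then show ?thesis unfolding k_def by (auto intro!: sum.cong simp: override_on_def)
    qed
    have ovS: "override_on y s L \<in> ?S \<rightarrow>\<^sub>E {-1, 1}" if "y \<in> ?S \<rightarrow>\<^sub>E {-1, 1}" "s \<in> ?W" for y s
      using that rL rS by (intro override_on_PiE) auto
    have "measure \<rho> ?C = (\<integral>x. G (restrict x ?S) \<partial>?\<nu>)"
      unfolding me[OF cylinder_in_sets[OF A]]
    proof (rule Bochner_Integration.integral_cong[OF refl])
      fix x assume "x \<in> space ?\<nu>"
      then have x: "x \<in> T \<rightarrow>\<^sub>E {-1, 1}" by (simp add: space_tree_chain)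
      have "\<pi> s x * indicator ?C (override_on x s L) =
          w (override_on (restrict x ?S) s L) * I (override_on (restrict x ?S) s L) / (\<Sum>s\<in>?W. w (override_on (restrict x ?S) s L))"
        if s: "s \<in> ?W" for s
      proof -
        have "indicator ?C (override_on x s L) = I (override_on (restrict x ?S) s L)"
          using ov_space[OF x s] r rS by (auto simp: indicator_def I_def override_on_def subset_iff)
        then show ?thesis using \<pi>_cong[OF rL, of s x] by (simp add: \<pi>_def D_def)
      qed
      then show "ising_specification \<beta> T L x ?C = G (restrict x ?S)"
        unfolding spec G_def by (simp add: sum_divide_distrib)
    qed
    also have "\<dots> = (\<Sum>y\<in>?S \<rightarrow>\<^sub>E {-1, 1}. G y * chain_weight \<beta> h ?S y)"
      by (rule integral_tree_chain[OF T S])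
    also have "\<dots> = (\<Sum>y\<in>?S \<rightarrow>\<^sub>E {-1, 1}. I y * chain_weight \<beta> h ?S y)"
      unfolding G_def
      using rL rS w_pos by (intro sum_resample S) (auto simp: cw ovS k)
    also have "\<dots> = (\<Sum>y\<in>?S \<rightarrow>\<^sub>E {-1, 1}. if \<forall>v\<in>A. y v = \<sigma> v then chain_weight \<beta> h ?S y else 0)"
      by (intro sum.cong) (auto simp: I_def)
    also have "\<dots> = (\<Sum>y\<in>cylinder ?S A \<sigma>. chain_weight \<beta> h ?S y)"
      using S by (intro sum.inter_filter[symmetric] finite_PiE) auto
    also have "\<dots> = measure ?\<nu> ?C"
      using r rS by (intro measure_tree_chain[OF T S, symmetric]) auto
    finally show "measure ?\<nu> ?C = measure \<rho> ?C" ..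
  qed
  moreover have "E \<in> sets (spin_space T)" using LE by simp
  ultimately show "measure ?\<nu> E = (\<integral>x. ising_specification \<beta> T L x E \<partial>?\<nu>)"
    using me[of E] by simp
qed

lemma measure_root_spin:
  assumes "rooted_tree T"
  shows "measure (tree_chain \<beta> T h) {x \<in> T \<rightarrow>\<^sub>E {-1, 1}. \<forall>v\<in>{[]}. x v = 1} = spin_prob (h []) 1"
  using measure_tree_chain_cylinder[OF assms, of "{[]}" "\<lambda>_. 1" \<beta> h] rooted_tree_Nil[OF assms]
  by (simp add: ancestor_closed_def chain_weight_def local_field_def)

text \<open>
  The plus fields and their negatives both solve the cavity equations. The corresponding Gibbs measures
  give the event that the root has spin 1 different probabilities unless the field at the root
  vanishes.
\<close>

lemma unique_gibbs_imp_plus_message_eq_0: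
  assumes T: "rooted_tree T" and \<beta>: "0 < \<beta>" and ex: "\<exists>!\<nu>. ising_gibbs \<beta> T \<nu>" and a: "[a] \<in> T"
  shows "plus_message \<beta> T [a] = 0"
proof -
  let ?h = "plus_field \<beta> T"
  have "cavity \<beta> (?h w) = plus_message \<beta> T w" for w
    unfolding plus_field_def using \<beta> by (intro plus_message_eq[OF T, symmetric]) simp
  then have eq: "(\<lambda>w. cavity \<beta> (?h w)) = plus_message \<beta> T" by blast
  have h: "?h v = incoming T (\<lambda>w. cavity \<beta> (?h w)) v" for v
    unfolding eq by (rule plus_field_def[THEN fun_cong])
  have h': "- ?h v = incoming T (\<lambda>w. cavity \<beta> (- ?h w)) v" for v
    using h[of v] by (simp add: incoming_def cavity_uminus sum_negf)
  have "tree_chain \<beta> T ?h = tree_chain \<beta> T (\<lambda>v. - ?h v)"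
    using ex ising_gibbs_tree_chain[OF T h] ising_gibbs_tree_chain[OF T, of "\<lambda>v. - ?h v", OF h'] by blast
  then have "spin_prob (?h []) 1 = spin_prob (- ?h []) 1"
    using measure_root_spin[OF T, of \<beta> ?h] measure_root_spin[OF T, of \<beta> "\<lambda>v. - ?h v"] by simp
  then have "?h [] = 0" using cosh_real_pos[of "?h []"] by (simp add: spin_prob_def)
  then have "(\<Sum>a\<in>children T []. plus_message \<beta> T [a]) = 0" by (simp add: plus_field_def incoming_def)
  moreover have "\<forall>a. 0 \<le> plus_message \<beta> T [a]" using plus_message_nonneg[OF T] \<beta> by simp
  ultimately show ?thesis
    using a finite_children[OF T] by (subst (asm) sum_nonneg_eq_0_iff) (auto simp: children_def)
qed

section \<open>The energy at the root as a function of the inverse temperature\<close>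

lemma neighbours_root: "neighbours T [] = (\<lambda>a. [a]) ` children T []"
proof -
  have "w \<in> neighbours T [] \<longleftrightarrow> w \<in> (\<lambda>a. [a]) ` children T []" for w
  proof
    assume "w \<in> neighbours T []"
    then obtain v where v: "v \<in> T" "v \<noteq> []" "{[], w} = {tl v, v}"
      by (auto simp: neighbours_def edges_def)
    then have "v = w" "tl w = []" by (auto simp: doubleton_eq_iff)
    then obtain a where "w = [a]" using v by (cases w) auto
    then show "w \<in> (\<lambda>a. [a]) ` children T []" using v \<open>v = w\<close> by (auto simp: children_def)
  next
    assume "w \<in> (\<lambda>a. [a]) ` children T []"
    then obtain a where a: "w = [a]" "[a] \<in> T" by (auto simp: children_def)
    then have "{tl [a], [a]} \<in> edges T" unfolding edges_def by blast
    then show "w \<in> neighbours T []" using a by (simp add: neighbours_def)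
  qed
  then show ?thesis by blast
qed

lemma neighbours_Cons: "neighbours T (a # v) \<subseteq> insert v ((\<lambda>b. b # a # v) ` children T (a # v))"
proof
  fix w assume "w \<in> neighbours T (a # v)"
  then obtain u where u: "u \<in> T" "u \<noteq> []" "{a # v, w} = {tl u, u}"
    by (auto simp: neighbours_def edges_def)
  then consider "a # v = tl u" "w = u" | "a # v = u" "w = tl u" by (auto simp: doubleton_eq_iff)
  then show "w \<in> insert v ((\<lambda>b. b # a # v) ` children T (a # v))"
  proof cases
    case 1
    then obtain b where "u = b # a # v" using u by (cases u) auto
    then show ?thesis using 1 u by (auto simp: children_def)
  next
    case 2
    then show ?thesis by auto
  qed
qed

text \<open>
  The subtracted 1 is for the parent.
\<close>

lemma min_degree_le_children:
  assumes T: "rooted_tree T" and v: "v \<in> T"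
  shows "min_degree T - 1 \<le> card (children T v)"
proof -
  have "min_degree T \<le> degree T v"
    unfolding min_degree_def using v by (intro cINF_lower) auto
  also have "degree T v \<le> Suc (card (children T v))"
  proof (cases v)
    case Nil
    then show ?thesis unfolding degree_def by (simp add: neighbours_root card_image inj_on_def)
  next
    case (Cons a w)
    have "degree T v \<le> card (insert w ((\<lambda>b. b # a # w) ` children T (a # w)))"
      unfolding degree_def Cons using finite_children[OF T] by (intro card_mono neighbours_Cons) auto
    also have "\<dots> \<le> Suc (card ((\<lambda>b. b # a # w) ` children T (a # w)))"
      by (rule card_insert_le_m1) auto
    also have "card ((\<lambda>b. b # a # w) ` children T (a # w)) = card (children T v)"
      unfolding Cons by (intro card_image) (auto simp: inj_on_def)
    finally show ?thesis .
  qed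
  finally show ?thesis by simp
qed

text \<open>
  The correlation of two spins that interact with strength \<open>\<beta>\<close> and feel the fields \<open>a\<close> and \<open>b\<close>.
\<close>

definition edge_corr :: "real \<Rightarrow> real \<Rightarrow> real \<Rightarrow> real" where
  "edge_corr \<beta> a b = (tanh \<beta> + tanh a * tanh b) / (1 + tanh \<beta> * (tanh a * tanh b))"

text \<open>
  Removing the contribution of the child \<open>[c]\<close> from the field at the root separates the two ends of the
  edge, so that \<open>edge_corr\<close> applies. In the calculation, \<open>tanh (h [])\<close> is expanded by the addition
  theorem for \<open>tanh\<close>.
\<close>

lemma integral_edge_spins:
  assumes T: "rooted_tree T" and c: "[c] \<in> T"
  shows "(\<integral>x. x [] * x [c] \<partial>tree_chain \<beta> T h) = edge_corr \<beta> (h [] - cavity \<beta> (h [c])) (h [c])"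
proof -
  let ?S = "{[], [c]}"
  have S: "finite ?S" "?S \<subseteq> T" "ancestor_closed ?S"
    using rooted_tree_Nil[OF T] c by (auto simp: ancestor_closed_def)
  let ?f = "\<lambda>p q. p * q * (spin_prob (h []) p * spin_prob (\<beta> * p + h [c]) q)"
  have "(\<integral>x. x [] * x [c] \<partial>tree_chain \<beta> T h) = (\<Sum>y\<in>?S \<rightarrow>\<^sub>E {-1, 1}. y [] * y [c] * chain_weight \<beta> h ?S y)"
    using integral_tree_chain[OF T S, where g = "\<lambda>y. y [] * y [c]"] by simp
  also have "\<dots> = (\<Sum>(p, q)\<in>{-1, 1} \<times> {-1, 1}. ?f p q)"
  proof (rule sum.reindex_bij_witness[where i = "\<lambda>(p, q). \<lambda>v\<in>?S. if v = [] then p else q" and j = "\<lambda>y. (y [], y [c])"], goal_cases)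
    case (1 y)
    then show ?case using PiE_arb[OF 1] by (auto simp: fun_eq_iff restrict_def)
  next
    case (2 y)
    show ?case by (intro SigmaI PiE_mem[OF 2]) auto
  next
    case (3 p)
    then show ?case by (cases p) simp
  next
    case (4 p)
    then show ?case by (cases p) (auto simp: PiE_iff)
  next
    case (5 y)
    show ?case by (simp add: chain_weight_def local_field_def parent_spin_def)
  qed
  also have "\<dots> = (\<Sum>p\<in>{-1, 1}. \<Sum>q\<in>{-1, 1}. ?f p q)" by (simp add: sum.cartesian_product)
  also have "\<dots> = spin_prob (h []) 1 * tanh (\<beta> + h [c]) - spin_prob (h []) (-1) * tanh (- \<beta> + h [c])"
  proof -
    have tanh: "tanh b = spin_prob b 1 - spin_prob b (-1)" for b :: real
      by (simp add: spin_prob_def tanh_def sinh_def diff_divide_distrib)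
    show ?thesis unfolding tanh by (simp add: algebra_simps)
  qed
  also have "\<dots> = edge_corr \<beta> (h [] - cavity \<beta> (h [c])) (h [c])"
  proof -
    define a where "a = h [] - cavity \<beta> (h [c])"
    define t where "t = tanh \<beta>"
    define \<alpha> where "\<alpha> = tanh a"
    define \<tau> where "\<tau> = tanh (h [c])"
    have n: "1 + t * \<tau> \<noteq> 0" "1 - t * \<tau> \<noteq> 0" "1 + \<alpha> * (t * \<tau>) \<noteq> 0"
      using tanh_mult_bounds[of \<beta> "h [c]"] tanh_mult_bounds[of a "cavity \<beta> (h [c])"]
      by (auto simp: t_def \<tau>_def \<alpha>_def tanh_cavity)
    have H: "tanh (h []) = (\<alpha> + t * \<tau>) / (1 + \<alpha> * (t * \<tau>))"
      using tanh_add[of a "cavity \<beta> (h [c])"] by (simp add: a_def \<alpha>_def t_def \<tau>_def tanh_cavity)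
    have p: "spin_prob (h []) 1 = (1 + tanh (h [])) / 2" "spin_prob (h []) (-1) = (1 - tanh (h [])) / 2"
    proof -
      have "1 + tanh (h []) = (cosh (h []) + sinh (h [])) / cosh (h [])"
        "1 - tanh (h []) = (cosh (h []) - sinh (h [])) / cosh (h [])"
        by (simp_all add: tanh_def add_divide_distrib diff_divide_distrib)
      then show "spin_prob (h []) 1 = (1 + tanh (h [])) / 2" "spin_prob (h []) (-1) = (1 - tanh (h [])) / 2"
        unfolding cosh_plus_sinh cosh_minus_sinh by (simp_all add: spin_prob_def)
    qed
    have "spin_prob (h []) 1 = (1 + \<alpha>) * (1 + t * \<tau>) / (2 * (1 + \<alpha> * (t * \<tau>)))"
      "spin_prob (h []) (-1) = (1 - \<alpha>) * (1 - t * \<tau>) / (2 * (1 + \<alpha> * (t * \<tau>)))"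
      unfolding p H using n(3) by (simp_all add: field_simps)
    moreover have "tanh (\<beta> + h [c]) = (t + \<tau>) / (1 + t * \<tau>)" "tanh (- \<beta> + h [c]) = (\<tau> - t) / (1 - t * \<tau>)"
      using tanh_add[of \<beta> "h [c]"] tanh_add[of "- \<beta>" "h [c]"] by (simp_all add: t_def \<tau>_def)
    ultimately have "spin_prob (h []) 1 * tanh (\<beta> + h [c]) = (1 + \<alpha>) * (t + \<tau>) / (2 * (1 + \<alpha> * (t * \<tau>)))"
      "spin_prob (h []) (-1) * tanh (- \<beta> + h [c]) = (1 - \<alpha>) * (\<tau> - t) / (2 * (1 + \<alpha> * (t * \<tau>)))"
      using n by (simp_all only: times_divide_times_eq) simp_all
    then have "spin_prob (h []) 1 * tanh (\<beta> + h [c]) - spin_prob (h []) (-1) * tanh (- \<beta> + h [c]) =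
        ((1 + \<alpha>) * (t + \<tau>) - (1 - \<alpha>) * (\<tau> - t)) / (2 * (1 + \<alpha> * (t * \<tau>)))"
      by (simp only: diff_divide_distrib)
    also have "\<dots> = (2 * (t + \<alpha> * \<tau>)) / (2 * (1 + \<alpha> * (t * \<tau>)))" by (simp add: algebra_simps)
    also have "\<dots> = (t + \<alpha> * \<tau>) / (1 + \<alpha> * (t * \<tau>))" by (rule mult_divide_mult_cancel_left) simp
    also have "\<dots> = (t + \<alpha> * \<tau>) / (1 + t * (\<alpha> * \<tau>))" by (simp only: mult.left_commute)
    finally show ?thesis by (simp add: edge_corr_def t_def \<alpha>_def \<tau>_def a_def)
  qed
  finally show ?thesis .
qed

definition root_energy :: "real \<Rightarrow> 'a list set \<Rightarrow> real" where
  "root_energy \<beta> T = (\<Sum>a\<in>children T [].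
     edge_corr \<beta> (plus_field \<beta> T [] - plus_message \<beta> T [a]) (plus_field \<beta> T [a]))"

lemma sum_edge_spins_eq_root_energy:
  assumes "rooted_tree T" "0 \<le> \<beta>"
  shows "(\<Sum>i\<in>neighbours T []. \<integral>x. x [] * x i \<partial>ising_plus \<beta> T) = root_energy \<beta> T"
proof -
  have i: "inj_on (\<lambda>a. [a]) (children T [])" by (simp add: inj_on_def)
  have c: "cavity \<beta> (plus_field \<beta> T v) = plus_message \<beta> T v" for v
    unfolding plus_field_def by (rule plus_message_eq[OF assms, symmetric])
  show ?thesis
    unfolding neighbours_root root_energy_def ising_plus_eq_tree_chain[OF assms] sum.reindex[OF i] o_def
  proof (intro sum.cong refl)
    fix a assume "a \<in> children T []"
    then have "[a] \<in> T" by (simp add: children_def)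
    then show "(\<integral>x. x [] * x [a] \<partial>tree_chain \<beta> T (plus_field \<beta> T)) =
        edge_corr \<beta> (plus_field \<beta> T [] - plus_message \<beta> T [a]) (plus_field \<beta> T [a])"
      by (simp only: integral_edge_spins[OF assms(1)] c)
  qed
qed

lemma plus_field_minus:
  assumes "rooted_tree T" "a \<in> children T v"
  shows "plus_field \<beta> T v - plus_message \<beta> T (a # v) = (\<Sum>b\<in>children T v - {a}. plus_message \<beta> T (b # v))"
  unfolding plus_field_def incoming_def using assms finite_children[OF assms(1)] by (simp add: sum_diff1)

lemma plus_field_nonneg: "rooted_tree T \<Longrightarrow> 0 \<le> \<beta> \<Longrightarrow> 0 \<le> plus_field \<beta> T v"
  unfolding plus_field_def by (intro incoming_nonneg plus_message_nonneg)

lemma edge_corr_nonneg: "0 \<le> \<beta> \<Longrightarrow> 0 \<le> a \<Longrightarrow> 0 \<le> b \<Longrightarrow> 0 \<le> edge_corr \<beta> a b"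
  unfolding edge_corr_def by (intro divide_nonneg_nonneg add_nonneg_nonneg mult_nonneg_nonneg) auto

text \<open>
  The addition theorem of \<open>tanh\<close> on the values of \<open>tanh\<close>, including the limiting value 1.
\<close>

lemma frac_add_mono:
  fixes s t u v :: real
  assumes "0 \<le> s" "s \<le> t" "t \<le> 1" "0 \<le> u" "u \<le> v" "v \<le> 1"
  shows "(s + u) / (1 + s * u) \<le> (t + v) / (1 + t * v)"
proof -
  have "0 \<le> (t - s) * (1 - u * v)" "0 \<le> (v - u) * (1 - s * t)"
    using assms by (auto intro!: mult_nonneg_nonneg mult_le_one)
  then have "(s + u) * (1 + t * v) \<le> (t + v) * (1 + s * u)" by (simp add: algebra_simps)
  moreover have "0 < 1 + s * u" "0 < 1 + t * v" using assms by (auto intro!: add_pos_nonneg)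
  ultimately show ?thesis by (simp add: divide_simps)
qed

lemma edge_corr_mono:
  assumes "0 \<le> \<beta>" "\<beta> \<le> \<beta>'" "0 \<le> a" "a \<le> a'" "0 \<le> b" "b \<le> b'"
  shows "edge_corr \<beta> a b \<le> edge_corr \<beta>' a' b'"
  unfolding edge_corr_def using assms tanh_mult_bounds[of a' b'] tanh_real_lt_1[of \<beta>']
  by (intro frac_add_mono mult_mono) auto

lemma edge_corr_le_1: "0 \<le> \<beta> \<Longrightarrow> 0 \<le> a \<Longrightarrow> 0 \<le> b \<Longrightarrow> edge_corr \<beta> a b \<le> 1"
  using frac_add_mono[of "tanh \<beta>" 1 "tanh a * tanh b" 1] tanh_mult_bounds[of a b] tanh_real_lt_1[of \<beta>]
  unfolding edge_corr_def by simp

lemma plus_message_mono: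
  assumes "rooted_tree T" "0 \<le> \<beta>" "\<beta> \<le> \<beta>'"
  shows "plus_message \<beta> T v \<le> plus_message \<beta>' T v"
  by (rule LIMSEQ_le[OF message_tendsto message_tendsto]) (use assms in \<open>auto intro!: message_mono\<close>)

lemma root_energy_mono:
  assumes T: "rooted_tree T" and "0 \<le> \<beta>" "\<beta> \<le> \<beta>'"
  shows "root_energy \<beta> T \<le> root_energy \<beta>' T"
  unfolding root_energy_def
proof (intro sum_mono)
  fix a assume a: "a \<in> children T []"
  show "edge_corr \<beta> (plus_field \<beta> T [] - plus_message \<beta> T [a]) (plus_field \<beta> T [a])
      \<le> edge_corr \<beta>' (plus_field \<beta>' T [] - plus_message \<beta>' T [a]) (plus_field \<beta>' T [a])"
    unfolding plus_field_minus[OF T a] using assms plus_message_mono[OF assms]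
    by (intro edge_corr_mono sum_nonneg sum_mono)
      (auto simp: plus_field_def intro!: incoming_mono plus_message_nonneg incoming_nonneg)
qed

lemma root_energy_bounds:
  assumes T: "rooted_tree T" and \<beta>: "0 \<le> \<beta>"
  shows "0 \<le> root_energy \<beta> T" "root_energy \<beta> T \<le> card (children T [])"
proof -
  have a: "0 \<le> plus_field \<beta> T [] - plus_message \<beta> T [a]" if "a \<in> children T []" for a
    unfolding plus_field_minus[OF T that] using plus_message_nonneg[OF assms] by (intro sum_nonneg)
  show "0 \<le> root_energy \<beta> T" unfolding root_energy_def
    using a plus_field_nonneg[OF assms] \<beta> by (intro sum_nonneg edge_corr_nonneg) auto
  have "root_energy \<beta> T \<le> (\<Sum>a\<in>children T []. 1)" unfolding root_energy_def
    using a plus_field_nonneg[OF assms] \<beta> by (intro sum_mono edge_corr_le_1) auto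
  then show "root_energy \<beta> T \<le> card (children T [])" by simp
qed

lemma root_energy_eq_tanh:
  assumes T: "rooted_tree T" and \<beta>: "0 \<le> \<beta>" and z: "\<And>a. a \<in> children T [] \<Longrightarrow> plus_message \<beta> T [a] = 0"
  shows "root_energy \<beta> T = card (children T []) * tanh \<beta>"
proof -
  have "plus_field \<beta> T [] = 0" unfolding plus_field_def incoming_def using z by simp
  then have "edge_corr \<beta> (plus_field \<beta> T [] - plus_message \<beta> T [a]) (plus_field \<beta> T [a]) = tanh \<beta>"
    if "a \<in> children T []" for a
    using z[OF that] by (simp add: edge_corr_def)
  then show ?thesis unfolding root_energy_def by simp
qed

lemma root_energy_tendsto:
  assumes "(f \<longlongrightarrow> \<beta>) F" and u: "\<And>v. ((\<lambda>n. plus_message (f n) T v) \<longlongrightarrow> plus_message \<beta> T v) F" and "0 \<le> \<beta>" "rooted_tree T"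
  shows "((\<lambda>n. root_energy (f n) T) \<longlongrightarrow> root_energy \<beta> T) F"
proof -
  have h: "((\<lambda>n. plus_field (f n) T v) \<longlongrightarrow> plus_field \<beta> T v) F" for v
    unfolding plus_field_def incoming_def by (intro tendsto_sum u)
  have ne: "1 + tanh \<beta> * (tanh a * tanh b) \<noteq> 0" for a b :: real
    using tanh_mult_bounds[of \<beta> "artanh (tanh a * tanh b)"] tanh_artanh_real[OF tanh_mult_bounds(2,3), of a b] by simp
  show ?thesis
    unfolding root_energy_def edge_corr_def using assms(1) h u ne
    by (intro tendsto_sum tendsto_divide tendsto_add tendsto_mult tendsto_tanh tendsto_const tendsto_diff) auto
qed

lemma tendsto_message:
  assumes "(f \<longlongrightarrow> w) F" "(g \<longlongrightarrow> \<beta>) F"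
  shows "((\<lambda>x. message (f x) (g x) T n v) \<longlongrightarrow> message w \<beta> T n v) F"
  using assms by (induction n arbitrary: v) (auto simp: incoming_def intro!: tendsto_intros)

text \<open>
  As a decreasing limit of increasing continuous functions of \<open>\<beta>\<close>, the field of the plus measure is
  continuous from the right; where it is also an increasing limit, it is continuous from the left.
\<close>

lemma plus_message_tendsto_right:
  assumes T: "rooted_tree T" and \<beta>: "0 \<le> \<beta>" and f: "f \<longlonglongrightarrow> \<beta>" "\<And>n. \<beta> \<le> f n"
  shows "(\<lambda>n. plus_message (f n) T v) \<longlonglongrightarrow> plus_message \<beta> T v"
proof (rule order_tendstoI)
  fix c assume "c < plus_message \<beta> T v"
  then show "\<forall>\<^sub>F n in sequentially. c < plus_message (f n) T v"
    using plus_message_mono[OF T \<beta> f(2)] by (intro always_eventually allI) (rule less_le_trans)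
next
  fix c assume "plus_message \<beta> T v < c"
  then obtain k where k: "message \<beta> \<beta> T k v < c"
    using order_tendstoD(2)[OF message_tendsto[OF T \<beta>]] by (meson eventually_happens' sequentially_bot)
  have "\<forall>\<^sub>F n in sequentially. message (f n) (f n) T k v < c"
    using order_tendstoD(2)[OF tendsto_message[OF f(1) f(1)] k] .
  then show "\<forall>\<^sub>F n in sequentially. plus_message (f n) T v < c"
  proof eventually_elim
    case (elim n)
    have "0 \<le> f n" using \<beta> f(2)[of n] by simp
    then show ?case using plus_message_le_message[OF T, of "f n" v k] elim by simp
  qed
qed

lemma incoming_ge:
  assumes T: "rooted_tree T" and b: "b \<le> card (children T v)" and l: "\<And>a. a \<in> children T v \<Longrightarrow> l \<le> f (a # v)" "0 \<le> l"
  shows "b * l \<le> incoming T f v"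
proof -
  have "b * l \<le> (\<Sum>a\<in>children T v. l)" using b l(2) by (simp add: mult_right_mono)
  also have "\<dots> \<le> incoming T f v" unfolding incoming_def by (intro sum_mono l)
  finally show ?thesis .
qed

text \<open>
  If every vertex has at least \<open>b\<close> children and \<open>l\<close> is a subsolution of the cavity equation of the
  \<open>b\<close>-ary tree, the fields started from \<open>l\<close> increase to a solution that is bounded away from 0. Its
  ratio to the solution coming from the plus boundary condition is bounded and must be 1, by
  contraction.
\<close>

lemma message_tendsto_from_below:
  assumes T: "rooted_tree T" and b: "\<And>v. v \<in> T \<Longrightarrow> b \<le> card (children T v)" "1 \<le> b"
    and \<beta>: "0 < \<beta>" and l: "0 < l" "l \<le> cavity \<beta> (b * l)" and v: "v \<in> T"
  shows "message l \<beta> T n v \<le> plus_message \<beta> T v" "(\<lambda>n. message l \<beta> T n v) \<longlonglongrightarrow> plus_message \<beta> T v"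
proof -
  let ?m = "message l \<beta> T" and ?u = "plus_message \<beta> T"
  have l\<beta>: "l \<le> \<beta>" using l cavity_le[of \<beta> "b * l"] \<beta> by simp
  have child: "a # v \<in> T" if "a \<in> children T v" for a v using that by (simp add: children_def)
  have inc_cong: "incoming T f v \<le> incoming T g v" if "\<And>w. w \<in> T \<Longrightarrow> f w \<le> g w" for f g v
    unfolding incoming_def using that child by (intro sum_mono) auto
  have bl: "l \<le> b * l" using b(2) l(1) by simp
  have nn: "0 \<le> ?m n v" for n v using l \<beta> by (intro message_nonneg) auto
  have up: "?m n v \<le> ?m (Suc n) v" if "v \<in> T" for n v
    using that
  proof (induction n arbitrary: v)
    case 0
    have "b * l \<le> incoming T (?m 0) v" using l b 0 by (intro incoming_ge[OF T]) auto
    then have "cavity \<beta> (b * l) \<le> cavity \<beta> (incoming T (?m 0) v)"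
      using \<beta> l by (intro cavity_mono) auto
    then show ?case using l by simp
  next
    case (Suc n)
    show ?case
      unfolding message.simps(2)[of _ _ _ "Suc n"] message.simps(2)[of _ _ _ n]
      using \<beta> Suc by (intro cavity_mono inc_cong incoming_nonneg) (auto intro!: nn cavity_nonneg incoming_nonneg)
  qed
  then have inc: "incseq (\<lambda>n. ?m n v)" if "v \<in> T" for v using that by (intro incseq_SucI) auto
  have mu: "?m n v \<le> ?u v" if "v \<in> T" for n v
  proof (rule LIMSEQ_le_const[OF message_tendsto[OF T]])
    show "\<exists>N. \<forall>k\<ge>N. ?m n v \<le> message \<beta> \<beta> T k v"
    proof (intro exI[of _ n] allI impI)
      fix k assume "n \<le> k"
      then have "?m n v \<le> ?m k v" by (rule incseqD[OF inc[OF that]])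
      also have "\<dots> \<le> message \<beta> \<beta> T k v" using T l\<beta> l \<beta> by (intro message_mono) auto
      finally show "?m n v \<le> message \<beta> \<beta> T k v" .
    qed
  qed (use \<beta> in simp)
  show "message l \<beta> T n v \<le> ?u v" by (rule mu[OF v])
  define L where "L v = lim (\<lambda>n. ?m n v)" for v
  have L: "(\<lambda>n. ?m n v) \<longlonglongrightarrow> L v" if "v \<in> T" for v
  proof -
    have "convergent (\<lambda>n. ?m n v)"
      using inc[OF that] mu[OF that]
      by (intro Bseq_monoseq_convergent incseq_imp_monoseq incseq_bounded) auto
    then show ?thesis by (simp add: L_def convergent_LIMSEQ_iff)
  qed
  have Ll: "l \<le> L v" if "v \<in> T" for v
    using incseq_le[OF inc[OF that] L[OF that], of 0] by simp
  have Leq: "L v = cavity \<beta> (incoming T L v)" if "v \<in> T" for v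
  proof (rule LIMSEQ_unique[OF LIMSEQ_Suc[OF L[OF that]]])
    show "(\<lambda>n. ?m (Suc n) v) \<longlonglongrightarrow> cavity \<beta> (incoming T L v)"
      unfolding message.simps incoming_def using L child by (intro tendsto_intros) auto
  qed
  have inL: "l \<le> incoming T L v" if "v \<in> T" for v
  proof (rule order_trans[OF bl incoming_ge[OF T b(1)[OF that]]])
    show "l \<le> L (a # v)" if "a \<in> children T v" for a by (rule Ll[OF child[OF that]])
  qed (use l in simp)
  obtain \<delta> where \<delta>: "0 < \<delta>" "\<delta> \<le> 1"
    "\<And>R y. 1 \<le> R \<Longrightarrow> l \<le> y \<Longrightarrow> cavity \<beta> (R * y) \<le> (1 + (1 - \<delta>) * (R - 1)) * cavity \<beta> y"
    using cavity_ratio_contraction[OF \<beta> l(1)] by metis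
  define R where "R k = 1 + (1 - \<delta>) ^ k * (\<beta> / l - 1)" for k
  have R1: "1 \<le> R k" for k unfolding R_def using \<delta> l l\<beta> by auto
  \<comment> \<open>starts from \<open>?u v \<le> \<beta>\<close> and \<open>l \<le> L v\<close>; each use of the cavity equations shrinks \<open>R k - 1\<close> by \<open>1 - \<delta>\<close>\<close>
  have ratio: "?u v \<le> R k * L v" if "v \<in> T" for k v
    using that
  proof (induction k arbitrary: v)
    case 0
    have "?u v \<le> \<beta>" using \<beta> by (intro plus_message_le[OF T]) simp
    also have "\<dots> = \<beta> / l * l" using l by simp
    also have "\<dots> \<le> \<beta> / l * L v" using Ll[OF 0] l \<beta> by (intro mult_left_mono) auto
    finally show ?case by (simp add: R_def)
  next
    case (Suc k)
    have "?u v = cavity \<beta> (incoming T ?u v)" using \<beta> by (intro plus_message_eq[OF T]) simp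
    also have "\<dots> \<le> cavity \<beta> (R k * incoming T L v)"
    proof (rule cavity_mono)
      have "incoming T ?u v \<le> incoming T (\<lambda>w. R k * L w) v" by (rule inc_cong[OF Suc.IH])
      then show "incoming T ?u v \<le> R k * incoming T L v" by (simp add: incoming_def sum_distrib_left)
      show "0 \<le> incoming T ?u v" using \<beta> by (intro incoming_nonneg plus_message_nonneg[OF T]) simp
    qed (use \<beta> in auto)
    also have "\<dots> \<le> (1 + (1 - \<delta>) * (R k - 1)) * cavity \<beta> (incoming T L v)"
      using R1 inL[OF Suc.prems] by (intro \<delta>(3))
    also have "\<dots> = R (Suc k) * L v" using Leq[OF Suc.prems] by (simp add: R_def)
    finally show ?case .
  qed
  have "(\<lambda>k. R k * L v) \<longlonglongrightarrow> (1 + 0 * (\<beta> / l - 1)) * L v"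
    unfolding R_def using \<delta> by (intro tendsto_intros LIMSEQ_power_zero) auto
  then have "?u v \<le> (1 + 0 * (\<beta> / l - 1)) * L v"
    by (rule LIMSEQ_le_const) (use ratio[OF v] in auto)
  moreover have "L v \<le> ?u v" by (rule LIMSEQ_le_const2[OF L[OF v]]) (use mu[OF v] in auto)
  ultimately show "(\<lambda>n. ?m n v) \<longlonglongrightarrow> ?u v" using L[OF v] by simp
qed

text \<open>
  At 0 the map \<open>\<lambda>l. cavity \<beta> (b * l)\<close> has slope \<open>b * tanh \<beta> > 1\<close>.
\<close>

lemma cavity_subsolution:
  assumes "0 < \<beta>" "1 < b * tanh \<beta>"
  obtains l where "0 < l" "l \<le> cavity \<beta> (b * l)"
proof -
  have b: "0 < b" using assms by (metis less_trans mult_nonpos_nonneg not_less tanh_real_nonneg_iff zero_less_one less_imp_le)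
  have "((\<lambda>l. b * cavity_deriv \<beta> (b * l)) \<longlongrightarrow> b * cavity_deriv \<beta> (b * 0)) (at_right 0)"
    unfolding cavity_deriv_def by (intro tendsto_intros) (auto simp: )
  then have "\<forall>\<^sub>F l in at_right 0. 1 < b * cavity_deriv \<beta> (b * l)"
    using assms by (intro order_tendstoD(1)) (auto simp: cavity_deriv_def)
  moreover have "\<forall>\<^sub>F l in at_right (0::real). 0 < l" by (simp add: eventually_at_right_less)
  ultimately have "\<forall>\<^sub>F l in at_right (0::real). 0 < l \<and> 1 < b * cavity_deriv \<beta> (b * l)"
    by eventually_elim simp
  then obtain l where l: "0 < l" "1 < b * cavity_deriv \<beta> (b * l)"
    using eventually_happens'[OF trivial_limit_at_right_real] by (metis (mono_tags, lifting))
  have "l * 1 \<le> l * (b * cavity_deriv \<beta> (b * l))" using l by (intro mult_left_mono) auto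
  also have "\<dots> = (b * l) * cavity_deriv \<beta> (b * l)" by simp
  also have "\<dots> \<le> cavity \<beta> (b * l)" using assms l b by (intro cavity_ge_linear) auto
  finally show ?thesis using that l by simp
qed

lemma plus_message_tendsto_left:
  assumes T: "rooted_tree T" and b: "\<And>v. v \<in> T \<Longrightarrow> b \<le> card (children T v)" "1 \<le> b"
    and \<beta>: "0 < \<beta>\<^sub>1" "\<beta>\<^sub>1 < \<beta>" "1 < b * tanh \<beta>\<^sub>1" and f: "f \<longlonglongrightarrow> \<beta>" "\<And>n. \<beta>\<^sub>1 \<le> f n" "\<And>n. f n \<le> \<beta>"
    and v: "v \<in> T"
  shows "(\<lambda>n. plus_message (f n) T v) \<longlonglongrightarrow> plus_message \<beta> T v"
proof (rule order_tendstoI)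
  fix c assume "plus_message \<beta> T v < c"
  moreover have "plus_message (f n) T v \<le> plus_message \<beta> T v" for n
    using \<beta> f(2)[of n] f(3)[of n] by (intro plus_message_mono[OF T]) auto
  ultimately show "\<forall>\<^sub>F n in sequentially. plus_message (f n) T v < c"
    by (intro always_eventually allI) (rule le_less_trans)
next
  obtain l :: real where l: "0 < l" "l \<le> cavity \<beta>\<^sub>1 (b * l)" using cavity_subsolution[OF \<beta>(1,3)] .
  have l': "l \<le> cavity \<beta>' (b * l)" if "\<beta>\<^sub>1 \<le> \<beta>'" for \<beta>'
    using cavity_mono[of \<beta>\<^sub>1 \<beta>' "b * l" "b * l"] l \<beta> that by simp
  fix c assume c: "c < plus_message \<beta> T v"
  have "(\<lambda>n. message l \<beta> T n v) \<longlonglongrightarrow> plus_message \<beta> T v"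
    using \<beta> l l'[of \<beta>] by (intro message_tendsto_from_below(2)[OF T b _ _ _ v]) auto
  then have "\<forall>\<^sub>F n in sequentially. c < message l \<beta> T n v" by (rule order_tendstoD(1)[OF _ c])
  then obtain k where k: "c < message l \<beta> T k v" by (auto simp: eventually_sequentially)
  have "\<forall>\<^sub>F n in sequentially. c < message l (f n) T k v"
    using order_tendstoD(1)[OF tendsto_message[OF tendsto_const f(1)] k] .
  then show "\<forall>\<^sub>F n in sequentially. c < plus_message (f n) T v"
  proof eventually_elim
    case (elim n)
    have "message l (f n) T k v \<le> plus_message (f n) T v"
      using \<beta> l l'[OF f(2)[of n]] f(2)[of n] by (intro message_tendsto_from_below(1)[OF T b _ _ _ v]) auto
    then show ?case using elim by simp
  qed
qed

section \<open>Independence of the subtrees of a branching tree\<close>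

type_synonym 'q offspring = "('q \<times> nat) list \<Rightarrow> 'q \<Rightarrow> nat"

definition offspring_space :: "'q offspring measure" where
  "offspring_space = (\<Pi>\<^sub>M v\<in>UNIV. count_space UNIV)"

definition tree_law :: "(('q \<times> nat) list \<Rightarrow> ('q \<Rightarrow> nat) pmf) \<Rightarrow> 'q offspring measure" where
  "tree_law Q = (\<Pi>\<^sub>M v\<in>UNIV. measure_pmf (Q v))"

text \<open>
  Addresses are read up to the root, so the subtree of the child \<open>c\<close> of the root consists of the
  addresses \<open>v @ [c]\<close>.
\<close>

definition descend :: "'q \<times> nat \<Rightarrow> 'q offspring \<Rightarrow> 'q offspring" where
  "descend c K v = K (v @ [c])"

lemma sets_tree_law [measurable_cong]: "sets (tree_law Q) = sets offspring_space"
  unfolding tree_law_def offspring_space_def by (intro sets_PiM_cong) auto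

lemma space_tree_law [simp]: "space (tree_law Q) = UNIV"
  by (simp add: tree_law_def space_PiM)

lemma space_offspring_space [simp]: "space offspring_space = UNIV"
  by (simp add: offspring_space_def space_PiM)

lemma prob_space_tree_law: "prob_space (tree_law Q)"
  unfolding tree_law_def by (intro prob_space_PiM measure_pmf.prob_space_axioms)

lemma measurable_offspring [measurable]: "(\<lambda>K. K v) \<in> measurable offspring_space (count_space UNIV)"
  unfolding offspring_space_def by simp

lemma measurable_descend [measurable]: "descend c \<in> measurable offspring_space offspring_space"
proof -
  have "(\<lambda>K. \<lambda>v\<in>UNIV. K (v @ [c])) \<in> measurable offspring_space offspring_space"
    unfolding offspring_space_def by (intro measurable_restrict) simp
  also have "(\<lambda>K. \<lambda>v\<in>UNIV. K (v @ [c])) = descend c" by (simp add: descend_def fun_eq_iff)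
  finally show ?thesis .
qed

lemma distr_descend: "distr (tree_law Q) offspring_space (descend c) = tree_law (\<lambda>v. Q (v @ [c]))"
proof -
  have "distr (tree_law Q) (tree_law (\<lambda>v. Q (v @ [c]))) (\<lambda>K. \<lambda>v\<in>UNIV. K (v @ [c])) = tree_law (\<lambda>v. Q (v @ [c]))"
    unfolding tree_law_def
    by (rule distr_PiM_reindex) (auto simp: inj_on_def intro: measure_pmf.prob_space_axioms)
  moreover have "(\<lambda>K. \<lambda>v\<in>UNIV. K (v @ [c])) = descend c" by (simp add: descend_def fun_eq_iff)
  moreover have "distr (tree_law Q) (tree_law (\<lambda>v. Q (v @ [c]))) (descend c) = distr (tree_law Q) offspring_space (descend c)"
    by (rule distr_cong) (simp_all add: sets_tree_law)
  ultimately show ?thesis by simp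
qed

lemma integral_descend:
  fixes \<phi> :: "'q offspring \<Rightarrow> real"
  assumes [measurable]: "\<phi> \<in> borel_measurable offspring_space"
  shows "(\<integral>K. \<phi> (descend c K) \<partial>tree_law Q) = (\<integral>K. \<phi> K \<partial>tree_law (\<lambda>v. Q (v @ [c])))"
  unfolding distr_descend[symmetric]
  by (subst integral_distr) (simp_all add: measurable_cong_sets[OF sets_tree_law refl])

lemma integral_root:
  fixes f :: "('q \<Rightarrow> nat) \<Rightarrow> real"
  shows "(\<integral>K. f (K []) \<partial>tree_law Q) = (\<integral>k. f k \<partial>measure_pmf (Q []))"
proof -
  have "distr (tree_law Q) (measure_pmf (Q [])) (\<lambda>K. K []) = measure_pmf (Q [])"
    unfolding tree_law_def by (intro distr_PiM_component measure_pmf.prob_space_axioms) simp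
  then have "(\<integral>k. f k \<partial>measure_pmf (Q [])) = (\<integral>k. f k \<partial>distr (tree_law Q) (measure_pmf (Q [])) (\<lambda>K. K []))" by simp
  also have "\<dots> = (\<integral>K. f (K []) \<partial>tree_law Q)"
    by (subst integral_distr) (simp_all add: measurable_cong_sets[OF sets_tree_law refl])
  finally show ?thesis ..
qed

lemma integrable_bounded_tree_law:
  fixes \<phi> :: "'q offspring \<Rightarrow> real"
  assumes "\<phi> \<in> borel_measurable offspring_space" "\<And>K. \<bar>\<phi> K\<bar> \<le> B"
  shows "integrable (tree_law Q) \<phi>"
proof -
  interpret prob_space "tree_law Q" by (rule prob_space_tree_law)
  show ?thesis
    by (rule integrable_const_bound[where B = B])
      (use assms in \<open>auto simp: measurable_cong_sets[OF sets_tree_law refl]\<close>)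
qed

lemma indep_vars_tree_law:
  "prob_space.indep_vars (tree_law Q) (\<lambda>_. count_space UNIV) (\<lambda>v K. K v) UNIV"
proof -
  interpret prob_space "tree_law Q" by (rule prob_space_tree_law)
  have c: "(\<lambda>K. K v) \<in> measurable (tree_law Q) (count_space UNIV)" for v
    by (simp add: measurable_cong_sets[OF sets_tree_law refl])
  have d: "distr (tree_law Q) (count_space UNIV) (\<lambda>K. K v) = measure_pmf (Q v)" for v
  proof -
    have "distr (tree_law Q) (count_space UNIV) (\<lambda>K. K v) = distr (tree_law Q) (measure_pmf (Q v)) (\<lambda>K. K v)"
      by (rule distr_cong) auto
    also have "\<dots> = measure_pmf (Q v)"
      unfolding tree_law_def by (intro distr_PiM_component measure_pmf.prob_space_axioms) simp
    finally show ?thesis .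
  qed
  have "distr (tree_law Q) (\<Pi>\<^sub>M v\<in>UNIV. count_space UNIV) (\<lambda>K. \<lambda>v\<in>UNIV. K v) =
      distr (tree_law Q) (tree_law Q) (\<lambda>K. K)"
    by (rule distr_cong) (simp_all add: sets_tree_law offspring_space_def restrict_UNIV)
  also have "\<dots> = (\<Pi>\<^sub>M v\<in>UNIV. distr (tree_law Q) (count_space UNIV) (\<lambda>K. K v))"
    unfolding d by (simp add: tree_law_def[symmetric] distr_id)
  finally show ?thesis
    by (subst indep_vars_iff_distr_eq_PiM') (auto simp: c)
qed

text \<open>
  The offspring of the root and the subtrees of distinct potential children are read off disjoint sets
  of addresses.
\<close>

lemma integral_branching:
  fixes f :: "('q \<Rightarrow> nat) \<Rightarrow> real" and \<phi> :: "'q \<times> nat \<Rightarrow> 'q offspring \<Rightarrow> real"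
  assumes C: "finite C" and f: "\<And>k. \<bar>f k\<bar> \<le> B"
    and \<phi>: "\<And>c. c \<in> C \<Longrightarrow> \<phi> c \<in> borel_measurable offspring_space" "\<And>c K. c \<in> C \<Longrightarrow> \<bar>\<phi> c K\<bar> \<le> B"
  shows "(\<integral>K. f (K []) * (\<Prod>c\<in>C. \<phi> c (descend c K)) \<partial>tree_law Q) =
    (\<integral>k. f k \<partial>measure_pmf (Q [])) * (\<Prod>c\<in>C. \<integral>K. \<phi> c K \<partial>tree_law (\<lambda>v. Q (v @ [c])))"
proof -
  interpret prob_space "tree_law Q" by (rule prob_space_tree_law)
  define J where "J = insert None (Some ` C)"
  define I where "I j = (case j of None \<Rightarrow> {[]} | Some c \<Rightarrow> range (\<lambda>v. v @ [c]))" for j :: "('q \<times> nat) option"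
  define Y where "Y j r = (case j of None \<Rightarrow> f (r []) | Some c \<Rightarrow> \<phi> c (\<lambda>v. r (v @ [c])))" for j and r :: "'q offspring"
  define X where "X j K = (case j of None \<Rightarrow> f (K []) | Some c \<Rightarrow> \<phi> c (descend c K))" for j and K :: "'q offspring"
  have "indep_vars (\<lambda>j. PiM (I j) (\<lambda>_. count_space UNIV)) (\<lambda>j K. restrict (\<lambda>v. K v) (I j)) J"
    by (rule indep_vars_restrict[OF indep_vars_tree_law]) (auto simp: disjoint_family_on_def I_def split: option.splits)
  then have "indep_vars (\<lambda>_. borel) (\<lambda>j K. Y j (restrict (\<lambda>v. K v) (I j))) J"
  proof (rule indep_vars_compose2)
    fix j assume j: "j \<in> J"
    show "Y j \<in> borel_measurable (PiM (I j) (\<lambda>_. count_space UNIV))"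
    proof (cases j)
      case None
      have "(\<lambda>r. r []) \<in> measurable (PiM {[]} (\<lambda>_. count_space UNIV)) (count_space (UNIV :: ('q \<Rightarrow> nat) set))"
        by (rule measurable_component_singleton) simp
      then show ?thesis unfolding None I_def Y_def option.case by (rule measurable_compose) simp
    next
      case (Some c)
      then have c: "\<phi> c \<in> borel_measurable offspring_space" using j \<phi>(1) by (auto simp: J_def)
      have "(\<lambda>r. \<lambda>v\<in>UNIV. r (v @ [c])) \<in> measurable (PiM (range (\<lambda>v. v @ [c])) (\<lambda>_. count_space UNIV)) (offspring_space :: 'q offspring measure)"
        unfolding offspring_space_def by (intro measurable_restrict measurable_component_singleton) auto
      then have "(\<lambda>r. \<phi> c (\<lambda>v\<in>UNIV. r (v @ [c]))) \<in> borel_measurable (PiM (range (\<lambda>v. v @ [c])) (\<lambda>_. count_space UNIV))"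
        by (rule measurable_compose[OF _ c])
      then show ?thesis unfolding Some I_def Y_def option.case by (simp add: restrict_UNIV)
    qed
  qed
  moreover have eq: "Y j (restrict (\<lambda>v. K v) (I j)) = X j K" for j K
  proof (cases j)
    case (Some c)
    have "(\<lambda>v. restrict (\<lambda>v. K v) (range (\<lambda>v. v @ [c])) (v @ [c])) = descend c K"
      by (auto simp: descend_def fun_eq_iff)
    then show ?thesis by (simp add: Some Y_def X_def I_def)
  qed (simp add: Y_def X_def I_def)
  ultimately have ind: "indep_vars (\<lambda>_. borel) X J" by (simp only: eq)
  have int: "integrable (tree_law Q) (X j)" if "j \<in> J" for j
  proof (rule integrable_bounded_tree_law[where B = B])
    have m: "(\<lambda>K. f (K [])) \<in> borel_measurable offspring_space"
      by (rule measurable_compose[OF measurable_offspring]) simp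
    have m': "(\<lambda>K. \<phi> c (descend c K)) \<in> borel_measurable offspring_space" if "c \<in> C" for c
      by (rule measurable_compose[OF measurable_descend \<phi>(1)[OF that]])
    show "X j \<in> borel_measurable offspring_space"
      using that m m' by (auto simp: X_def[abs_def] J_def split: option.splits)
    show "\<bar>X j K\<bar> \<le> B" for K using that f \<phi>(2) by (auto simp: X_def J_def)
  qed
  have "finite J" using C by (simp add: J_def)
  have prod: "(\<Prod>j\<in>J. g j) = g None * (\<Prod>c\<in>C. g (Some c))" for g :: "('q \<times> nat) option \<Rightarrow> real"
    using C unfolding J_def by (subst prod.insert) (auto simp: prod.reindex)
  have "(\<integral>K. f (K []) * (\<Prod>c\<in>C. \<phi> c (descend c K)) \<partial>tree_law Q) = (\<integral>K. (\<Prod>j\<in>J. X j K) \<partial>tree_law Q)"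
    unfolding prod by (simp add: X_def)
  also have "\<dots> = (\<Prod>j\<in>J. \<integral>K. X j K \<partial>tree_law Q)"
    by (rule indep_vars_lebesgue_integral[OF \<open>finite J\<close> ind int])
  also have "\<dots> = (\<integral>k. f k \<partial>measure_pmf (Q [])) * (\<Prod>c\<in>C. \<integral>K. \<phi> c K \<partial>tree_law (\<lambda>v. Q (v @ [c])))"
  proof -
    have "(\<integral>K. X None K \<partial>tree_law Q) = (\<integral>k. f k \<partial>measure_pmf (Q []))"
      unfolding X_def option.case by (rule integral_root)
    moreover have "(\<integral>K. X (Some c) K \<partial>tree_law Q) = (\<integral>K. \<phi> c K \<partial>tree_law (\<lambda>v. Q (v @ [c])))" if "c \<in> C" for c
      unfolding X_def option.case by (rule integral_descend[OF \<phi>(1)[OF that]])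
    ultimately show ?thesis unfolding prod by (metis (no_types, lifting) prod.cong)
  qed
  finally show ?thesis .
qed

text \<open>
  Offspring laws in the subtree of a vertex of type \<open>fst a\<close> whose parent has type \<open>snd a\<close>.
\<close>

primrec subtree_law :: "'q offspring_laws \<Rightarrow> 'q \<times> 'q \<Rightarrow> ('q \<times> nat) list \<Rightarrow> ('q \<Rightarrow> nat) pmf" where
  "subtree_law P a [] = biased_law P (fst a) (snd a)"
| "subtree_law P a (c # v) = biased_law P (fst c) (vertex_type (fst a) v)"

lemma vertex_type_append: "vertex_type i (v @ [c]) = vertex_type (fst c) v"
  by (cases v) auto

lemma vertex_law_append: "vertex_law P i (v @ [c]) = subtree_law P (fst c, i) v"
  by (cases v) (auto simp: vertex_type_append)

lemma subtree_law_append: "subtree_law P a (v @ [c]) = subtree_law P (fst c, fst a) v"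
  by (cases v) (auto simp: vertex_type_append)

abbreviation subtree_measure :: "'q offspring_laws \<Rightarrow> 'q \<times> 'q \<Rightarrow> 'q offspring measure" where
  "subtree_measure P a \<equiv> tree_law (subtree_law P a)"

text \<open>
  A sum over the children of the root, of which only the first \<open>N\<close> of each type are kept. The cutoff
  makes all moments finite, also where the offspring means are infinite.
\<close>

definition child_sum :: "nat \<Rightarrow> ('q::finite \<Rightarrow> 'q offspring \<Rightarrow> real) \<Rightarrow> 'q offspring \<Rightarrow> real" where
  "child_sum N \<phi> K = (\<Sum>c\<in>UNIV \<times> {..<N}. if snd c < K [] (fst c) then \<phi> (fst c) (descend c K) else 0)"

definition trunc_mean :: "'q offspring_laws \<Rightarrow> nat \<Rightarrow> 'q \<times> 'q \<Rightarrow> 'q \<times> 'q \<Rightarrow> real" where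
  "trunc_mean P N a b =
     (if snd b = fst a then \<integral>k. real (min (k (fst b)) N) \<partial>measure_pmf (biased_law P (fst a) (snd a)) else 0)"

lemma trunc_mean_nonneg: "0 \<le> trunc_mean P N a b"
  by (simp add: trunc_mean_def)

lemma measurable_child_sum:
  assumes [measurable]: "\<And>j. \<phi> j \<in> borel_measurable offspring_space"
  shows "child_sum N \<phi> \<in> borel_measurable offspring_space"
proof -
  have [measurable]: "Measurable.pred offspring_space (\<lambda>K. snd c < K [] (fst c))" for c :: "'a \<times> nat"
    by (rule measurable_compose[OF measurable_offspring]) simp
  show ?thesis unfolding child_sum_def[abs_def] by measurable
qed

lemma child_sum_nonneg: "(\<And>j K. 0 \<le> \<phi> j K) \<Longrightarrow> 0 \<le> child_sum N \<phi> K"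
  unfolding child_sum_def by (intro sum_nonneg) auto

lemma child_sum_bound:
  fixes \<phi> :: "'q::finite \<Rightarrow> 'q offspring \<Rightarrow> real"
  assumes "\<And>j K. \<bar>\<phi> j K\<bar> \<le> B"
  shows "\<bar>child_sum N \<phi> K\<bar> \<le> real (card (UNIV \<times> {..<N} :: ('q \<times> nat) set)) * B"
proof -
  have "0 \<le> B" using assms[of undefined undefined] by linarith
  have "\<bar>child_sum N \<phi> K\<bar> \<le> (\<Sum>c\<in>UNIV \<times> {..<N}. \<bar>if snd c < K [] (fst c) then \<phi> (fst c) (descend c K) else 0\<bar>)"
    unfolding child_sum_def by (rule sum_abs)
  also have "\<dots> \<le> real (card (UNIV \<times> {..<N} :: ('q \<times> nat) set)) * B"
    using assms \<open>0 \<le> B\<close> by (intro sum_bounded_above) auto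
  finally show ?thesis .
qed

lemma sum_prob_less:
  fixes p :: "('q \<Rightarrow> nat) pmf"
  shows "(\<Sum>m<N. \<integral>k. (if m < k j then 1 else 0) \<partial>measure_pmf p) = (\<integral>k. real (min (k j) N) \<partial>measure_pmf p)"
proof -
  have "(\<Sum>m<N. if m < n then 1 else 0) = real (min n N)" for n :: nat
  proof -
    have "(\<Sum>m<N. if m < n then 1 else 0 :: real) = real (card ({..<N} \<inter> {m. m < n}))"
      by (simp add: sum.If_cases)
    also have "{..<N} \<inter> {m. m < n} = {..<min n N}" by auto
    finally show ?thesis by simp
  qed
  then have "(\<integral>k. real (min (k j) N) \<partial>measure_pmf p) = (\<integral>k. (\<Sum>m<N. if m < k j then 1 else 0) \<partial>measure_pmf p)" by simp
  also have "\<dots> = (\<Sum>m<N. \<integral>k. (if m < k j then 1 else 0) \<partial>measure_pmf p)"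
    by (rule Bochner_Integration.integral_sum) (auto intro!: measure_pmf.integrable_const_bound[where B = 1])
  finally show ?thesis ..
qed

definition bounded_rv :: "('q offspring \<Rightarrow> real) \<Rightarrow> bool" where
  "bounded_rv \<phi> \<longleftrightarrow> \<phi> \<in> borel_measurable offspring_space \<and> (\<forall>K. 0 \<le> \<phi> K) \<and> (\<exists>B. \<forall>K. \<phi> K \<le> B)"

lemma bounded_rv_family:
  fixes \<phi> :: "'b::finite \<Rightarrow> 'q offspring \<Rightarrow> real"
  assumes "\<And>b. bounded_rv (\<phi> b)"
  obtains B where "\<And>b K. \<phi> b K \<le> B"
proof -
  obtain f where f: "\<And>b K. \<phi> b K \<le> f b" using assms unfolding bounded_rv_def by metis
  have "\<phi> b K \<le> Max (range f)" for b K
    using order_trans[OF f[of b K] Max_ge[of "range f" "f b"]] by simp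
  then show ?thesis using that by blast
qed

lemma bounded_rv_const: "0 \<le> x \<Longrightarrow> bounded_rv (\<lambda>K. x)"
  by (auto simp: bounded_rv_def)

lemma bounded_rv_add: "bounded_rv \<phi> \<Longrightarrow> bounded_rv \<psi> \<Longrightarrow> bounded_rv (\<lambda>K. \<phi> K + \<psi> K)"
  unfolding bounded_rv_def
proof (safe intro!: borel_measurable_add add_nonneg_nonneg)
  fix A B assume "\<forall>K. \<phi> K \<le> A" "\<forall>K. \<psi> K \<le> B"
  then show "\<exists>B. \<forall>K. \<phi> K + \<psi> K \<le> B" by (intro exI[of _ "A + B"] allI add_mono) auto
qed auto

lemma bounded_rv_mult: "bounded_rv \<phi> \<Longrightarrow> bounded_rv \<psi> \<Longrightarrow> bounded_rv (\<lambda>K. \<phi> K * \<psi> K)"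
  unfolding bounded_rv_def
proof (safe intro!: borel_measurable_times mult_nonneg_nonneg)
  fix A B assume *: "\<forall>K. 0 \<le> \<phi> K" "\<forall>K. 0 \<le> \<psi> K" "\<forall>K. \<phi> K \<le> A" "\<forall>K. \<psi> K \<le> B"
  then have "0 \<le> A" by (meson order_trans)
  with * show "\<exists>B. \<forall>K. \<phi> K * \<psi> K \<le> B" by (intro exI[of _ "A * B"] allI mult_mono) auto
qed auto

lemma bounded_rv_child_sum:
  fixes \<phi> :: "'q::finite \<Rightarrow> 'q offspring \<Rightarrow> real"
  assumes "\<And>j. bounded_rv (\<phi> j)"
  shows "bounded_rv (child_sum N \<phi>)"
proof -
  obtain B where B: "\<And>j K. \<phi> j K \<le> B" by (rule bounded_rv_family[of \<phi>, OF assms]) blast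
  have n: "0 \<le> \<phi> j K" for j K using assms by (simp add: bounded_rv_def)
  then have "\<bar>\<phi> j K\<bar> \<le> B" for j K using B by simp
  then have "child_sum N \<phi> K \<le> real (card (UNIV \<times> {..<N} :: ('q \<times> nat) set)) * B" for K
    by (rule abs_le_D1[OF child_sum_bound])
  then have "\<exists>B. \<forall>K. child_sum N \<phi> K \<le> B" by blast
  then show ?thesis using assms n unfolding bounded_rv_def
    by (auto intro!: measurable_child_sum child_sum_nonneg)
qed

lemma integrable_bounded_rv: "bounded_rv \<phi> \<Longrightarrow> integrable (tree_law Q) \<phi>"
proof -
  assume b: "bounded_rv \<phi>"
  then obtain B where "\<And>K. \<phi> K \<le> B" by (auto simp: bounded_rv_def)
  then show ?thesis using b by (intro integrable_bounded_tree_law[where B = B]) (auto simp: bounded_rv_def)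
qed

lemma integral_bounded_rv_nonneg: "bounded_rv \<phi> \<Longrightarrow> 0 \<le> (\<integral>K. \<phi> K \<partial>tree_law Q)"
  by (intro Bochner_Integration.integral_nonneg) (simp add: bounded_rv_def)

lemma expectation_child_sum:
  fixes \<phi> :: "'q::finite \<times> 'q \<Rightarrow> 'q offspring \<Rightarrow> real"
  assumes b: "\<And>b. bounded_rv (\<phi> b)"
  shows "(\<integral>K. child_sum N (\<lambda>j. \<phi> (j, fst a)) K \<partial>subtree_measure P a) =
    (\<Sum>b\<in>UNIV. trunc_mean P N a b * (\<integral>K. \<phi> b K \<partial>subtree_measure P b))"
proof -
  obtain B where le: "\<And>b K. \<phi> b K \<le> B" by (rule bounded_rv_family[of \<phi>, OF b]) blast
  have \<phi>: "\<phi> b \<in> borel_measurable offspring_space" "\<bar>\<phi> b K\<bar> \<le> B" for b K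
    using b[of b] le[of b K] by (simp_all add: bounded_rv_def)
  interpret prob_space "subtree_measure P a" by (rule prob_space_tree_law)
  let ?p = "measure_pmf (biased_law P (fst a) (snd a))"
  let ?E = "\<lambda>b. \<integral>K. \<phi> b K \<partial>subtree_measure P b"
  let ?X = "\<lambda>c K. if snd c < K [] (fst c) then \<phi> (fst c, fst a) (descend c K) else 0"
  have m: "?X c \<in> borel_measurable offspring_space" for c
  proof -
    have [measurable]: "Measurable.pred offspring_space (\<lambda>K. snd c < K [] (fst c))"
      by (rule measurable_compose[OF measurable_offspring]) simp
    note \<phi>(1)[measurable]
    show ?thesis by measurable
  qed
  have B: "0 \<le> B" using \<phi>(2)[of undefined undefined] by linarith
  have one: "(\<integral>K. ?X c K \<partial>subtree_measure P a) = (\<integral>k. (if snd c < k (fst c) then 1 else 0) \<partial>?p) * ?E (fst c, fst a)" for c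
  proof -
    have "(\<integral>K. ?X c K \<partial>subtree_measure P a) =
        (\<integral>K. (if snd c < K [] (fst c) then 1 else 0) * (\<Prod>c\<in>{c}. \<phi> (fst c, fst a) (descend c K)) \<partial>subtree_measure P a)"
      by (intro Bochner_Integration.integral_cong) auto
    also have "\<dots> = (\<integral>k. (if snd c < k (fst c) then 1 else 0) \<partial>measure_pmf (subtree_law P a [])) *
        (\<Prod>c\<in>{c}. \<integral>K. \<phi> (fst c, fst a) K \<partial>tree_law (\<lambda>v. subtree_law P a (v @ [c])))"
      using \<phi> B by (intro integral_branching[where B = "max B 1"]) (auto simp: le_max_iff_disj)
    finally show ?thesis by (simp add: subtree_law_append[abs_def])
  qed
  have "(\<integral>K. child_sum N (\<lambda>j. \<phi> (j, fst a)) K \<partial>subtree_measure P a) = (\<Sum>c\<in>UNIV \<times> {..<N}. \<integral>K. ?X c K \<partial>subtree_measure P a)"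
    unfolding child_sum_def using m \<phi>(2) B
    by (intro Bochner_Integration.integral_sum integrable_bounded_tree_law[where B = B]) auto
  also have "\<dots> = (\<Sum>j\<in>UNIV. \<Sum>i<N. (\<integral>k. (if i < k j then 1 else 0) \<partial>?p) * ?E (j, fst a))"
    unfolding one by (simp add: sum.cartesian_product case_prod_beta)
  also have "\<dots> = (\<Sum>j\<in>UNIV. trunc_mean P N a (j, fst a) * ?E (j, fst a))"
    by (simp add: sum_distrib_right[symmetric] sum_prob_less trunc_mean_def)
  also have "\<dots> = (\<Sum>b\<in>UNIV \<times> {fst a}. trunc_mean P N a b * ?E b)"
    by (subst sum.cartesian_product[symmetric, where g = "\<lambda>i j. trunc_mean P N a (i, j) * ?E (i, j)", simplified]) simp
  also have "\<dots> = (\<Sum>b\<in>UNIV. trunc_mean P N a b * ?E b)"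
    by (rule sum.mono_neutral_left) (auto simp: trunc_mean_def)
  finally show ?thesis .
qed

text \<open>
  The first term comes from the diagonal of the squared sum. Off the diagonal, independence bounds each
  term by a product of expectations, whatever the correlations of the offspring numbers.
\<close>

lemma second_moment_child_sum:
  fixes \<phi> :: "'q::finite \<times> 'q \<Rightarrow> 'q offspring \<Rightarrow> real"
  assumes b: "\<And>b. bounded_rv (\<phi> b)"
  shows "(\<integral>K. (child_sum N (\<lambda>j. \<phi> (j, fst a)) K)\<^sup>2 \<partial>subtree_measure P a) \<le>
    (\<Sum>b\<in>UNIV. trunc_mean P N a b * (\<integral>K. (\<phi> b K)\<^sup>2 \<partial>subtree_measure P b)) +
    (real N * (\<Sum>b\<in>UNIV. \<integral>K. \<phi> b K \<partial>subtree_measure P b))\<^sup>2"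
proof -
  obtain B where le: "\<And>b K. \<phi> b K \<le> B" by (rule bounded_rv_family[of \<phi>, OF b]) blast
  have \<phi>: "\<phi> b \<in> borel_measurable offspring_space" "0 \<le> \<phi> b K" "\<phi> b K \<le> B" for b K
    using b[of b] le[of b K] by (simp_all add: bounded_rv_def)
  interpret prob_space "subtree_measure P a" by (rule prob_space_tree_law)
  let ?E = "\<lambda>b. \<integral>K. \<phi> b K \<partial>subtree_measure P b"
  let ?C = "UNIV \<times> {..<N} :: ('q \<times> nat) set"
  let ?I = "\<lambda>c K. if snd c < K [] (fst c) then 1 else 0 :: real"
  let ?X = "\<lambda>c K. if snd c < K [] (fst c) then \<phi> (fst c, fst a) (descend c K) else 0"
  have m [measurable]: "?X c \<in> borel_measurable offspring_space" for c
  proof -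
    have [measurable]: "Measurable.pred offspring_space (\<lambda>K. snd c < K [] (fst c))"
      by (rule measurable_compose[OF measurable_offspring]) simp
    note \<phi>(1)[measurable]
    show ?thesis by measurable
  qed
  have B: "0 \<le> B" using \<phi>(2,3)[of undefined undefined] by linarith
  have X: "0 \<le> ?X c K" "?X c K \<le> B" for c K using \<phi>(2,3) B by auto
  have E: "0 \<le> ?E b" for b using \<phi>(2) by (intro Bochner_Integration.integral_nonneg) auto
  have int: "integrable (subtree_measure P a) (\<lambda>K. ?X c K * ?X c' K)" for c c'
  proof (rule integrable_bounded_tree_law[where B = "B * B"])
    show "(\<lambda>K. ?X c K * ?X c' K) \<in> borel_measurable offspring_space" by measurable
    show "\<bar>?X c K * ?X c' K\<bar> \<le> B * B" for K
      unfolding abs_mult using X[of c K] X[of c' K] B by (intro mult_mono) (simp_all only: abs_of_nonneg)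
  qed
  have off: "(\<integral>K. ?X c K * ?X c' K \<partial>subtree_measure P a) \<le> ?E (fst c, fst a) * ?E (fst c', fst a)" if "c \<noteq> c'" for c c'
  proof -
    have "(\<integral>K. ?X c K * ?X c' K \<partial>subtree_measure P a) =
        (\<integral>K. (?I c K * ?I c' K) * (\<Prod>c\<in>{c, c'}. \<phi> (fst c, fst a) (descend c K)) \<partial>subtree_measure P a)"
      using that by (intro Bochner_Integration.integral_cong) auto
    also have "\<dots> = (\<integral>k. (if snd c < k (fst c) then 1 else 0) * (if snd c' < k (fst c') then 1 else 0) \<partial>measure_pmf (subtree_law P a [])) *
        (\<Prod>c\<in>{c, c'}. \<integral>K. \<phi> (fst c, fst a) K \<partial>tree_law (\<lambda>v. subtree_law P a (v @ [c])))"
      using \<phi> B by (intro integral_branching[where B = "max B 1"]) (auto simp: le_max_iff_disj)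
    also have "\<dots> \<le> 1 * (\<Prod>c\<in>{c, c'}. \<integral>K. \<phi> (fst c, fst a) K \<partial>tree_law (\<lambda>v. subtree_law P a (v @ [c])))"
    proof (rule mult_right_mono)
      show "(\<integral>k. (if snd c < k (fst c) then 1 else 0) * (if snd c' < k (fst c') then 1 else 0) \<partial>measure_pmf (subtree_law P a [])) \<le> (1 :: real)"
        by (rule measure_pmf.integral_le_const) (auto intro!: measure_pmf.integrable_const_bound[where B = 1])
      show "0 \<le> (\<Prod>c\<in>{c, c'}. \<integral>K. \<phi> (fst c, fst a) K \<partial>tree_law (\<lambda>v. subtree_law P a (v @ [c])))"
        using \<phi>(2) by (intro prod_nonneg Bochner_Integration.integral_nonneg)
    qed
    finally show ?thesis using that by (simp add: subtree_law_append[abs_def])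
  qed
  have diag: "(\<Sum>c\<in>?C. \<integral>K. ?X c K * ?X c K \<partial>subtree_measure P a) =
      (\<Sum>b\<in>UNIV. trunc_mean P N a b * (\<integral>K. (\<phi> b K)\<^sup>2 \<partial>subtree_measure P b))"
  proof -
    have "(\<Sum>c\<in>?C. \<integral>K. ?X c K * ?X c K \<partial>subtree_measure P a) = (\<integral>K. (\<Sum>c\<in>?C. ?X c K * ?X c K) \<partial>subtree_measure P a)"
      by (rule Bochner_Integration.integral_sum[OF int, symmetric])
    also have "\<dots> = (\<integral>K. child_sum N (\<lambda>j K. (\<phi> (j, fst a) K)\<^sup>2) K \<partial>subtree_measure P a)"
      unfolding child_sum_def
      by (intro Bochner_Integration.integral_cong sum.cong) (auto simp: power2_eq_square)
    also have "\<dots> = (\<Sum>b\<in>UNIV. trunc_mean P N a b * (\<integral>K. (\<phi> b K)\<^sup>2 \<partial>subtree_measure P b))"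
      using bounded_rv_mult[OF b b] by (intro expectation_child_sum) (simp add: power2_eq_square)
    finally show ?thesis .
  qed
  have "(\<integral>K. (child_sum N (\<lambda>j. \<phi> (j, fst a)) K)\<^sup>2 \<partial>subtree_measure P a) =
      (\<integral>K. (\<Sum>c\<in>?C. \<Sum>c'\<in>?C. ?X c K * ?X c' K) \<partial>subtree_measure P a)"
    unfolding child_sum_def power2_eq_square sum_product ..
  also have "\<dots> = (\<Sum>c\<in>?C. \<Sum>c'\<in>?C. \<integral>K. ?X c K * ?X c' K \<partial>subtree_measure P a)"
    using int by (simp add: Bochner_Integration.integral_sum)
  also have "\<dots> \<le> (\<Sum>c\<in>?C. \<Sum>c'\<in>?C. (if c = c' then \<integral>K. ?X c K * ?X c K \<partial>subtree_measure P a else 0) +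
      ?E (fst c, fst a) * ?E (fst c', fst a))"
  proof (intro sum_mono)
    fix c c' :: "'q \<times> nat"
    show "(\<integral>K. ?X c K * ?X c' K \<partial>subtree_measure P a) \<le> (if c = c' then \<integral>K. ?X c K * ?X c K \<partial>subtree_measure P a else 0) +
      ?E (fst c, fst a) * ?E (fst c', fst a)"
      using off[of c c'] mult_nonneg_nonneg[OF E[of "(fst c, fst a)"] E[of "(fst c', fst a)"]] by (cases "c = c'") auto
  qed
  also have "\<dots> = (\<Sum>c\<in>?C. \<integral>K. ?X c K * ?X c K \<partial>subtree_measure P a) + (\<Sum>c\<in>?C. ?E (fst c, fst a))\<^sup>2"
    unfolding sum.distrib power2_eq_square sum_product by (simp add: sum.delta)
  also have "\<dots> \<le> (\<Sum>b\<in>UNIV. trunc_mean P N a b * (\<integral>K. (\<phi> b K)\<^sup>2 \<partial>subtree_measure P b)) + (real N * (\<Sum>b\<in>UNIV. ?E b))\<^sup>2"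
  proof -
    have "(\<Sum>c\<in>?C. ?E (fst c, fst a)) = real N * (\<Sum>j\<in>UNIV. ?E (j, fst a))"
      using sum.cartesian_product[of "\<lambda>j i. ?E (j, fst a)" "{..<N}" UNIV]
      by (simp add: case_prod_beta sum_distrib_left)
    also have "(\<Sum>j\<in>UNIV. ?E (j, fst a)) = (\<Sum>b\<in>UNIV \<times> {fst a}. ?E b)"
      using sum.cartesian_product[of "\<lambda>i j. ?E (i, j)" "{fst a}" UNIV] by (simp add: case_prod_beta)
    also have "\<dots> \<le> (\<Sum>b\<in>UNIV. ?E b)" using E by (intro sum_mono2) auto
    finally have "(\<Sum>c\<in>?C. ?E (fst c, fst a)) \<le> real N * (\<Sum>b\<in>UNIV. ?E b)" by (simp add: mult_left_mono)
    moreover have "0 \<le> (\<Sum>c\<in>?C. ?E (fst c, fst a))" using E by (intro sum_nonneg)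
    ultimately show ?thesis unfolding diag by (intro add_left_mono power_mono)
  qed
  finally show ?thesis .
qed

section \<open>Messages as random variables\<close>

lemma measurable_mem_tree: "Measurable.pred tree_space (\<lambda>T. v \<in> T)"
proof -
  have "{T \<in> space tree_space. v \<in> T} = {T. rooted_tree T \<and> v \<in> T}"
    by (simp add: tree_space_def space_measure_of_conv)
  moreover have "{T. rooted_tree T \<and> v \<in> T} \<in> sets tree_space"
    unfolding tree_space_def by (subst sets_measure_of) (auto intro: sigma_sets.Basic)
  ultimately show ?thesis by (simp add: pred_def)
qed

lemma space_tree_space: "space tree_space = Collect rooted_tree"
  by (simp add: tree_space_def space_measure_of_conv)

text \<open>
  The children are enumerated by \<open>to_nat\<close>; for each tree, finitely many terms give the whole sum.
\<close>

lemma measurable_sum_children: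
  fixes f :: "'a::countable \<Rightarrow> 'a list set \<Rightarrow> real"
  assumes [measurable]: "\<And>a. f a \<in> borel_measurable tree_space"
  shows "(\<lambda>T. \<Sum>a\<in>children T v. f a T) \<in> borel_measurable tree_space"
proof (rule borel_measurable_LIMSEQ_real)
  define A where "A N = {a :: 'a. to_nat a < N}" for N
  have fin: "finite (A N)" for N
  proof -
    have "A N \<subseteq> from_nat ` {..<N}"
    proof
      fix a assume "a \<in> A N"
      then have "a = from_nat (to_nat a)" "to_nat a \<in> {..<N}" by (auto simp: A_def)
      then show "a \<in> from_nat ` {..<N}" by blast
    qed
    then show ?thesis by (rule finite_subset) simp
  qed
  note measurable_mem_tree[measurable]
  show "(\<lambda>T. \<Sum>a\<in>A N. if a # v \<in> T then f a T else 0) \<in> borel_measurable tree_space" for N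
    by measurable
  fix T :: "'a list set" assume "T \<in> space tree_space"
  then have T: "rooted_tree T" by (simp add: space_tree_space)
  define M where "M = Suc (Max (insert 0 (to_nat ` children T v)))"
  have M: "children T v \<subseteq> A N" if "M \<le> N" for N
  proof
    fix a assume "a \<in> children T v"
    then have "to_nat a \<le> Max (insert 0 (to_nat ` children T v))"
      using finite_children[OF T] by (intro Max_ge) auto
    then show "a \<in> A N" using that by (simp add: A_def M_def)
  qed
  have "(\<Sum>a\<in>A N. if a # v \<in> T then f a T else 0) = (\<Sum>a\<in>children T v. f a T)" if "M \<le> N" for N
    using M[OF that] fin by (intro sum.mono_neutral_cong_right) (auto simp: children_def)
  then have "\<forall>\<^sub>F N in sequentially. (\<Sum>a\<in>children T v. f a T) = (\<Sum>a\<in>A N. if a # v \<in> T then f a T else 0)"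
    unfolding eventually_sequentially by metis
  then show "(\<lambda>N. \<Sum>a\<in>A N. if a # v \<in> T then f a T else 0) \<longlonglongrightarrow> (\<Sum>a\<in>children T v. f a T)"
    by (rule Lim_transform_eventually[OF tendsto_const])
qed

lemma measurable_message:
  "(\<lambda>T :: 'a::countable list set. message w \<beta> T n v) \<in> borel_measurable tree_space"
proof (induction n arbitrary: v)
  case (Suc n)
  have "(\<lambda>T. \<Sum>a\<in>children T v. message w \<beta> T n (a # v)) \<in> borel_measurable tree_space"
    by (rule measurable_sum_children) (rule Suc)
  then show ?case unfolding message.simps incoming_def by measurable
qed simp

lemma measurable_plus_message:
  assumes "0 \<le> \<beta>"
  shows "(\<lambda>T :: 'a::countable list set. plus_message \<beta> T v) \<in> borel_measurable tree_space"
  by (rule borel_measurable_LIMSEQ_real[OF message_tendsto measurable_message])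
    (use assms in \<open>auto simp: space_tree_space\<close>)

abbreviation offspring_tree :: "'q::finite offspring \<Rightarrow> ('q \<times> nat) list set" where
  "offspring_tree K \<equiv> Collect (in_tree K)"

lemma measurable_offspring_tree: "offspring_tree \<in> measurable offspring_space tree_space"
  using measurable_in_tree[of "\<lambda>_. return_pmf undefined", folded tree_law_def]
  by (simp only: measurable_cong_sets[OF sets_tree_law refl])

lemma in_tree_append: "in_tree K (v @ [c]) \<longleftrightarrow> snd c < K [] (fst c) \<and> in_tree (descend c K) v"
  by (induction v) (auto simp: descend_def)

lemma children_offspring_tree_root: "children (offspring_tree K) [] = {c. snd c < K [] (fst c)}"
  by (simp add: children_def)

lemma message_descend:
  assumes "snd c < K [] (fst c)"
  shows "message w \<beta> (offspring_tree K) n (v @ [c]) = message w \<beta> (offspring_tree (descend c K)) n v"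
proof (induction n arbitrary: v)
  case (Suc n)
  have "children (offspring_tree K) (v @ [c]) = children (offspring_tree (descend c K)) v"
    unfolding children_def using assms in_tree_append[of K "_ # v" c] by simp
  then show ?case using Suc[of "_ # v"] by (simp add: incoming_def)
qed simp

definition truncate :: "nat \<Rightarrow> 'q offspring \<Rightarrow> 'q offspring" where
  "truncate N K v j = min (K v j) N"

lemma measurable_truncate [measurable]:
  "(truncate N :: 'q offspring \<Rightarrow> 'q offspring) \<in> measurable offspring_space offspring_space"
proof -
  have "(\<lambda>K j. min (K v j) N) \<in> measurable (offspring_space :: 'q offspring measure) (count_space UNIV)" for v
    by (rule measurable_compose[OF measurable_offspring[of v]]) simp
  then have "(\<lambda>K. \<lambda>v\<in>UNIV. \<lambda>j. min (K v j) N) \<in> measurable (offspring_space :: 'q offspring measure) (\<Pi>\<^sub>M v\<in>UNIV. count_space UNIV)"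
    by (intro measurable_restrict)
  also have "(\<lambda>K. \<lambda>v\<in>UNIV. \<lambda>j. min (K v j) N) = (truncate N :: 'q offspring \<Rightarrow> 'q offspring)"
    by (simp add: truncate_def fun_eq_iff restrict_UNIV)
  finally show ?thesis by (simp only: offspring_space_def)
qed

lemma descend_truncate: "descend c (truncate N K) = truncate N (descend c K)"
  by (simp add: descend_def truncate_def fun_eq_iff)

lemma offspring_tree_truncate: "offspring_tree (truncate N K) \<subseteq> offspring_tree K"
proof -
  have "in_tree (truncate N K) v \<Longrightarrow> in_tree K v" for v
    by (induction v) (auto simp: truncate_def)
  then show ?thesis by auto
qed

definition trunc_message :: "nat \<Rightarrow> real \<Rightarrow> nat \<Rightarrow> 'q::finite offspring \<Rightarrow> real" where
  "trunc_message N \<beta> n K = message \<beta> \<beta> (offspring_tree (truncate N K)) n []"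

definition root_message :: "real \<Rightarrow> 'q::finite offspring \<Rightarrow> real" where
  "root_message \<beta> K = plus_message \<beta> (offspring_tree K) []"

lemma child_sum_eq_incoming:
  fixes \<phi> :: "'q::finite offspring \<Rightarrow> real"
  shows "child_sum N (\<lambda>_. \<phi>) K = (\<Sum>c\<in>{c \<in> children (offspring_tree K) []. snd c < N}. \<phi> (descend c K))"
proof -
  have "child_sum N (\<lambda>_. \<phi>) K = (\<Sum>c\<in>{c \<in> UNIV \<times> {..<N}. snd c < K [] (fst c)}. \<phi> (descend c K))"
    unfolding child_sum_def by (rule sum.inter_filter[symmetric]) simp
  also have "{c \<in> UNIV \<times> {..<N}. snd c < K [] (fst c)} = {c \<in> children (offspring_tree K) []. snd c < N}"
    by (auto simp: children_offspring_tree_root)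
  finally show ?thesis .
qed

lemma trunc_message_Suc:
  "trunc_message N \<beta> (Suc n) K = cavity \<beta> (child_sum N (\<lambda>_. trunc_message N \<beta> n) K)"
proof -
  have "incoming (offspring_tree (truncate N K)) (message \<beta> \<beta> (offspring_tree (truncate N K)) n) [] =
      (\<Sum>c\<in>children (offspring_tree (truncate N K)) []. trunc_message N \<beta> n (descend c K))"
    unfolding incoming_def
  proof (intro sum.cong refl)
    fix c assume "c \<in> children (offspring_tree (truncate N K)) []"
    then have "snd c < truncate N K [] (fst c)" by (simp add: children_def)
    then show "message \<beta> \<beta> (offspring_tree (truncate N K)) n [c] = trunc_message N \<beta> n (descend c K)"
      using message_descend[of c "truncate N K" \<beta> \<beta> n "[]"]
      by (simp add: trunc_message_def descend_truncate)
  qed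
  also have "children (offspring_tree (truncate N K)) [] = {c \<in> children (offspring_tree K) []. snd c < N}"
    by (auto simp: children_offspring_tree_root truncate_def)
  finally show ?thesis by (simp add: trunc_message_def child_sum_eq_incoming)
qed

lemma measurable_trunc_message [measurable]: "trunc_message N \<beta> n \<in> borel_measurable offspring_space"
  unfolding trunc_message_def[abs_def]
  by (rule measurable_compose[OF measurable_truncate measurable_compose[OF measurable_offspring_tree measurable_message]])

lemma trunc_message_bounds:
  assumes "0 \<le> \<beta>"
  shows "0 \<le> trunc_message N \<beta> n K" "trunc_message N \<beta> n K \<le> \<beta>"
  unfolding trunc_message_def using assms by (auto intro: message_nonneg message_le)

lemma measurable_root_message [measurable]:
  "0 \<le> \<beta> \<Longrightarrow> root_message \<beta> \<in> borel_measurable offspring_space"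
  unfolding root_message_def[abs_def]
  by (rule measurable_compose[OF measurable_offspring_tree measurable_plus_message])

lemma root_message_bounds:
  assumes "0 \<le> \<beta>"
  shows "0 \<le> root_message \<beta> K" "root_message \<beta> K \<le> \<beta>"
  unfolding root_message_def using assms by (auto intro: plus_message_nonneg plus_message_le rooted_tree_in_tree)

lemma trunc_message_tendsto_0:
  assumes \<beta>: "0 \<le> \<beta>" and "root_message \<beta> K = 0"
  shows "(\<lambda>n. trunc_message N \<beta> n K) \<longlonglongrightarrow> 0"
proof -
  let ?T = "offspring_tree (truncate N K)"
  have "plus_message \<beta> ?T [] \<le> plus_message \<beta> (offspring_tree K) []"
    by (rule LIMSEQ_le[OF message_tendsto message_tendsto])
      (use \<beta> offspring_tree_truncate[of N K] in \<open>auto intro!: message_mono rooted_tree_in_tree\<close>)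
  moreover have "0 \<le> plus_message \<beta> ?T []" by (rule plus_message_nonneg[OF rooted_tree_in_tree \<beta>])
  ultimately have "plus_message \<beta> ?T [] = 0" using assms(2) by (simp add: root_message_def)
  then show ?thesis using message_tendsto[OF rooted_tree_in_tree \<beta>, of "truncate N K" "[]"]
    by (simp add: trunc_message_def)
qed

lemma plus_message_child:
  assumes "snd c < K [] (fst c)" "0 \<le> \<beta>"
  shows "plus_message \<beta> (offspring_tree K) [c] = root_message \<beta> (descend c K)"
  unfolding root_message_def plus_message_def using message_descend[of c K \<beta> \<beta> _ "[]"] assms(1) by simp

lemma plus_field_root:
  assumes "0 \<le> \<beta>"
  shows "plus_field \<beta> (offspring_tree K) [] = (\<Sum>c\<in>children (offspring_tree K) []. root_message \<beta> (descend c K))"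
  unfolding plus_field_def incoming_def
  by (intro sum.cong refl plus_message_child assms) (simp add: children_def)


section \<open>Uniqueness forces subcritical growth\<close>

lemma expectation_sq_le:
  assumes "bounded_rv \<phi>"
  shows "(\<integral>K. \<phi> K \<partial>tree_law Q)\<^sup>2 \<le> (\<integral>K. (\<phi> K)\<^sup>2 \<partial>tree_law Q)"
proof -
  interpret prob_space "tree_law Q" by (rule prob_space_tree_law)
  have "integrable (tree_law Q) (\<lambda>K. (\<phi> K)\<^sup>2)"
    using integrable_bounded_rv[OF bounded_rv_mult[OF assms assms]] by (simp add: power2_eq_square)
  then show ?thesis
    using variance_eq[OF integrable_bounded_rv[OF assms]] variance_positive[of \<phi>] by simp
qed

primrec trunc_mean_power :: "'q::finite offspring_laws \<Rightarrow> nat \<Rightarrow> nat \<Rightarrow> 'q \<times> 'q \<Rightarrow> 'q \<times> 'q \<Rightarrow> real" where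
  "trunc_mean_power P N 0 a b = (if a = b then 1 else 0)"
| "trunc_mean_power P N (Suc r) a b = (\<Sum>c\<in>UNIV. trunc_mean P N a c * trunc_mean_power P N r c b)"

lemma trunc_mean_power_nonneg: "0 \<le> trunc_mean_power P N r a b"
  by (induction r arbitrary: a) (auto intro!: sum_nonneg mult_nonneg_nonneg trunc_mean_nonneg)

text \<open>
  Flow to the root from the vertices of type \<open>a\<close> on level \<open>d\<close>, each of which contributes the strength
  \<open>\<theta>\<close> of its own subtree. The energy is the one that the flow dissipates if it meets the resistance
  \<open>r / t ^ i\<close> at each vertex on level \<open>i < d\<close>, plus \<open>e / t ^ d\<close> for each of these subtrees.
\<close>

primrec flow :: "nat \<Rightarrow> 'q::finite \<times> 'q \<Rightarrow> ('q offspring \<Rightarrow> real) \<Rightarrow> nat \<Rightarrow> 'q \<times> 'q \<Rightarrow> 'q offspring \<Rightarrow> real" where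
  "flow N a \<theta> 0 = (\<lambda>b K. if b = a then \<theta> K else 0)"
| "flow N a \<theta> (Suc d) = (\<lambda>b. child_sum N (\<lambda>j. flow N a \<theta> d (j, fst b)))"

primrec flow_energy ::
    "real \<Rightarrow> real \<Rightarrow> nat \<Rightarrow> 'q::finite \<times> 'q \<Rightarrow> ('q offspring \<Rightarrow> real) \<Rightarrow> ('q offspring \<Rightarrow> real) \<Rightarrow>
      nat \<Rightarrow> 'q \<times> 'q \<Rightarrow> 'q offspring \<Rightarrow> real" where
  "flow_energy t r N a \<theta> e 0 = (\<lambda>b K. if b = a then e K else 0)"
| "flow_energy t r N a \<theta> e (Suc d) = (\<lambda>b K.
     (1 / t) * child_sum N (\<lambda>j. flow_energy t r N a \<theta> e d (j, fst b)) K + r * (flow N a \<theta> (Suc d) b K * flow N a \<theta> (Suc d) b K))"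

lemma bounded_rv_flow: "bounded_rv \<theta> \<Longrightarrow> bounded_rv (flow N a \<theta> d b)"
proof (induction d arbitrary: b)
  case 0
  then show ?case by (cases "b = a") (auto intro: bounded_rv_const)
qed (auto intro: bounded_rv_child_sum)

lemma bounded_rv_flow_energy:
  assumes "bounded_rv \<theta>" "bounded_rv e" "0 < t" "0 < r"
  shows "bounded_rv (flow_energy t r N a \<theta> e d b)"
proof (induction d arbitrary: b)
  case 0
  then show ?case using assms by (cases "b = a") (auto intro: bounded_rv_const)
next
  case (Suc d)
  show ?case unfolding flow_energy.simps using assms Suc
    by (intro bounded_rv_add bounded_rv_mult bounded_rv_const bounded_rv_child_sum bounded_rv_flow) auto
qed

lemma sum_sq_le:
  fixes x u e :: "'i \<Rightarrow> real"
  assumes "\<And>i. i \<in> I \<Longrightarrow> (x i)\<^sup>2 \<le> u i * e i" "\<And>i. i \<in> I \<Longrightarrow> 0 \<le> u i" "\<And>i. i \<in> I \<Longrightarrow> 0 \<le> e i"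
  shows "(\<Sum>i\<in>I. x i)\<^sup>2 \<le> (\<Sum>i\<in>I. u i) * (\<Sum>i\<in>I. e i)"
proof -
  have "\<bar>\<Sum>i\<in>I. x i\<bar> \<le> (\<Sum>i\<in>I. \<bar>x i\<bar>)" by (rule sum_abs)
  also have "\<dots> \<le> (\<Sum>i\<in>I. sqrt (u i) * sqrt (e i))"
    using assms(1) by (intro sum_mono) (metis real_sqrt_abs real_sqrt_le_mono real_sqrt_mult)
  finally have "(\<Sum>i\<in>I. x i)\<^sup>2 \<le> (\<Sum>i\<in>I. sqrt (u i) * sqrt (e i))\<^sup>2"
    by (metis abs_ge_zero power2_abs power_mono)
  also have "\<dots> \<le> (\<Sum>i\<in>I. (sqrt (u i))\<^sup>2) * (\<Sum>i\<in>I. (sqrt (e i))\<^sup>2)" by (rule Cauchy_Schwarz_ineq_sum)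
  also have "\<dots> = (\<Sum>i\<in>I. u i) * (\<Sum>i\<in>I. e i)" using assms(2,3) by simp
  finally show ?thesis .
qed

lemma series_step:
  assumes \<beta>: "0 < \<beta>" and r: "\<And>x. 0 < x \<Longrightarrow> 1 / cavity \<beta> x \<le> 1 / (tanh \<beta> * x) + r"
    and h: "0 \<le> h" "\<theta>\<^sup>2 \<le> h * E"
  shows "\<theta>\<^sup>2 \<le> cavity \<beta> h * (1 / tanh \<beta> * E + r * (\<theta> * \<theta>))"
proof (cases "h = 0")
  case False
  then have h0: "0 < h" using h by simp
  have g: "0 < cavity \<beta> h" using cavity_pos[OF \<beta> h0] .
  have t: "0 < tanh \<beta>" using \<beta> by simp
  have "1 \<le> cavity \<beta> h * (1 / (tanh \<beta> * h) + r)"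
    using r[OF h0] g by (simp add: field_simps)
  then have "\<theta>\<^sup>2 * 1 \<le> \<theta>\<^sup>2 * (cavity \<beta> h * (1 / (tanh \<beta> * h) + r))" by (intro mult_left_mono) auto
  also have "\<dots> = cavity \<beta> h * (\<theta>\<^sup>2 / h / tanh \<beta> + r * (\<theta> * \<theta>))"
    by (simp add: algebra_simps power2_eq_square)
  also have "\<dots> \<le> cavity \<beta> h * (1 / tanh \<beta> * E + r * (\<theta> * \<theta>))"
  proof -
    have "\<theta>\<^sup>2 / h \<le> E" using h h0 by (simp add: divide_le_eq mult.commute)
    then have "\<theta>\<^sup>2 / h / tanh \<beta> \<le> E / tanh \<beta>" using t by (intro divide_right_mono) auto
    then have "\<theta>\<^sup>2 / h / tanh \<beta> \<le> 1 / tanh \<beta> * E" by simp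
    then show ?thesis using g by (intro mult_left_mono add_right_mono) auto
  qed
  finally show ?thesis by simp
qed (use h in simp)

text \<open>
  Thomson's principle: the field at the root is at least the squared strength of any flow divided
  by its energy.
\<close>

lemma flow_sq_le_message_mult_energy:
  assumes \<beta>: "0 < \<beta>" and r: "0 < r" "\<And>x. 0 < x \<Longrightarrow> 1 / cavity \<beta> x \<le> 1 / (tanh \<beta> * x) + r"
    and \<theta>: "bounded_rv \<theta>" "bounded_rv e" "\<And>K. (\<theta> K)\<^sup>2 \<le> trunc_message N \<beta> k K * e K"
  shows "(flow N a \<theta> d b K)\<^sup>2 \<le> trunc_message N \<beta> (k + d) K * flow_energy (tanh \<beta>) r N a \<theta> e d b K"
proof (induction d arbitrary: b K)
  case 0
  show ?case using \<theta>(3) by simp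
next
  case (Suc d)
  have \<beta>0: "0 \<le> \<beta>" and t: "0 < tanh \<beta>" using \<beta> by simp_all
  have nn: "0 \<le> trunc_message N \<beta> n K" for n K using \<beta>0 by (rule trunc_message_bounds)
  have en: "0 \<le> flow_energy (tanh \<beta>) r N a \<theta> e d b K" for b K
    using bounded_rv_flow_energy[OF \<theta>(1,2) t r(1)] by (simp add: bounded_rv_def)
  have h: "0 \<le> child_sum N (\<lambda>_. trunc_message N \<beta> (k + d)) K" by (rule child_sum_nonneg) (rule nn)
  have "(flow N a \<theta> (Suc d) b K)\<^sup>2 \<le> child_sum N (\<lambda>_. trunc_message N \<beta> (k + d)) K *
      child_sum N (\<lambda>j. flow_energy (tanh \<beta>) r N a \<theta> e d (j, fst b)) K"
    unfolding flow.simps child_sum_def using Suc nn en by (intro sum_sq_le) auto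
  from series_step[OF \<beta> r(2) h this] show ?case by (simp add: trunc_message_Suc)
qed

lemma expectation_flow:
  assumes "bounded_rv \<theta>"
  shows "(\<integral>K. flow N a \<theta> d b K \<partial>subtree_measure P b) = trunc_mean_power P N d b a * (\<integral>K. \<theta> K \<partial>subtree_measure P a)"
proof (induction d arbitrary: b)
  case (Suc d)
  show ?case
    unfolding flow.simps expectation_child_sum[where \<phi> = "flow N a \<theta> d", OF bounded_rv_flow[OF assms]] Suc
    by (simp add: sum_distrib_right mult.assoc)
qed simp

text \<open>
  The point is that \<open>L\<close> does not depend on \<open>\<theta>\<close>. When the flow is divided by its mean growth
  \<open>m = trunc_mean_power P N d a a\<close>, the first term gets the factor \<open>1 / m\<close>, and the second one stays
  bounded.
\<close>

lemma second_moment_flow: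
  fixes P :: "'q::finite offspring_laws"
  shows "\<exists>L\<ge>0. \<forall>\<theta> b. bounded_rv \<theta> \<longrightarrow> (\<integral>K. (flow N a \<theta> d b K)\<^sup>2 \<partial>subtree_measure P b) \<le>
    trunc_mean_power P N d b a * (\<integral>K. (\<theta> K)\<^sup>2 \<partial>subtree_measure P a) + L * (\<integral>K. \<theta> K \<partial>subtree_measure P a)\<^sup>2"
proof (induction d)
  case 0
  show ?case by (intro exI[of _ 0]) auto
next
  case (Suc d)
  then obtain L where L: "0 \<le> L" "\<And>\<theta> b. bounded_rv \<theta> \<Longrightarrow> (\<integral>K. (flow N a \<theta> d b K)\<^sup>2 \<partial>subtree_measure P b) \<le>
    trunc_mean_power P N d b a * (\<integral>K. (\<theta> K)\<^sup>2 \<partial>subtree_measure P a) + L * (\<integral>K. \<theta> K \<partial>subtree_measure P a)\<^sup>2" by blast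
  define S where "S b = (\<Sum>c\<in>UNIV. trunc_mean P N b c)" for b
  define L' where "L' = (\<Sum>b\<in>UNIV. S b) * L + (real N * (\<Sum>c\<in>UNIV. trunc_mean_power P N d c a))\<^sup>2"
  have S: "0 \<le> S b" for b unfolding S_def by (intro sum_nonneg trunc_mean_nonneg)
  have "(\<integral>K. (flow N a \<theta> (Suc d) b K)\<^sup>2 \<partial>subtree_measure P b) \<le>
    trunc_mean_power P N (Suc d) b a * (\<integral>K. (\<theta> K)\<^sup>2 \<partial>subtree_measure P a) + L' * (\<integral>K. \<theta> K \<partial>subtree_measure P a)\<^sup>2"
    if \<theta>: "bounded_rv \<theta>" for \<theta> b
  proof -
    let ?V = "\<integral>K. (\<theta> K)\<^sup>2 \<partial>subtree_measure P a" and ?M = "\<integral>K. \<theta> K \<partial>subtree_measure P a"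
    have "(\<integral>K. (flow N a \<theta> (Suc d) b K)\<^sup>2 \<partial>subtree_measure P b) \<le>
        (\<Sum>c\<in>UNIV. trunc_mean P N b c * (\<integral>K. (flow N a \<theta> d c K)\<^sup>2 \<partial>subtree_measure P c)) +
        (real N * (\<Sum>c\<in>UNIV. \<integral>K. flow N a \<theta> d c K \<partial>subtree_measure P c))\<^sup>2"
      unfolding flow.simps by (rule second_moment_child_sum[where \<phi> = "flow N a \<theta> d"]) (rule bounded_rv_flow[OF \<theta>])
    also have "\<dots> \<le> (\<Sum>c\<in>UNIV. trunc_mean P N b c * (trunc_mean_power P N d c a * ?V + L * ?M\<^sup>2)) +
        (real N * (\<Sum>c\<in>UNIV. trunc_mean_power P N d c a * ?M))\<^sup>2"
      unfolding expectation_flow[OF \<theta>]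
      by (intro add_right_mono sum_mono mult_left_mono L(2)[OF \<theta>] trunc_mean_nonneg)
    also have "\<dots> = trunc_mean_power P N (Suc d) b a * ?V +
        (S b * L + (real N * (\<Sum>c\<in>UNIV. trunc_mean_power P N d c a))\<^sup>2) * ?M\<^sup>2"
    proof -
      have "(\<Sum>c\<in>UNIV. trunc_mean P N b c * (trunc_mean_power P N d c a * ?V + L * ?M\<^sup>2)) =
          trunc_mean_power P N (Suc d) b a * ?V + S b * L * ?M\<^sup>2"
        unfolding S_def by (simp add: distrib_left sum.distrib sum_distrib_right mult.assoc)
      moreover have "(real N * (\<Sum>c\<in>UNIV. trunc_mean_power P N d c a * ?M))\<^sup>2 =
          (real N * (\<Sum>c\<in>UNIV. trunc_mean_power P N d c a))\<^sup>2 * ?M\<^sup>2"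
        by (simp only: sum_distrib_right[symmetric] power_mult_distrib mult.assoc)
      ultimately show ?thesis by (simp only: distrib_right add.assoc)
    qed
    also have "\<dots> \<le> trunc_mean_power P N (Suc d) b a * ?V + L' * ?M\<^sup>2"
      unfolding L'_def using S L(1) by (intro add_left_mono mult_right_mono add_right_mono member_le_sum) auto
    finally show ?thesis .
  qed
  moreover have "0 \<le> L'" unfolding L'_def using S L(1) by (intro add_nonneg_nonneg mult_nonneg_nonneg sum_nonneg) auto
  ultimately show ?case by blast
qed

text \<open>
  Again \<open>L\<close> depends on neither \<open>\<theta>\<close> nor \<open>e\<close>. After normalization of the flow, the energy below level
  \<open>d\<close> gets the factor \<open>1 / (t ^ d * m)\<close>.
\<close>

lemma expectation_flow_energy:
  fixes P :: "'q::finite offspring_laws"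
  assumes t: "0 < t" and r: "0 < r"
  shows "\<exists>L\<ge>0. \<forall>\<theta> e b. bounded_rv \<theta> \<longrightarrow> bounded_rv e \<longrightarrow>
    (\<integral>K. flow_energy t r N a \<theta> e d b K \<partial>subtree_measure P b) \<le>
    trunc_mean_power P N d b a / t ^ d * (\<integral>K. e K \<partial>subtree_measure P a) + L * (\<integral>K. (\<theta> K)\<^sup>2 \<partial>subtree_measure P a)"
proof (induction d)
  case 0
  show ?case by (intro exI[of _ 0]) auto
next
  case (Suc d)
  then obtain L where L: "0 \<le> L" "\<And>\<theta> e b. bounded_rv \<theta> \<Longrightarrow> bounded_rv e \<Longrightarrow>
    (\<integral>K. flow_energy t r N a \<theta> e d b K \<partial>subtree_measure P b) \<le>
    trunc_mean_power P N d b a / t ^ d * (\<integral>K. e K \<partial>subtree_measure P a) + L * (\<integral>K. (\<theta> K)\<^sup>2 \<partial>subtree_measure P a)" by blast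
  obtain L2 where L2: "0 \<le> L2" "\<And>\<theta> b. bounded_rv \<theta> \<Longrightarrow> (\<integral>K. (flow N a \<theta> (Suc d) b K)\<^sup>2 \<partial>subtree_measure P b) \<le>
    trunc_mean_power P N (Suc d) b a * (\<integral>K. (\<theta> K)\<^sup>2 \<partial>subtree_measure P a) + L2 * (\<integral>K. \<theta> K \<partial>subtree_measure P a)\<^sup>2"
    using second_moment_flow[where N = N and a = a and d = "Suc d" and P = P] by blast
  define S where "S b = (\<Sum>c\<in>UNIV. trunc_mean P N b c)" for b
  define A where "A b = S b * L / t + r * (trunc_mean_power P N (Suc d) b a + L2)" for b
  have S: "0 \<le> S b" for b unfolding S_def by (intro sum_nonneg trunc_mean_nonneg)
  have A: "0 \<le> A b" for b unfolding A_def using S L(1) L2(1) t r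
    by (intro add_nonneg_nonneg mult_nonneg_nonneg divide_nonneg_nonneg trunc_mean_power_nonneg) auto
  have "(\<integral>K. flow_energy t r N a \<theta> e (Suc d) b K \<partial>subtree_measure P b) \<le>
    trunc_mean_power P N (Suc d) b a / t ^ Suc d * (\<integral>K. e K \<partial>subtree_measure P a) + (\<Sum>b\<in>UNIV. A b) * (\<integral>K. (\<theta> K)\<^sup>2 \<partial>subtree_measure P a)"
    if \<theta>: "bounded_rv \<theta>" and e: "bounded_rv e" for \<theta> e b
  proof -
    let ?V = "\<integral>K. (\<theta> K)\<^sup>2 \<partial>subtree_measure P a" and ?M = "\<integral>K. \<theta> K \<partial>subtree_measure P a"
      and ?E = "\<integral>K. e K \<partial>subtree_measure P a"
    have V: "0 \<le> ?V" by (intro Bochner_Integration.integral_nonneg) simp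
    have MV: "?M\<^sup>2 \<le> ?V" by (rule expectation_sq_le[OF \<theta>])
    have b1: "bounded_rv (child_sum N (\<lambda>j. flow_energy t r N a \<theta> e d (j, fst b)))"
      by (intro bounded_rv_child_sum bounded_rv_flow_energy \<theta> e t r)
    have b2: "bounded_rv (\<lambda>K. flow N a \<theta> (Suc d) b K * flow N a \<theta> (Suc d) b K)"
      by (intro bounded_rv_mult bounded_rv_flow \<theta>)
    have "(\<integral>K. flow_energy t r N a \<theta> e (Suc d) b K \<partial>subtree_measure P b) =
        (1 / t) * (\<integral>K. child_sum N (\<lambda>j. flow_energy t r N a \<theta> e d (j, fst b)) K \<partial>subtree_measure P b) +
        r * (\<integral>K. (flow N a \<theta> (Suc d) b K)\<^sup>2 \<partial>subtree_measure P b)"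
      using integrable_bounded_rv[OF b1] integrable_bounded_rv[OF b2]
      unfolding flow_energy.simps power2_eq_square
      by (subst Bochner_Integration.integral_add) simp_all
    also have "(\<integral>K. child_sum N (\<lambda>j. flow_energy t r N a \<theta> e d (j, fst b)) K \<partial>subtree_measure P b) =
        (\<Sum>c\<in>UNIV. trunc_mean P N b c * (\<integral>K. flow_energy t r N a \<theta> e d c K \<partial>subtree_measure P c))"
      by (rule expectation_child_sum[where \<phi> = "flow_energy t r N a \<theta> e d"]) (intro bounded_rv_flow_energy \<theta> e t r)
    also have "(1 / t) * (\<Sum>c\<in>UNIV. trunc_mean P N b c * (\<integral>K. flow_energy t r N a \<theta> e d c K \<partial>subtree_measure P c)) +
        r * (\<integral>K. (flow N a \<theta> (Suc d) b K)\<^sup>2 \<partial>subtree_measure P b) \<le>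
        (1 / t) * (\<Sum>c\<in>UNIV. trunc_mean P N b c * (trunc_mean_power P N d c a / t ^ d * ?E + L * ?V)) +
        r * (trunc_mean_power P N (Suc d) b a * ?V + L2 * ?V)"
    proof (intro add_mono mult_left_mono sum_mono L(2)[OF \<theta> e] trunc_mean_nonneg)
      have "L2 * ?M\<^sup>2 \<le> L2 * ?V" using MV L2(1) by (rule mult_left_mono)
      then show "(\<integral>K. (flow N a \<theta> (Suc d) b K)\<^sup>2 \<partial>subtree_measure P b) \<le> trunc_mean_power P N (Suc d) b a * ?V + L2 * ?V"
        using L2(2)[OF \<theta>, of b] by linarith
    qed (use t r in auto)
    also have "(\<Sum>c\<in>UNIV. trunc_mean P N b c * (trunc_mean_power P N d c a / t ^ d * ?E + L * ?V)) =
        trunc_mean_power P N (Suc d) b a / t ^ d * ?E + S b * L * ?V"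
      unfolding S_def by (simp add: distrib_left sum.distrib sum_distrib_right sum_divide_distrib mult.assoc)
    also have "(1 / t) * (trunc_mean_power P N (Suc d) b a / t ^ d * ?E + S b * L * ?V) +
        r * (trunc_mean_power P N (Suc d) b a * ?V + L2 * ?V) =
        trunc_mean_power P N (Suc d) b a / t ^ Suc d * ?E + A b * ?V"
      unfolding A_def power_Suc by (simp add: distrib_left distrib_right add_divide_distrib mult.assoc del: trunc_mean_power.simps)
    also have "\<dots> \<le> trunc_mean_power P N (Suc d) b a / t ^ Suc d * ?E + (\<Sum>b\<in>UNIV. A b) * ?V"
      using A V by (intro add_left_mono mult_right_mono member_le_sum) auto
    finally show ?thesis .
  qed
  moreover have "0 \<le> (\<Sum>b\<in>UNIV. A b)" using A by (intro sum_nonneg)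
  ultimately show ?case by blast
qed

lemma contraction_bound:
  fixes q :: real
  assumes "0 \<le> q" "q < 1"
  obtains V where "V\<^sub>0 \<le> V" "q * V + C \<le> V"
proof -
  define V where "V = max V\<^sub>0 (C / (1 - q))"
  have "C / (1 - q) * (1 - q) \<le> V * (1 - q)" using assms unfolding V_def by (intro mult_right_mono) auto
  moreover have "C / (1 - q) * (1 - q) = C" using assms by simp
  ultimately have "q * V + C \<le> V" by (simp add: algebra_simps)
  then show ?thesis using that[of V] by (simp add: V_def)
qed

text \<open>
  Flows are built in blocks of \<open>n\<close> levels between vertices of type \<open>a\<close>, normalized to expected strength
  1. Since \<open>m > 1\<close> and \<open>t ^ n * m > 1\<close>, the bounds \<open>V\<close> on the second moment and \<open>W\<close> on the expected
  energy survive each further block. By Thomson's principle and the Cauchy-Schwarz inequality, the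
  expected field is then at least \<open>1 / W\<close>.
\<close>

lemma trunc_message_bounded_below:
  fixes P :: "'q::finite offspring_laws"
  assumes \<beta>: "0 < \<beta>" and m: "1 < tanh \<beta> ^ n * trunc_mean_power P N n a a"
  obtains W where "0 < W" "\<And>k. 1 / W \<le> (\<integral>K. trunc_message N \<beta> (k * n) K \<partial>subtree_measure P a)"
proof -
  let ?E = "\<lambda>\<phi>. \<integral>K. \<phi> K \<partial>subtree_measure P a"
  define t where "t = tanh \<beta>"
  define m where "m = trunc_mean_power P N n a a"
  have t: "0 < t" "t < 1" using \<beta> tanh_real_lt_1 by (simp_all add: t_def)
  have tm: "1 < t ^ n * m" using assms by (simp add: t_def m_def)
  have "t ^ n \<le> 1" using t by (intro power_le_one) auto
  then have m1: "1 < m" using tm trunc_mean_power_nonneg[of P N n a a]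
    by (smt (verit) m_def mult_left_le_one_le zero_le_power t(1))
  obtain r where r: "0 < r" "\<And>x. 0 < x \<Longrightarrow> 1 / cavity \<beta> x \<le> 1 / (tanh \<beta> * x) + r"
    using cavity_series_law[OF \<beta>] by blast
  obtain L where L: "0 \<le> L" "\<And>\<theta>. bounded_rv \<theta> \<Longrightarrow> ?E (\<lambda>K. (flow N a \<theta> n a K)\<^sup>2) \<le>
      m * ?E (\<lambda>K. (\<theta> K)\<^sup>2) + L * (?E \<theta>)\<^sup>2"
    using second_moment_flow[where N = N and a = a and d = n and P = P] unfolding m_def by blast
  obtain L' where L': "0 \<le> L'" "\<And>\<theta> e. bounded_rv \<theta> \<Longrightarrow> bounded_rv e \<Longrightarrow>
      ?E (flow_energy t r N a \<theta> e n a) \<le> m / t ^ n * ?E e + L' * ?E (\<lambda>K. (\<theta> K)\<^sup>2)"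
    using expectation_flow_energy[OF t(1) r(1), where N = N and a = a and d = n and P = P] unfolding m_def by blast
  obtain V where V: "1 \<le> V" "1 / m * V + L / m\<^sup>2 \<le> V"
    using contraction_bound[of "1 / m" 1 "L / m\<^sup>2"] m1 by auto
  obtain W where W: "1 / \<beta> \<le> W" "1 / (t ^ n * m) * W + L' * V / m\<^sup>2 \<le> W"
    using contraction_bound[of "1 / (t ^ n * m)" "1 / \<beta>" "L' * V / m\<^sup>2"] tm by auto
  have W0: "0 < W" using W(1) \<beta> by (smt (verit) zero_less_divide_1_iff)
  have ex: "\<exists>\<theta> e. bounded_rv \<theta> \<and> bounded_rv e \<and> ?E \<theta> = 1 \<and> ?E (\<lambda>K. (\<theta> K)\<^sup>2) \<le> V \<and> ?E e \<le> W \<and>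
      (\<forall>K. (\<theta> K)\<^sup>2 \<le> trunc_message N \<beta> (k * n) K * e K)" for k
  proof (induction k)
    case 0
    interpret prob_space "subtree_measure P a" by (rule prob_space_tree_law)
    show ?case
      using V(1) W(1) \<beta> prob_space
      by (intro exI[of _ "\<lambda>_. 1"] exI[of _ "\<lambda>_. 1 / \<beta>"]) (auto simp: trunc_message_def bounded_rv_const)
  next
    case (Suc k)
    then obtain \<theta> e where \<theta>: "bounded_rv \<theta>" "bounded_rv e" "?E \<theta> = 1" "?E (\<lambda>K. (\<theta> K)\<^sup>2) \<le> V" "?E e \<le> W"
      "\<And>K. (\<theta> K)\<^sup>2 \<le> trunc_message N \<beta> (k * n) K * e K" by blast
    define \<theta>' where "\<theta>' K = 1 / m * flow N a \<theta> n a K" for K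
    define e' where "e' K = 1 / m\<^sup>2 * flow_energy t r N a \<theta> e n a K" for K
    have "bounded_rv \<theta>'" unfolding \<theta>'_def[abs_def]
      using m1 by (intro bounded_rv_mult bounded_rv_const bounded_rv_flow \<theta>) simp
    moreover have "bounded_rv e'" unfolding e'_def[abs_def]
      by (intro bounded_rv_mult bounded_rv_const bounded_rv_flow_energy \<theta> t r) simp
    moreover have "?E \<theta>' = 1" using expectation_flow[OF \<theta>(1), where N = N and a = a and d = n and b = a and P = P] \<theta>(3) m1
      by (simp add: \<theta>'_def m_def)
    moreover have "?E (\<lambda>K. (\<theta>' K)\<^sup>2) \<le> V"
    proof -
      have "?E (\<lambda>K. (\<theta>' K)\<^sup>2) = 1 / m\<^sup>2 * ?E (\<lambda>K. (flow N a \<theta> n a K)\<^sup>2)"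
        by (simp add: \<theta>'_def power_divide)
      also have "\<dots> \<le> 1 / m\<^sup>2 * (m * V + L)"
      proof -
        have "m * ?E (\<lambda>K. (\<theta> K)\<^sup>2) \<le> m * V" using \<theta>(4) m1 by (intro mult_left_mono) auto
        then have "?E (\<lambda>K. (flow N a \<theta> n a K)\<^sup>2) \<le> m * V + L" using L(2)[OF \<theta>(1)] \<theta>(3) by simp
        then show ?thesis by (intro mult_left_mono) auto
      qed
      also have "\<dots> = 1 / m * V + L / m\<^sup>2" using m1 by (simp add: field_simps power2_eq_square)
      finally show ?thesis using V(2) by simp
    qed
    moreover have "?E e' \<le> W"
    proof -
      have "?E e' = 1 / m\<^sup>2 * ?E (flow_energy t r N a \<theta> e n a)" by (simp add: e'_def)
      also have "\<dots> \<le> 1 / m\<^sup>2 * (m / t ^ n * W + L' * V)"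
      proof -
        have "m / t ^ n * ?E e \<le> m / t ^ n * W" "L' * ?E (\<lambda>K. (\<theta> K)\<^sup>2) \<le> L' * V"
          by (rule mult_left_mono[OF \<theta>(5)], use m1 t in simp) (rule mult_left_mono[OF \<theta>(4) L'(1)])
        then have "?E (flow_energy t r N a \<theta> e n a) \<le> m / t ^ n * W + L' * V"
          using L'(2)[OF \<theta>(1,2)] by linarith
        then show ?thesis by (intro mult_left_mono) auto
      qed
      also have "\<dots> = 1 / (t ^ n * m) * W + L' * V / m\<^sup>2" using m1 t by (simp add: field_simps power2_eq_square)
      finally show ?thesis using W(2) by simp
    qed
    moreover have "(\<theta>' K)\<^sup>2 \<le> trunc_message N \<beta> (Suc k * n) K * e' K" for K
    proof -
      have "(flow N a \<theta> n a K)\<^sup>2 \<le> trunc_message N \<beta> (k * n + n) K * flow_energy t r N a \<theta> e n a K"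
        unfolding t_def by (rule flow_sq_le_message_mult_energy[OF \<beta> r \<theta>(1,2,6)])
      then have "1 / m\<^sup>2 * (flow N a \<theta> n a K)\<^sup>2 \<le> 1 / m\<^sup>2 * (trunc_message N \<beta> (k * n + n) K * flow_energy t r N a \<theta> e n a K)"
        by (intro mult_left_mono) auto
      then show ?thesis by (simp add: \<theta>'_def e'_def power_divide add.commute)
    qed
    ultimately show ?case by blast
  qed
  show ?thesis
  proof (rule that[OF W0])
    fix k
    obtain \<theta> e where \<theta>: "bounded_rv \<theta>" "bounded_rv e" "?E \<theta> = 1" "?E e \<le> W"
      "\<And>K. (\<theta> K)\<^sup>2 \<le> trunc_message N \<beta> (k * n) K * e K" using ex[of k] by blast
    let ?U = "trunc_message N \<beta> (k * n) :: 'q offspring \<Rightarrow> real"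
    have U: "bounded_rv ?U" unfolding bounded_rv_def using trunc_message_bounds[of \<beta>] \<beta>
      by (auto intro!: exI[of _ \<beta>])
    \<comment> \<open>the arithmetic mean dominates the geometric mean, and \<open>(\<theta> K)\<^sup>2 \<le> ?U K * e K\<close>\<close>
    have "2 * \<theta> K \<le> W * ?U K + 1 / W * e K" for K
    proof (rule power2_le_imp_le)
      have u: "0 \<le> ?U K" "0 \<le> e K" using U \<theta>(2) by (auto simp: bounded_rv_def)
      then show "0 \<le> W * ?U K + 1 / W * e K" using W0 by simp
      have "(W * ?U K + 1 / W * e K)\<^sup>2 - 4 * (?U K * e K) = (W * ?U K - 1 / W * e K)\<^sup>2"
        using W0 by (simp add: power2_eq_square field_simps)
      then have "4 * (?U K * e K) \<le> (W * ?U K + 1 / W * e K)\<^sup>2"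
        by (metis diff_ge_0_iff_ge zero_le_power2)
      then show "(2 * \<theta> K)\<^sup>2 \<le> (W * ?U K + 1 / W * e K)\<^sup>2" using \<theta>(5)[of K] by (simp add: power_mult_distrib)
    qed
    then have "?E (\<lambda>K. 2 * \<theta> K) \<le> ?E (\<lambda>K. W * ?U K + 1 / W * e K)"
      by (intro integral_mono Bochner_Integration.integrable_add integrable_mult_right
          integrable_bounded_rv[OF U] integrable_bounded_rv[OF \<theta>(1)] integrable_bounded_rv[OF \<theta>(2)])
    also have "\<dots> = W * ?E ?U + 1 / W * ?E e"
      by (simp add: integrable_bounded_rv[OF U] integrable_bounded_rv[OF \<theta>(2)])
    also have "\<dots> \<le> W * ?E ?U + 1" using \<theta>(4) W0 by (simp add: divide_le_eq)
    finally have "1 \<le> W * ?E ?U" using \<theta>(3) by simp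
    then show "1 / W \<le> ?E ?U" using W0 by (simp add: divide_le_eq mult.commute)
  qed
qed

text \<open>
  The fields of the truncated tree are dominated by those of the whole tree, hence decrease to 0, and
  dominated convergence contradicts the lower bound on their expectations.
\<close>

theorem trunc_mean_power_le_of_root_message_0:
  fixes P :: "'q::finite offspring_laws"
  assumes \<beta>: "0 < \<beta>" and n: "0 < n" and z: "AE K in subtree_measure P a. root_message \<beta> K = 0"
  shows "tanh \<beta> ^ n * trunc_mean_power P N n a a \<le> 1"
proof (rule ccontr)
  interpret prob_space "subtree_measure P a" by (rule prob_space_tree_law)
  assume "\<not> ?thesis"
  then obtain W where W: "0 < W" "\<And>k. 1 / W \<le> (\<integral>K. trunc_message N \<beta> (k * n) K \<partial>subtree_measure P a)"
    using trunc_message_bounded_below[OF \<beta>, of n P N a] by auto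
  have "(\<lambda>k. \<integral>K. trunc_message N \<beta> (k * n) K \<partial>subtree_measure P a) \<longlonglongrightarrow> (\<integral>K. 0 \<partial>subtree_measure P a)"
  proof (rule integral_dominated_convergence[where w = "\<lambda>_. \<beta>"])
    show "AE K in subtree_measure P a. (\<lambda>k. trunc_message N \<beta> (k * n) K) \<longlonglongrightarrow> 0"
      using z
    proof eventually_elim
      case (elim K)
      have "strict_mono (\<lambda>k. k * n)" using n by (simp add: strict_mono_def)
      from LIMSEQ_subseq_LIMSEQ[OF trunc_message_tendsto_0[OF _ elim] this] \<beta> show ?case
        by (simp add: o_def)
    qed
    show "AE K in subtree_measure P a. norm (trunc_message N \<beta> (k * n) K) \<le> \<beta>" for k
      using \<beta> by (intro AE_I2) (simp add: abs_of_nonneg trunc_message_bounds)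
  qed (simp_all add: measurable_cong_sets[OF sets_tree_law refl])
  then have "(\<lambda>k. \<integral>K. trunc_message N \<beta> (k * n) K \<partial>subtree_measure P a) \<longlonglongrightarrow> 0" by simp
  then have "1 / W \<le> 0" by (rule LIMSEQ_le_const) (use W(2) in auto)
  then show False using W(1) by simp
qed

lemma incseq_trunc_mean: "incseq (\<lambda>N. trunc_mean P N a b)"
proof (rule incseq_SucI)
  fix N
  have "(\<integral>k. real (min (k (fst b)) N) \<partial>measure_pmf (biased_law P (fst a) (snd a)))
      \<le> (\<integral>k. real (min (k (fst b)) (Suc N)) \<partial>measure_pmf (biased_law P (fst a) (snd a)))"
    by (intro integral_mono measure_pmf.integrable_const_bound[where B = "real (Suc N)"]) auto
  then show "trunc_mean P N a b \<le> trunc_mean P (Suc N) a b" by (simp add: trunc_mean_def)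
qed

lemma incseq_trunc_mean_power: "incseq (\<lambda>N. trunc_mean_power P N n a b)"
proof (induction n arbitrary: a)
  case (Suc n)
  show ?case
    unfolding trunc_mean_power.simps
    by (intro incseq_SucI sum_mono mult_mono incseq_SucD[OF incseq_trunc_mean] incseq_SucD[OF Suc]
        trunc_mean_power_nonneg trunc_mean_nonneg)
qed (simp add: incseq_def)

lemma biased_mean_eq_SUP: "biased_mean P a b = (SUP N. ennreal (trunc_mean P N a b))"
proof (cases "snd b = fst a")
  case True
  let ?p = "biased_law P (fst a) (snd a)"
  have "(SUP N. ennreal (real (min n N))) = of_nat n" for n :: nat
  proof (rule antisym)
    show "(SUP N. ennreal (real (min n N))) \<le> of_nat n"
      by (intro SUP_least) (simp add: ennreal_of_nat_eq_real_of_nat)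
    show "of_nat n \<le> (SUP N. ennreal (real (min n N)))"
      by (rule SUP_upper2[of n]) (simp_all add: ennreal_of_nat_eq_real_of_nat)
  qed
  then have "biased_mean P a b = (\<integral>\<^sup>+k. (SUP N. ennreal (real (min (k (fst b)) N))) \<partial>measure_pmf ?p)"
    using True by (simp add: biased_mean_def case_prod_beta)
  also have "\<dots> = (SUP N. \<integral>\<^sup>+k. ennreal (real (min (k (fst b)) N)) \<partial>measure_pmf ?p)"
    by (rule nn_integral_monotone_convergence_SUP) (auto simp: incseq_def le_fun_def intro!: ennreal_leI)
  also have "\<dots> = (SUP N. ennreal (trunc_mean P N a b))"
  proof (rule SUP_cong)
    fix N :: nat
    have "integrable (measure_pmf ?p) (\<lambda>k. real (min (k (fst b)) N))"
      by (rule measure_pmf.integrable_const_bound[where B = "real N"]) auto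
    from nn_integral_eq_integral[OF this] show
      "(\<integral>\<^sup>+k. ennreal (real (min (k (fst b)) N)) \<partial>measure_pmf ?p) = ennreal (trunc_mean P N a b)"
      using True by (simp add: trunc_mean_def)
  qed simp
  finally show ?thesis .
qed (simp add: biased_mean_def case_prod_beta trunc_mean_def)

lemma SUP_mult_incseq_le:
  fixes f g :: "nat \<Rightarrow> ennreal"
  assumes "incseq f" "incseq g"
  shows "(SUP n. f n) * (SUP n. g n) \<le> (SUP n. f n * g n)"
proof -
  have "f i * g j \<le> (SUP n. f n * g n)" for i j
    using assms by (intro SUP_upper2[of "max i j"] mult_mono) (auto simp: incseq_def)
  then show ?thesis
    unfolding SUP_mult_left_ennreal SUP_mult_right_ennreal by (intro SUP_least)
qed

text \<open>
  Nothing is lost by the cutoff in the limit, even if entries of the mean matrix are infinite.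
\<close>

lemma biased_mean_power_le_SUP:
  fixes P :: "'q::finite offspring_laws"
  shows "biased_mean_power P n a b \<le> (SUP N. ennreal (trunc_mean_power P N n a b))"
proof (induction n arbitrary: a)
  case 0
  show ?case by (rule SUP_upper2[of 0]) auto
next
  case (Suc n)
  let ?m = "\<lambda>c N. ennreal (trunc_mean P N a c)" and ?M = "\<lambda>c N. ennreal (trunc_mean_power P N n c b)"
  have inc: "incseq (?m c)" "incseq (?M c)" for c
    by (intro incseq_SucI ennreal_leI incseq_SucD[OF incseq_trunc_mean] incseq_SucD[OF incseq_trunc_mean_power])+
  have inc2: "incseq (\<lambda>N. ?m c N * ?M c N)" for c
    by (intro incseq_SucI mult_mono incseq_SucD[OF inc(1)] incseq_SucD[OF inc(2)]) auto
  have "biased_mean_power P (Suc n) a b \<le> (\<Sum>c\<in>pos_pairs P. (SUP N. ?m c N) * (SUP N. ?M c N))"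
    unfolding biased_mean_power.simps biased_mean_eq_SUP by (intro sum_mono mult_left_mono Suc) simp
  also have "\<dots> \<le> (\<Sum>c\<in>UNIV. (SUP N. ?m c N) * (SUP N. ?M c N))" by (intro sum_mono2) auto
  also have "\<dots> \<le> (\<Sum>c\<in>UNIV. SUP N. ?m c N * ?M c N)" by (intro sum_mono SUP_mult_incseq_le inc)
  also have "\<dots> = (SUP N. \<Sum>c\<in>UNIV. ?m c N * ?M c N)"
    using inc2 by (intro ennreal_SUP_sum[symmetric])
  also have "\<dots> = (SUP N. ennreal (trunc_mean_power P N (Suc n) a b))"
    by (simp add: ennreal_mult[symmetric] trunc_mean_nonneg trunc_mean_power_nonneg sum_ennreal)
  finally show ?case .
qed

lemma biased_mean_power_le_of_root_message_0:
  fixes P :: "'q::finite offspring_laws"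
  assumes "0 < \<beta>" "0 < n" "AE K in subtree_measure P a. root_message \<beta> K = 0"
  shows "ennreal (tanh \<beta> ^ n) * biased_mean_power P n a a \<le> 1"
proof -
  have "ennreal (tanh \<beta> ^ n) * biased_mean_power P n a a \<le> ennreal (tanh \<beta> ^ n) * (SUP N. ennreal (trunc_mean_power P N n a a))"
    by (intro mult_left_mono biased_mean_power_le_SUP) simp
  also have "\<dots> = (SUP N. ennreal (tanh \<beta> ^ n * trunc_mean_power P N n a a))"
    using assms(1) by (simp add: SUP_mult_left_ennreal ennreal_mult trunc_mean_power_nonneg)
  also have "\<dots> \<le> 1"
    using trunc_mean_power_le_of_root_message_0[OF assms] by (intro SUP_least) (simp add: ennreal_le_1)
  finally show ?thesis .
qed


section \<open>No magnetization at subcritical growth\<close>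

lemma biased_mean_power_add:
  fixes P :: "'q::finite offspring_laws"
  assumes "a \<in> pos_pairs P"
  shows "biased_mean_power P (n + r) a c = (\<Sum>b\<in>pos_pairs P. biased_mean_power P n a b * biased_mean_power P r b c)"
  using assms
proof (induction n arbitrary: a)
  case 0
  have "(\<Sum>b\<in>pos_pairs P. biased_mean_power P 0 a b * biased_mean_power P r b c) =
      (\<Sum>b\<in>pos_pairs P. if a = b then biased_mean_power P r b c else 0)"
    by (intro sum.cong) auto
  then show ?case using 0 by (simp add: sum.delta)
next
  case (Suc n)
  have "biased_mean_power P (Suc n + r) a c = (\<Sum>d\<in>pos_pairs P. biased_mean P a d *
      (\<Sum>b\<in>pos_pairs P. biased_mean_power P n d b * biased_mean_power P r b c))"
    using Suc.IH by simp
  also have "\<dots> = (\<Sum>b\<in>pos_pairs P. \<Sum>d\<in>pos_pairs P. biased_mean P a d * (biased_mean_power P n d b * biased_mean_power P r b c))"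
    unfolding sum_distrib_left by (rule sum.swap)
  also have "\<dots> = (\<Sum>b\<in>pos_pairs P. biased_mean_power P (Suc n) a b * biased_mean_power P r b c)"
    by (simp add: sum_distrib_right mult.assoc)
  finally show ?case .
qed

lemma ennreal_le_inverse:
  fixes x y :: ennreal
  assumes "x * y \<le> 1" "0 < y"
  shows "x \<le> 1 / y"
proof (cases "y = \<infinity>")
  case True
  then have "x = 0" using assms by (auto simp: ennreal_mult_top top_unique split: if_splits)
  then show ?thesis by simp
next
  case False
  have "x = x * y / y" using assms False by (simp add: ennreal_mult_divide_eq)
  also have "\<dots> \<le> 1 / y" using assms by (intro divide_right_mono_ennreal)
  finally show ?thesis .
qed

text \<open>
  By positive regularity, a path from \<open>a\<close> to \<open>b\<close> can be closed up to a path from \<open>a\<close> to \<open>a\<close> at the cost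
  of \<open>r\<close> further steps and a positive factor.
\<close>

lemma biased_mean_power_bounded:
  fixes P :: "'q::finite offspring_laws"
  assumes t: "0 < t" and r: "\<And>a b. a \<in> pos_pairs P \<Longrightarrow> b \<in> pos_pairs P \<Longrightarrow> 0 < biased_mean_power P r a b" "0 < r"
    and sub: "\<And>a n. a \<in> pos_pairs P \<Longrightarrow> 0 < n \<Longrightarrow> ennreal (t ^ n) * biased_mean_power P n a a \<le> 1"
  obtains C where "C < \<infinity>" "\<And>a b n. a \<in> pos_pairs P \<Longrightarrow> b \<in> pos_pairs P \<Longrightarrow> ennreal (t ^ n) * biased_mean_power P n a b \<le> C"
proof
  let ?X = "pos_pairs P"
  let ?C = "\<Sum>a\<in>?X. \<Sum>b\<in>?X. 1 / (ennreal (t ^ r) * biased_mean_power P r b a)"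
  have pos: "0 < ennreal (t ^ r) * biased_mean_power P r b a" if "a \<in> ?X" "b \<in> ?X" for a b
    using r(1)[OF that(2,1)] t by (simp add: ennreal_zero_less_mult_iff)
  have "biased_mean_power P r b a \<noteq> 0" if "a \<in> ?X" "b \<in> ?X" for a b
    using r(1)[OF that(2,1)] by auto
  then show "?C < \<infinity>"
    using t by (auto simp: ennreal_divide_eq_top_iff less_top[symmetric] ennreal_eq_0_iff not_le)
  fix a b n assume ab: "a \<in> ?X" "b \<in> ?X"
  have "ennreal (t ^ n) * biased_mean_power P n a b * (ennreal (t ^ r) * biased_mean_power P r b a) =
      ennreal (t ^ (n + r)) * (biased_mean_power P n a b * biased_mean_power P r b a)"
    using t by (simp add: power_add ennreal_mult mult_ac)
  also have "\<dots> \<le> ennreal (t ^ (n + r)) * biased_mean_power P (n + r) a a"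
    unfolding biased_mean_power_add[OF ab(1)] using ab(2) by (intro mult_left_mono member_le_sum) auto
  also have "\<dots> \<le> 1" using r(2) by (intro sub ab) simp
  finally have "ennreal (t ^ n) * biased_mean_power P n a b \<le> 1 / (ennreal (t ^ r) * biased_mean_power P r b a)"
    by (rule ennreal_le_inverse[OF _ pos[OF ab]])
  also have "\<dots> \<le> (\<Sum>b\<in>?X. 1 / (ennreal (t ^ r) * biased_mean_power P r b a))" using ab by (intro member_le_sum) auto
  also have "\<dots> \<le> ?C" using ab by (intro member_le_sum[of a ?X "\<lambda>a. \<Sum>b\<in>?X. 1 / (ennreal (t ^ r) * biased_mean_power P r b a)"]) auto
  finally show "ennreal (t ^ n) * biased_mean_power P n a b \<le> ?C" .
qed

lemma pos_pairs_sym: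
  assumes "umgw_parameters p P" "(i, j) \<in> pos_pairs P"
  shows "(j, i) \<in> pos_pairs P"
proof -
  have "ennreal (pmf p i) * mean P i j = ennreal (pmf p j) * mean P j i" "0 < pmf p i" "0 < pmf p j"
    using assms(1) by (auto simp: umgw_parameters_def)
  moreover have "0 < mean P i j" using assms(2) by (simp add: pos_pairs_def)
  ultimately have "0 < ennreal (pmf p j) * mean P j i"
    by (metis ennreal_less_zero_iff ennreal_zero_less_mult_iff)
  then show ?thesis by (simp add: pos_pairs_def ennreal_zero_less_mult_iff)
qed

lemma mean_eq_0_imp:
  assumes "mean P i j = 0" "k \<in> set_pmf (P i)"
  shows "k j = 0"
proof -
  have "AE k in measure_pmf (P i). (of_nat (k j) :: ennreal) = 0"
    using assms(1) unfolding mean_def by (subst (asm) nn_integral_0_iff_AE) auto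
  then show ?thesis using assms(2) by (auto simp: AE_measure_pmf_iff)
qed

text \<open>
  By the balance condition on \<open>p\<close> and the means, a pair of a child and its parent that occurs with
  positive probability lies in \<open>pos_pairs P\<close>.
\<close>

lemma biased_mean_eq_0:
  fixes P :: "'q::finite offspring_laws"
  assumes u: "umgw_parameters p P" and a: "a \<in> pos_pairs P" and b: "b \<notin> pos_pairs P"
  shows "biased_mean P a b = 0"
proof (cases "snd b = fst a")
  case True
  obtain i j where ij: "a = (i, j)" by (cases a)
  obtain l where l: "b = (l, i)" using True ij by (cases b) simp
  have "(i, l) \<notin> pos_pairs P" using pos_pairs_sym[OF u, of i l] b l by auto
  then have m: "mean P i l = 0" by (simp add: pos_pairs_def)
  have fin: "mean P i j < \<infinity>" using u by (simp add: umgw_parameters_def)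
  have "k l = 0" if "k \<in> set_pmf (biased_law P i j)" for k
  proof -
    have "pmf (biased_law P i j) k \<noteq> 0" using that by (simp add: set_pmf_iff)
    then have "pmf (P i) (k(j := k j + 1)) \<noteq> 0"
      using pmf_biased_law[of i j P k] a ij fin by auto
    then have "(k(j := k j + 1)) l = 0" by (intro mean_eq_0_imp[OF m, of "k(j := k j + 1)"]) (simp only: set_pmf_iff not_False_eq_True)
    then show ?thesis by (auto split: if_splits)
  qed
  then have "(\<integral>\<^sup>+k. of_nat (k l) \<partial>measure_pmf (biased_law P i j)) = (\<integral>\<^sup>+k. 0 \<partial>measure_pmf (biased_law P i j))"
    by (intro nn_integral_cong_AE) (auto simp: AE_measure_pmf_iff)
  then show ?thesis by (simp add: biased_mean_def ij l)
qed (auto simp: biased_mean_def split: prod.splits)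

lemma child_sum_tendsto_plus_field:
  assumes "0 \<le> \<beta>"
  shows "(\<lambda>N. child_sum N (\<lambda>_. root_message \<beta>) K) \<longlonglongrightarrow> plus_field \<beta> (offspring_tree K) []"
    and "incseq (\<lambda>N. child_sum N (\<lambda>_. root_message \<beta>) K)"
proof -
  let ?C = "children (offspring_tree K) []"
  have fin: "finite ?C" by (rule finite_children[OF rooted_tree_in_tree])
  define M where "M = Suc (Max (insert 0 (snd ` ?C)))"
  have M: "snd c < N" if "c \<in> ?C" "M \<le> N" for c N
  proof -
    have "snd c \<le> Max (insert 0 (snd ` ?C))" using fin that(1) by (intro Max_ge) auto
    then show ?thesis using that(2) by (simp add: M_def)
  qed
  have "child_sum N (\<lambda>_. root_message \<beta>) K = plus_field \<beta> (offspring_tree K) []" if "M \<le> N" for N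
  proof -
    have "{c \<in> ?C. snd c < N} = ?C" using M[OF _ that] by auto
    then show ?thesis unfolding child_sum_eq_incoming plus_field_root[OF assms] by simp
  qed
  then have "\<forall>\<^sub>F N in sequentially. plus_field \<beta> (offspring_tree K) [] = child_sum N (\<lambda>_. root_message \<beta>) K"
    unfolding eventually_sequentially by metis
  then show "(\<lambda>N. child_sum N (\<lambda>_. root_message \<beta>) K) \<longlonglongrightarrow> plus_field \<beta> (offspring_tree K) []"
    by (rule Lim_transform_eventually[OF tendsto_const])
  show "incseq (\<lambda>N. child_sum N (\<lambda>_. root_message \<beta>) K)"
    unfolding child_sum_eq_incoming using fin root_message_bounds(1)[OF assms]
    by (intro incseq_SucI sum_mono2) auto
qed

lemma root_message_eq_cavity:
  "0 \<le> \<beta> \<Longrightarrow> root_message \<beta> K = cavity \<beta> (plus_field \<beta> (offspring_tree K) [])"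
  unfolding root_message_def plus_field_def by (rule plus_message_eq[OF rooted_tree_in_tree])

lemma bounded_rv_root_message: "0 \<le> \<beta> \<Longrightarrow> bounded_rv (root_message \<beta>)"
  using root_message_bounds[of \<beta>] unfolding bounded_rv_def by (auto intro!: exI[of _ \<beta>])

text \<open>
  Strict concavity: unless the field vanishes, its expectation is strictly smaller than what the
  linearized cavity equations would give.
\<close>

lemma expectation_root_message_less:
  fixes P :: "'q::finite offspring_laws"
  assumes u: "umgw_parameters p P" and \<beta>: "0 < \<beta>" and a: "a \<in> pos_pairs P"
    and fin: "\<And>b. b \<in> pos_pairs P \<Longrightarrow> biased_mean P a b < \<infinity>"
    and pos: "0 < (\<integral>K. root_message \<beta> K \<partial>subtree_measure P a)"
  shows "(\<integral>K. root_message \<beta> K \<partial>subtree_measure P a) <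
    tanh \<beta> * (\<Sum>b\<in>pos_pairs P. enn2real (biased_mean P a b) * (\<integral>K. root_message \<beta> K \<partial>subtree_measure P b))"
proof -
  let ?M = "subtree_measure P a" and ?u = "root_message \<beta> :: 'q offspring \<Rightarrow> real"
  define y where "y b = (\<integral>K. ?u K \<partial>subtree_measure P b)" for b
  define h where "h K = plus_field \<beta> (offspring_tree K) []" for K :: "'q offspring"
  interpret prob_space ?M by (rule prob_space_tree_law)
  have \<beta>0: "0 \<le> \<beta>" using \<beta> by simp
  have b: "bounded_rv ?u" by (rule bounded_rv_root_message[OF \<beta>0])
  have y: "0 \<le> y b" for b unfolding y_def by (rule integral_bounded_rv_nonneg[OF b])
  have bc: "bounded_rv (child_sum N (\<lambda>_. ?u))" for N by (rule bounded_rv_child_sum[OF b])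
  have tr: "trunc_mean P N a b \<le> enn2real (biased_mean P a b)" for N b
  proof -
    have "biased_mean P a b < \<infinity>" using fin[of b] biased_mean_eq_0[OF u a, of b] by (cases "b \<in> pos_pairs P") auto
    moreover have "ennreal (trunc_mean P N a b) \<le> biased_mean P a b"
      unfolding biased_mean_eq_SUP by (rule SUP_upper) simp
    ultimately show ?thesis using trunc_mean_nonneg[of P N a b]
      by (metis enn2real_ennreal enn2real_mono infinity_ennreal_def)
  qed
  let ?H = "\<Sum>b\<in>pos_pairs P. enn2real (biased_mean P a b) * y b"
  have le: "(\<integral>K. child_sum N (\<lambda>_. ?u) K \<partial>?M) \<le> ?H" for N
  proof -
    have "(\<integral>K. child_sum N (\<lambda>_. ?u) K \<partial>?M) = (\<Sum>b\<in>UNIV. trunc_mean P N a b * y b)"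
      using expectation_child_sum[where \<phi> = "\<lambda>_. ?u" and N = N and a = a and P = P] b unfolding y_def by simp
    also have "\<dots> \<le> (\<Sum>b\<in>UNIV. enn2real (biased_mean P a b) * y b)" by (intro sum_mono mult_right_mono tr y)
    also have "\<dots> = ?H" using biased_mean_eq_0[OF u a] by (intro sum.mono_neutral_right) auto
    finally show ?thesis .
  qed
  have inc: "incseq (\<lambda>N. \<integral>K. child_sum N (\<lambda>_. ?u) K \<partial>?M)"
    by (intro incseq_SucI integral_mono integrable_bounded_rv bc incseq_SucD[OF child_sum_tendsto_plus_field(2)[OF \<beta>0]])
  obtain x where x: "(\<lambda>N. \<integral>K. child_sum N (\<lambda>_. ?u) K \<partial>?M) \<longlonglongrightarrow> x"
    using incseq_convergent[OF inc] le by blast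
  have xH: "x \<le> ?H" by (rule LIMSEQ_le_const2[OF x]) (use le in auto)
  have hm: "h \<in> borel_measurable ?M" unfolding h_def[abs_def]
    by (rule borel_measurable_LIMSEQ_real[OF child_sum_tendsto_plus_field(1)[OF \<beta>0]])
      (use bc in \<open>simp add: bounded_rv_def measurable_cong_sets[OF sets_tree_law refl]\<close>)
  have h: "integrable ?M h" "(\<integral>K. h K \<partial>?M) = x"
  proof -
    have 1: "integrable ?M (child_sum N (\<lambda>_. ?u))" for N by (rule integrable_bounded_rv[OF bc])
    have 2: "AE K in ?M. mono (\<lambda>N. child_sum N (\<lambda>_. ?u) K)"
      using child_sum_tendsto_plus_field(2)[OF \<beta>0] by (intro AE_I2)
    have 3: "AE K in ?M. (\<lambda>N. child_sum N (\<lambda>_. ?u) K) \<longlonglongrightarrow> h K"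
      unfolding h_def by (intro AE_I2 child_sum_tendsto_plus_field(1)[OF \<beta>0])
    show "integrable ?M h" "(\<integral>K. h K \<partial>?M) = x"
      by (rule integrable_monotone_convergence[OF 1 2 3 x hm], rule integral_monotone_convergence[OF 1 2 3 x hm])
  qed
  have h0: "0 \<le> h K" for K unfolding h_def using \<beta>0 by (intro plus_field_nonneg[OF rooted_tree_in_tree])
  have uh: "?u K = cavity \<beta> (h K)" for K unfolding h_def by (rule root_message_eq_cavity[OF \<beta>0])
  have d: "integrable ?M (\<lambda>K. tanh \<beta> * h K - ?u K)"
    using h(1) integrable_bounded_rv[OF b] by (intro Bochner_Integration.integrable_diff integrable_mult_right)
  have d0: "0 \<le> tanh \<beta> * h K - ?u K" for K
    unfolding uh using cavity_le_linear[OF \<beta>0 h0] by simp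
  have "(\<integral>K. tanh \<beta> * h K - ?u K \<partial>?M) \<noteq> 0"
  proof
    assume "(\<integral>K. tanh \<beta> * h K - ?u K \<partial>?M) = 0"
    then have "AE K in ?M. tanh \<beta> * h K - ?u K = 0"
      using d d0 by (subst (asm) integral_nonneg_eq_0_iff_AE) auto
    then have "AE K in ?M. ?u K = 0"
    proof eventually_elim
      case (elim K)
      then show ?case using cavity_less[OF \<beta>, of "h K"] h0[of K] uh[of K] by (cases "h K = 0") auto
    qed
    then have "(\<integral>K. ?u K \<partial>?M) = 0" using integral_eq_zero_AE by blast
    then show False using pos by simp
  qed
  moreover have "0 \<le> (\<integral>K. tanh \<beta> * h K - ?u K \<partial>?M)" using d0 by (intro Bochner_Integration.integral_nonneg)
  moreover have "(\<integral>K. tanh \<beta> * h K - ?u K \<partial>?M) = tanh \<beta> * x - y a"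
    using h integrable_bounded_rv[OF b] by (simp add: y_def)
  moreover have "tanh \<beta> * x \<le> tanh \<beta> * ?H" using xH \<beta> by (intro mult_left_mono) auto
  ultimately show ?thesis unfolding y_def by linarith
qed

text \<open>
  Iterating the strict inequality of \<open>expectation_root_message_less\<close> gives \<open>y \<le> \<rho> ^ n * t ^ n * M ^ n y\<close>
  with \<open>\<rho> < 1\<close> for the vector \<open>y\<close> of expected fields and the mean matrix \<open>M\<close>, where \<open>t ^ n * M ^ n\<close> is
  bounded.
\<close>

theorem root_message_0_of_biased_mean_power_le:
  fixes P :: "'q::finite offspring_laws"
  assumes u: "umgw_parameters p P" and \<beta>: "0 < \<beta>"
    and sub: "\<And>a n. a \<in> pos_pairs P \<Longrightarrow> 0 < n \<Longrightarrow> ennreal (tanh \<beta> ^ n) * biased_mean_power P n a a \<le> 1"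
    and a: "a \<in> pos_pairs P"
  shows "AE K in subtree_measure P a. root_message \<beta> K = 0"
proof -
  let ?X = "pos_pairs P" and ?t = "tanh \<beta>"
  define y where "y b = (\<integral>K. root_message \<beta> K \<partial>subtree_measure P b)" for b
  have \<beta>0: "0 \<le> \<beta>" and t: "0 < ?t" using \<beta> by auto
  have bu: "bounded_rv (root_message \<beta>)" by (rule bounded_rv_root_message[OF \<beta>0])
  have y: "0 \<le> y b" for b unfolding y_def by (rule integral_bounded_rv_nonneg[OF bu])
  obtain r where r: "0 < r" "\<And>a b. a \<in> ?X \<Longrightarrow> b \<in> ?X \<Longrightarrow> 0 < biased_mean_power P r a b"
    using u unfolding umgw_parameters_def by blast
  obtain C where C: "C < \<infinity>" "\<And>a b n. a \<in> ?X \<Longrightarrow> b \<in> ?X \<Longrightarrow> ennreal (?t ^ n) * biased_mean_power P n a b \<le> C"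
    using biased_mean_power_bounded[OF t r(2,1) sub] by blast
  have fin: "biased_mean P a b < \<infinity>" if "a \<in> ?X" "b \<in> ?X" for a b
  proof -
    have "biased_mean_power P 1 a b = (\<Sum>c\<in>?X. if c = b then biased_mean P a c else 0)"
      unfolding One_nat_def biased_mean_power.simps by (intro sum.cong refl) simp
    also have "\<dots> = biased_mean P a b" using that by simp
    finally have e: "biased_mean_power P 1 a b = biased_mean P a b" .
    have "ennreal ?t * biased_mean P a b \<le> C" using C(2)[OF that, of 1] unfolding e by simp
    then have "ennreal ?t * biased_mean P a b < \<infinity>" using C(1) by (rule le_less_trans)
    then show ?thesis using t by (auto simp: ennreal_mult_less_top)
  qed
  define H where "H a = ?t * (\<Sum>b\<in>?X. enn2real (biased_mean P a b) * y b)" for a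
  have H: "0 \<le> H a" for a unfolding H_def using t y by (intro mult_nonneg_nonneg sum_nonneg) auto
  have less: "y a < H a" if "a \<in> ?X" "0 < y a" for a
    using expectation_root_message_less[OF u \<beta> that(1) fin[OF that(1)]] that(2) unfolding y_def H_def by blast
  \<comment> \<open>the quotient is less than 1 if \<open>y a > 0\<close>, and 0 otherwise, even if \<open>H a = 0\<close>\<close>
  define \<rho> where "\<rho> = Max (insert 0 ((\<lambda>a. y a / H a) ` ?X))"
  have \<rho>0: "0 \<le> \<rho>" unfolding \<rho>_def by (intro Max_ge) auto
  have \<rho>1: "\<rho> < 1" unfolding \<rho>_def
  proof (subst Max_less_iff)
    show "\<forall>x\<in>insert 0 ((\<lambda>a. y a / H a) ` ?X). x < 1"
    proof safe
      fix i j assume ij: "(i, j) \<in> ?X"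
      show "y (i, j) / H (i, j) < 1"
      proof (cases "y (i, j) = 0")
        case False
        then have "0 < y (i, j)" using y[of "(i, j)"] by simp
        then show ?thesis using less[OF ij] by (simp add: divide_less_eq)
      qed simp
    qed simp
  qed auto
  have step: "y a \<le> \<rho> * H a" if "a \<in> ?X" for a
  proof (cases "y a = 0")
    case True
    then show ?thesis using \<rho>0 H by simp
  next
    case False
    then have "0 < H a" using less[OF that] y[of a] by (meson less_le_trans less_le not_less order.strict_trans)
    moreover have "y a / H a \<le> \<rho>" unfolding \<rho>_def using that by (intro Max_ge) auto
    ultimately show ?thesis by (simp add: divide_le_eq)
  qed
  have estep: "ennreal (y a) \<le> ennreal (\<rho> * ?t) * (\<Sum>b\<in>?X. biased_mean P a b * ennreal (y b))" if "a \<in> ?X" for a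
  proof -
    have "ennreal (y a) \<le> ennreal (\<rho> * H a)" using step[OF that] by (rule ennreal_leI)
    also have "\<dots> = ennreal (\<rho> * ?t) * ennreal (\<Sum>b\<in>?X. enn2real (biased_mean P a b) * y b)"
      unfolding H_def using \<rho>0 t y by (subst ennreal_mult[symmetric]) (auto intro!: sum_nonneg simp: mult.assoc)
    also have "ennreal (\<Sum>b\<in>?X. enn2real (biased_mean P a b) * y b) = (\<Sum>b\<in>?X. biased_mean P a b * ennreal (y b))"
      using y fin[OF that] by (subst sum_ennreal[symmetric]) (auto intro!: sum.cong simp: ennreal_mult)
    finally show ?thesis .
  qed
  have iter: "ennreal (y a) \<le> ennreal (\<rho> ^ n) * (ennreal (?t ^ n) * (\<Sum>b\<in>?X. biased_mean_power P n a b * ennreal (y b)))"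
    if "a \<in> ?X" for a n
    using that
  proof (induction n arbitrary: a)
    case 0
    have "(\<Sum>b\<in>?X. biased_mean_power P 0 a b * ennreal (y b)) = (\<Sum>b\<in>?X. if a = b then ennreal (y b) else 0)"
      by (intro sum.cong) auto
    then show ?case using 0 by simp
  next
    case (Suc n)
    have "ennreal (y a) \<le> ennreal (\<rho> * ?t) * (\<Sum>c\<in>?X. biased_mean P a c *
        (ennreal (\<rho> ^ n) * (ennreal (?t ^ n) * (\<Sum>b\<in>?X. biased_mean_power P n c b * ennreal (y b)))))"
      by (rule order_trans[OF estep[OF Suc.prems]]) (intro mult_left_mono sum_mono Suc.IH, auto)
    also have "\<dots> = ennreal (\<rho> * ?t) * ennreal (\<rho> ^ n) * ennreal (?t ^ n) *
        (\<Sum>c\<in>?X. \<Sum>b\<in>?X. biased_mean P a c * biased_mean_power P n c b * ennreal (y b))"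
      by (simp add: sum_distrib_left mult_ac)
    also have "\<dots> = ennreal (\<rho> * ?t) * ennreal (\<rho> ^ n) * ennreal (?t ^ n) *
        (\<Sum>b\<in>?X. biased_mean_power P (Suc n) a b * ennreal (y b))"
      by (subst sum.swap) (simp add: sum_distrib_right)
    also have "\<dots> = ennreal (\<rho> ^ Suc n) * (ennreal (?t ^ Suc n) * (\<Sum>b\<in>?X. biased_mean_power P (Suc n) a b * ennreal (y b)))"
      using \<rho>0 t by (simp add: ennreal_mult mult_ac del: biased_mean_power.simps)
    finally show ?case .
  qed
  define D where "D = (\<Sum>b\<in>?X. C * ennreal (y b))"
  have D: "D < \<infinity>" unfolding D_def using C(1) by (auto simp: ennreal_mult_less_top)
  have "ennreal (y a) \<le> ennreal (\<rho> ^ n) * D" for n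
  proof -
    have "ennreal (?t ^ n) * (\<Sum>b\<in>?X. biased_mean_power P n a b * ennreal (y b)) \<le> D"
      unfolding D_def sum_distrib_left mult.assoc[symmetric] by (intro sum_mono mult_right_mono C(2) a) auto
    then show ?thesis using order_trans[OF iter[OF a, of n]] by (simp add: mult_left_mono)
  qed
  then have bd: "y a \<le> \<rho> ^ n * enn2real D" for n
  proof -
    have "ennreal (y a) \<le> ennreal (\<rho> ^ n * enn2real D)"
      using \<open>ennreal (y a) \<le> ennreal (\<rho> ^ n) * D\<close> D \<rho>0 by (simp add: ennreal_mult)
    then show ?thesis using \<rho>0 by (subst (asm) ennreal_le_iff) auto
  qed
  have "(\<lambda>n. \<rho> ^ n * enn2real D) \<longlonglongrightarrow> 0 * enn2real D"
    using \<rho>0 \<rho>1 by (intro tendsto_intros LIMSEQ_power_zero) auto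
  then have "y a \<le> 0 * enn2real D" by (rule LIMSEQ_le_const) (use bd in auto)
  then have "y a = 0" using y[of a] by simp
  then show ?thesis
    using integrable_bounded_rv[OF bu] root_message_bounds(1)[OF \<beta>0]
    unfolding y_def by (subst (asm) integral_nonneg_eq_0_iff_AE) auto
qed

section \<open>The UMGW measure\<close>

lemma space_umgw: "space (umgw p P) = Collect rooted_tree"
  using sets_eq_imp_space_eq[OF sets_umgw] by (simp add: space_tree_space)

lemma umgw_kernel:
  "(\<lambda>i. distr (tree_law (vertex_law P i)) tree_space offspring_tree) \<in> measurable (measure_pmf p) (subprob_algebra tree_space)"
proof -
  have "prob_space (distr (tree_law (vertex_law P i)) tree_space offspring_tree)" for i
    using measurable_offspring_tree
    by (intro prob_space.prob_space_distr prob_space_tree_law) (simp add: measurable_cong_sets[OF sets_tree_law refl])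
  then have "(\<lambda>i. distr (tree_law (vertex_law P i)) tree_space offspring_tree) \<in> measurable (measure_pmf p) (prob_algebra tree_space)"
    by (auto simp: space_prob_algebra)
  then show ?thesis by (rule measurable_prob_algebraD)
qed

lemma umgw_eq_bind: "umgw p P = measure_pmf p \<bind> (\<lambda>i. distr (tree_law (vertex_law P i)) tree_space offspring_tree)"
  by (simp add: umgw_def tree_law_def)

lemma AE_umgw_iff:
  assumes "Measurable.pred tree_space Q"
  shows "(AE T in umgw p P. Q T) \<longleftrightarrow> (\<forall>i\<in>set_pmf p. AE K in tree_law (vertex_law P i). Q (offspring_tree K))"
proof -
  have "(AE T in distr (tree_law (vertex_law P i)) tree_space offspring_tree. Q T) \<longleftrightarrow>
      (AE K in tree_law (vertex_law P i). Q (offspring_tree K))" for i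
    using assms measurable_offspring_tree
    by (intro AE_distr_iff) (simp_all add: measurable_cong_sets[OF sets_tree_law refl] pred_def)
  then show ?thesis
    unfolding umgw_eq_bind AE_bind[OF umgw_kernel assms] by (simp add: AE_measure_pmf_iff)
qed

lemma measurable_root_edges_unmagnetized:
  fixes \<beta> :: real
  assumes "0 \<le> \<beta>"
  shows "Measurable.pred tree_space (\<lambda>T :: 'a::countable list set. \<forall>c. [c] \<in> T \<longrightarrow> plus_message \<beta> T [c] = 0)"
proof -
  note measurable_mem_tree[measurable] measurable_plus_message[OF assms, measurable]
  show ?thesis by measurable
qed

text \<open>
  A root of type \<open>i\<close> has a child of type \<open>j\<close> with positive probability whenever \<open>(j, i) \<in> pos_pairs P\<close>.
  The event that it does is independent of the subtree of its first potential child of type \<open>j\<close>, which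
  has the law \<open>subtree_measure P (j, i)\<close>.
\<close>

lemma root_message_0_of_umgw:
  fixes P :: "'q::finite offspring_laws"
  assumes u: "umgw_parameters p P" and \<beta>: "0 \<le> \<beta>"
    and z: "AE T in umgw p P. \<forall>c. [c] \<in> T \<longrightarrow> plus_message \<beta> T [c] = 0" and a: "a \<in> pos_pairs P"
  shows "AE K in subtree_measure P a. root_message \<beta> K = 0"
proof -
  obtain j i where ji: "a = (j, i)" by (cases a)
  let ?Q = "vertex_law P i" and ?c = "(j, 0) :: 'q \<times> nat"
  have ij: "(i, j) \<in> pos_pairs P" using pos_pairs_sym[OF u] a ji by blast
  have "0 < pmf p i" using u unfolding umgw_parameters_def by blast
  then have "i \<in> set_pmf p" by (simp add: set_pmf_iff)
  with z have "AE K in tree_law ?Q. \<forall>c. [c] \<in> offspring_tree K \<longrightarrow> plus_message \<beta> (offspring_tree K) [c] = 0"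
    unfolding AE_umgw_iff[OF measurable_root_edges_unmagnetized[OF \<beta>]] by (rule bspec)
  then have "AE K in tree_law ?Q. (if 0 < K [] j then 1 else 0) * (\<Prod>c\<in>{?c}. root_message \<beta> (descend c K)) = 0"
  proof eventually_elim
    case (elim K)
    show ?case
    proof (cases "0 < K [] j")
      case True
      then show ?thesis using elim plus_message_child[of ?c K \<beta>] \<beta> by simp
    qed simp
  qed
  then have "(\<integral>K. (if 0 < K [] j then 1 else 0) * (\<Prod>c\<in>{?c}. root_message \<beta> (descend c K)) \<partial>tree_law ?Q) = 0"
    by (rule integral_eq_zero_AE)
  moreover have "(\<integral>K. (if 0 < K [] j then 1 else 0) * (\<Prod>c\<in>{?c}. root_message \<beta> (descend c K)) \<partial>tree_law ?Q) =
      (\<integral>k. (if 0 < k j then 1 else 0) \<partial>measure_pmf (?Q [])) * (\<Prod>c\<in>{?c}. \<integral>K. root_message \<beta> K \<partial>tree_law (\<lambda>v. ?Q (v @ [c])))"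
    using \<beta> by (intro integral_branching[where B = "max \<beta> 1"])
      (auto simp: le_max_iff_disj abs_of_nonneg root_message_bounds)
  ultimately have "(\<integral>k. (if 0 < k j then 1 else 0 :: real) \<partial>measure_pmf (P i)) = 0 \<or> (\<integral>K. root_message \<beta> K \<partial>subtree_measure P a) = 0"
    by (simp add: vertex_law_append[abs_def] ji)
  moreover have "(\<integral>k. (if 0 < k j then 1 else 0 :: real) \<partial>measure_pmf (P i)) \<noteq> 0"
  proof
    assume "(\<integral>k. (if 0 < k j then 1 else 0 :: real) \<partial>measure_pmf (P i)) = 0"
    then have "AE k in measure_pmf (P i). (if 0 < k j then 1 else 0 :: real) = 0"
      by (subst (asm) integral_nonneg_eq_0_iff_AE) (auto intro!: measure_pmf.integrable_const_bound[where B = 1])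
    then have "AE k in measure_pmf (P i). (of_nat (k j) :: ennreal) = 0"
      by eventually_elim (auto split: if_splits)
    then have "mean P i j = 0" unfolding mean_def by (subst nn_integral_0_iff_AE) auto
    then show False using ij by (simp add: pos_pairs_def)
  qed
  ultimately have "(\<integral>K. root_message \<beta> K \<partial>subtree_measure P a) = 0" by blast
  then show ?thesis
    using integrable_bounded_rv[OF bounded_rv_root_message[OF \<beta>]] root_message_bounds(1)[OF \<beta>]
    by (subst (asm) integral_nonneg_eq_0_iff_AE) auto
qed

lemma umgw_of_root_message_0:
  fixes P :: "'q::finite offspring_laws"
  assumes u: "umgw_parameters p P" and \<beta>: "0 \<le> \<beta>"
    and z: "\<And>a. a \<in> pos_pairs P \<Longrightarrow> AE K in subtree_measure P a. root_message \<beta> K = 0"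
  shows "AE T in umgw p P. \<forall>c. [c] \<in> T \<longrightarrow> plus_message \<beta> T [c] = 0"
  unfolding AE_umgw_iff[OF measurable_root_edges_unmagnetized[OF \<beta>]]
proof
  fix i assume "i \<in> set_pmf p"
  let ?Q = "vertex_law P i"
  have "AE K in tree_law ?Q. snd c < K [] (fst c) \<longrightarrow> root_message \<beta> (descend c K) = 0" for c
  proof (cases "(fst c, i) \<in> pos_pairs P")
    case True
    have "AE K in distr (tree_law ?Q) offspring_space (descend c). root_message \<beta> K = 0"
      using z[OF True] unfolding distr_descend vertex_law_append .
    then have "AE K in tree_law ?Q. root_message \<beta> (descend c K) = 0"
    proof (subst (asm) AE_distr_iff)
      show "descend c \<in> measurable (tree_law ?Q) offspring_space"
        by (simp add: measurable_cong_sets[OF sets_tree_law refl])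
      note measurable_root_message[OF \<beta>, measurable]
      have "Measurable.pred offspring_space (\<lambda>K :: 'q offspring. root_message \<beta> K = 0)" by measurable
      then show "{K \<in> space offspring_space. root_message \<beta> (K :: 'q offspring) = 0} \<in> sets offspring_space"
        by (simp add: pred_def)
    qed
    then show ?thesis by eventually_elim simp
  next
    case False
    then have "(i, fst c) \<notin> pos_pairs P" using pos_pairs_sym[OF u] by blast
    then have m: "mean P i (fst c) = 0" by (simp add: pos_pairs_def)
    have "AE k in measure_pmf (?Q []). k (fst c) = 0"
      using mean_eq_0_imp[OF m] by (simp add: AE_measure_pmf_iff)
    then have "AE K in tree_law ?Q. K [] (fst c) = 0"
      unfolding tree_law_def by (intro AE_PiM_component) (auto intro: measure_pmf.prob_space_axioms)
    then show ?thesis by eventually_elim simp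
  qed
  then have "AE K in tree_law ?Q. \<forall>c. snd c < K [] (fst c) \<longrightarrow> root_message \<beta> (descend c K) = 0"
    unfolding AE_all_countable by blast
  then show "AE K in tree_law ?Q. \<forall>c. [c] \<in> offspring_tree K \<longrightarrow> plus_message \<beta> (offspring_tree K) [c] = 0"
  proof eventually_elim
    case (elim K)
    show ?case
    proof (intro allI impI)
      fix c assume "[c] \<in> offspring_tree K"
      then have l: "snd c < K [] (fst c)" by simp
      then show "plus_message \<beta> (offspring_tree K) [c] = 0"
        using elim plus_message_child[of c K \<beta>, OF l \<beta>] by (cases c) simp
    qed
  qed
qed

lemma unmagnetized_below_critical:
  fixes P :: "'q::finite offspring_laws"
  assumes u: "umgw_parameters p P" and c: "critical_inverse_temperature (umgw p P) \<beta>\<^sub>c"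
    and \<beta>: "0 < \<beta>" "\<beta> < \<beta>\<^sub>c"
  shows "AE T in umgw p P. \<forall>c. [c] \<in> T \<longrightarrow> plus_message \<beta> T [c] = 0"
proof -
  have "AE T in umgw p P. \<exists>!\<nu>. ising_gibbs \<beta> T \<nu>"
  proof -
    have "AE T in umgw p P. \<forall>\<beta>\<ge>0. (\<beta> < \<beta>\<^sub>c \<longrightarrow> (\<exists>!\<nu>. ising_gibbs \<beta> T \<nu>)) \<and>
        (\<beta> > \<beta>\<^sub>c \<longrightarrow> (\<exists>\<nu> \<nu>'. ising_gibbs \<beta> T \<nu> \<and> ising_gibbs \<beta> T \<nu>' \<and> \<nu> \<noteq> \<nu>'))"
      using c by (simp add: critical_inverse_temperature_def)
    then show ?thesis
    proof eventually_elim
      case (elim T)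
      from elim[rule_format, of \<beta>, THEN conjunct1, rule_format] \<beta> show ?case by simp
    qed
  qed
  with AE_space show ?thesis
  proof eventually_elim
    case (elim T)
    then have "rooted_tree T" by (simp add: space_umgw)
    then show ?case using unique_gibbs_imp_plus_message_eq_0[OF _ \<beta>(1) elim(2)] by blast
  qed
qed

text \<open>
  Uniqueness below \<open>\<beta>\<^sub>c\<close> bounds the growth of the tree, the bound passes to \<open>\<beta>\<^sub>c\<close> by continuity, and
  there it excludes magnetization.
\<close>

lemma unmagnetized_at_critical:
  fixes P :: "'q::finite offspring_laws"
  assumes u: "umgw_parameters p P" and c: "critical_inverse_temperature (umgw p P) \<beta>\<^sub>c" and pos: "0 < \<beta>\<^sub>c"
  shows "AE T in umgw p P. \<forall>c. [c] \<in> T \<longrightarrow> plus_message \<beta>\<^sub>c T [c] = 0"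
proof (rule umgw_of_root_message_0[OF u])
  show "0 \<le> \<beta>\<^sub>c" using pos by simp
  fix a assume a: "a \<in> pos_pairs P"
  show "AE K in subtree_measure P a. root_message \<beta>\<^sub>c K = 0"
  proof (rule root_message_0_of_biased_mean_power_le[OF u pos _ a])
    fix a :: "'q \<times> 'q" and n :: nat assume a: "a \<in> pos_pairs P" and n: "0 < n"
    have le: "ennreal (tanh \<beta> ^ n) * biased_mean_power P n a a \<le> 1" if "0 < \<beta>" "\<beta> < \<beta>\<^sub>c" for \<beta>
      using root_message_0_of_umgw[OF u _ unmagnetized_below_critical[OF u c that] a] that
      by (intro biased_mean_power_le_of_root_message_0 n) auto
    have "ennreal (tanh (\<beta>\<^sub>c / 2) ^ n) * biased_mean_power P n a a < \<infinity>"
      using le[of "\<beta>\<^sub>c / 2"] pos by (intro le_less_trans[OF le]) auto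
    then have "biased_mean_power P n a a < \<infinity>" using pos by (auto simp: ennreal_mult_less_top)
    then obtain m where m: "0 \<le> m" "biased_mean_power P n a a = ennreal m"
      by (cases "biased_mean_power P n a a") auto
    have le': "tanh \<beta> ^ n * m \<le> 1" if "0 < \<beta>" "\<beta> < \<beta>\<^sub>c" for \<beta>
      using le[OF that] that m by (simp add: ennreal_mult[symmetric] ennreal_le_1)
    have "((\<lambda>\<beta>. tanh \<beta> ^ n * m) \<longlongrightarrow> tanh \<beta>\<^sub>c ^ n * m) (at_left \<beta>\<^sub>c)"
      by (intro tendsto_intros) auto
    moreover have "\<forall>\<^sub>F \<beta> in at_left \<beta>\<^sub>c. tanh \<beta> ^ n * m \<le> 1"
      using eventually_at_left_real[OF pos] by eventually_elim (auto intro: le')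
    ultimately have "tanh \<beta>\<^sub>c ^ n * m \<le> 1" by (rule tendsto_upperbound) simp
    then show "ennreal (tanh \<beta>\<^sub>c ^ n) * biased_mean_power P n a a \<le> 1"
      using m pos by (simp add: ennreal_mult[symmetric] ennreal_le_1)
  qed
qed


section \<open>Continuity of the internal energy\<close>

lemma measurable_root_energy:
  assumes "0 \<le> \<beta>"
  shows "(\<lambda>T :: 'a::countable list set. root_energy \<beta> T) \<in> borel_measurable tree_space"
proof -
  have [measurable]: "(tanh :: real \<Rightarrow> real) \<in> borel_measurable borel"
    by (intro borel_measurable_continuous_onI continuous_intros) auto
  note measurable_plus_message[OF assms, measurable]
  have [measurable]: "(\<lambda>T :: 'a list set. plus_field \<beta> T v) \<in> borel_measurable tree_space" for v
    unfolding plus_field_def incoming_def by (rule measurable_sum_children) measurable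
  show ?thesis
    unfolding root_energy_def edge_corr_def by (rule measurable_sum_children) measurable
qed

lemma integrable_root_degree:
  fixes P :: "'q::finite offspring_laws"
  assumes u: "umgw_parameters p P"
  shows "integrable (umgw p P) (\<lambda>T. real (card (children T [])))"
proof (rule integrableI_bounded)
  have m: "(\<lambda>T :: ('q \<times> nat) list set. real (card (children T []))) \<in> borel_measurable tree_space"
    using measurable_sum_children[of "\<lambda>_ _. 1" "[]"] by simp
  then show "(\<lambda>T. real (card (children T []))) \<in> borel_measurable (umgw p P)"
    by (simp add: measurable_cong_sets[OF sets_umgw refl])
  have deg: "card (children (offspring_tree K) []) = (\<Sum>j\<in>UNIV. K [] j)" for K :: "'q offspring"
  proof -
    have "children (offspring_tree K) [] = (SIGMA j:UNIV. {..<K [] j})"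
      by (auto simp: children_offspring_tree_root)
    then show ?thesis by simp
  qed
  have "(\<integral>\<^sup>+T. ennreal (card (children T [])) \<partial>distr (tree_law (vertex_law P i)) tree_space offspring_tree) =
      (\<Sum>j\<in>UNIV. mean P i j)" for i
  proof -
    have "(\<integral>\<^sup>+T. ennreal (card (children T [])) \<partial>distr (tree_law (vertex_law P i)) tree_space offspring_tree) =
        (\<integral>\<^sup>+K. ennreal (card (children (offspring_tree K) [])) \<partial>tree_law (vertex_law P i))"
      using m measurable_offspring_tree by (intro nn_integral_distr) (simp_all add: measurable_cong_sets[OF sets_tree_law refl])
    also have "\<dots> = (\<integral>\<^sup>+K. (\<Sum>j\<in>UNIV. of_nat (K [] j)) \<partial>tree_law (vertex_law P i))"
      unfolding deg by (simp add: ennreal_of_nat_eq_real_of_nat sum_ennreal)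
    also have "\<dots> = (\<integral>\<^sup>+k. (\<Sum>j\<in>UNIV. of_nat (k j)) \<partial>distr (tree_law (vertex_law P i)) (measure_pmf (vertex_law P i [])) (\<lambda>K. K []))"
      by (intro nn_integral_distr[symmetric]) (simp_all add: measurable_cong_sets[OF sets_tree_law refl])
    also have "distr (tree_law (vertex_law P i)) (measure_pmf (vertex_law P i [])) (\<lambda>K. K []) = measure_pmf (vertex_law P i [])"
      unfolding tree_law_def by (intro distr_PiM_component measure_pmf.prob_space_axioms) simp
    also have "(\<integral>\<^sup>+k. (\<Sum>j\<in>UNIV. of_nat (k j)) \<partial>measure_pmf (vertex_law P i [])) = (\<Sum>j\<in>UNIV. mean P i j)"
      by (simp add: nn_integral_sum mean_def)
    finally show ?thesis .
  qed
  then have "(\<integral>\<^sup>+T. ennreal (card (children T [])) \<partial>umgw p P) = (\<integral>\<^sup>+i. (\<Sum>j\<in>UNIV. mean P i j) \<partial>measure_pmf p)"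
    unfolding umgw_eq_bind using m by (subst nn_integral_bind[OF _ umgw_kernel]) auto
  also have "\<dots> = (\<Sum>i\<in>UNIV. (\<Sum>j\<in>UNIV. mean P i j) * ennreal (pmf p i))"
    by (subst nn_integral_measure_pmf_support[of UNIV]) (auto simp: mult.commute)
  also have "\<dots> < \<infinity>" using u by (auto simp: umgw_parameters_def ennreal_mult_less_top)
  finally show "(\<integral>\<^sup>+T. ennreal (norm (real (card (children T [])))) \<partial>umgw p P) < \<infinity>" by simp
qed

lemma internal_energy_umgw:
  fixes P :: "'q::finite offspring_laws"
  assumes "0 \<le> \<beta>"
  shows "internal_energy (umgw p P) \<beta> = 1 / 2 * (\<integral>T. root_energy \<beta> T \<partial>umgw p P)"
  unfolding internal_energy_def
  by (intro arg_cong2[where f = "(*)"] refl Bochner_Integration.integral_cong)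
    (simp add: space_umgw sum_edge_spins_eq_root_energy assms)

lemma integrable_root_energy:
  fixes P :: "'q::finite offspring_laws"
  assumes u: "umgw_parameters p P" and \<beta>: "0 \<le> \<beta>"
  shows "integrable (umgw p P) (root_energy \<beta>)"
proof (rule Bochner_Integration.integrable_bound[OF integrable_root_degree[OF u]])
  show "root_energy \<beta> \<in> borel_measurable (umgw p P)"
    using measurable_root_energy[OF \<beta>] by (simp add: measurable_cong_sets[OF sets_umgw refl])
  show "AE T in umgw p P. norm (root_energy \<beta> T) \<le> norm (real (card (children T [])))"
    by (intro AE_I2) (simp add: space_umgw abs_of_nonneg root_energy_bounds \<beta>)
qed

lemma internal_energy_mono:
  fixes P :: "'q::finite offspring_laws"
  assumes u: "umgw_parameters p P" and "0 \<le> \<beta>" "\<beta> \<le> \<beta>'"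
  shows "internal_energy (umgw p P) \<beta> \<le> internal_energy (umgw p P) \<beta>'"
proof -
  have "(\<integral>T. root_energy \<beta> T \<partial>umgw p P) \<le> (\<integral>T. root_energy \<beta>' T \<partial>umgw p P)"
    using assms by (intro integral_mono integrable_root_energy root_energy_mono) (auto simp: space_umgw)
  then show ?thesis using assms by (simp add: internal_energy_umgw)
qed

lemma internal_energy_tendsto:
  fixes P :: "'q::finite offspring_laws"
  assumes u: "umgw_parameters p P" and f: "\<And>n. 0 \<le> f n" and \<beta>: "0 \<le> \<beta>"
    and lim: "AE T in umgw p P. (\<lambda>n. root_energy (f n) T) \<longlonglongrightarrow> root_energy \<beta> T"
  shows "(\<lambda>n. internal_energy (umgw p P) (f n)) \<longlonglongrightarrow> internal_energy (umgw p P) \<beta>"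
proof -
  have "(\<lambda>n. \<integral>T. root_energy (f n) T \<partial>umgw p P) \<longlonglongrightarrow> (\<integral>T. root_energy \<beta> T \<partial>umgw p P)"
  proof (rule integral_dominated_convergence[OF _ _ integrable_root_degree[OF u] lim])
    show "root_energy \<beta> \<in> borel_measurable (umgw p P)" "root_energy (f n) \<in> borel_measurable (umgw p P)" for n
      using integrable_root_energy[OF u] \<beta> f by auto
    show "AE T in umgw p P. norm (root_energy (f n) T) \<le> real (card (children T []))" for n
      by (intro AE_I2) (simp add: space_umgw abs_of_nonneg root_energy_bounds f)
  qed
  then show ?thesis unfolding internal_energy_umgw[OF f] internal_energy_umgw[OF \<beta>] by (intro tendsto_intros)
qed

lemma internal_energy_tendsto_right:
  fixes P :: "'q::finite offspring_laws"
  assumes u: "umgw_parameters p P" and \<beta>: "0 \<le> \<beta>" and f: "f \<longlonglongrightarrow> \<beta>" "\<And>n. \<beta> \<le> f n"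
  shows "(\<lambda>n. internal_energy (umgw p P) (f n)) \<longlonglongrightarrow> internal_energy (umgw p P) \<beta>"
proof (rule internal_energy_tendsto[OF u _ \<beta>])
  show "0 \<le> f n" for n using \<beta> f(2)[of n] by simp
  show "AE T in umgw p P. (\<lambda>n. root_energy (f n) T) \<longlonglongrightarrow> root_energy \<beta> T"
    using plus_message_tendsto_right[OF _ \<beta> f] \<beta>
    by (intro AE_I2 root_energy_tendsto[OF f(1)]) (auto simp: space_umgw)
qed

lemma plus_message_outside:
  assumes "rooted_tree T" "0 \<le> \<beta>" "v \<notin> T"
  shows "plus_message \<beta> T v = 0"
proof -
  have "children T v = {}" using assms(1,3) by (auto simp: children_def dest: rooted_tree_parent)
  then show ?thesis by (subst plus_message_eq[OF assms(1,2)]) (simp add: incoming_def)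
qed

lemma internal_energy_tendsto_left:
  fixes P :: "'q::finite offspring_laws"
  assumes u: "umgw_parameters p P" and d: "AE T in umgw p P. min_degree T = d" "2 < d"
    and \<beta>: "artanh (1 / (real d - 1)) < \<beta>" and f: "f \<longlonglongrightarrow> \<beta>" "\<And>n. 0 \<le> f n" "\<And>n. f n \<le> \<beta>"
  shows "(\<lambda>n. internal_energy (umgw p P) (f n)) \<longlonglongrightarrow> internal_energy (umgw p P) \<beta>"
proof -
  let ?b = "d - 1" and ?\<beta>\<^sub>s = "artanh (1 / (real d - 1))"
  have b: "real ?b = real d - 1" "2 \<le> real ?b" using d(2) by auto
  have x: "-1 < 1 / real ?b" "1 / real ?b < 1" "0 < 1 / real ?b" using b(2) by (auto simp: less_divide_eq)
  have ts: "tanh ?\<beta>\<^sub>s = 1 / real ?b" unfolding b(1)[symmetric] by (rule tanh_artanh_real[OF x(1,2)])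
  then have s0: "0 < ?\<beta>\<^sub>s" using x(3) by (metis tanh_real_pos_iff)
  \<comment> \<open>the iteration from below must start at the same field \<open>l\<close> for all temperatures near \<open>\<beta>\<close>\<close>
  define \<beta>\<^sub>1 where "\<beta>\<^sub>1 = (?\<beta>\<^sub>s + \<beta>) / 2"
  have \<beta>1: "0 < \<beta>\<^sub>1" "?\<beta>\<^sub>s < \<beta>\<^sub>1" "\<beta>\<^sub>1 < \<beta>" using s0 \<beta> by (auto simp: \<beta>\<^sub>1_def)
  have "1 / real ?b < tanh \<beta>\<^sub>1" using \<beta>1(2) ts by (metis tanh_real_less_iff)
  then have bt: "1 < real ?b * tanh \<beta>\<^sub>1" using b(2) by (simp add: divide_less_eq mult.commute)
  have \<beta>0: "0 \<le> \<beta>" using \<beta>1 by simp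
  show ?thesis
  proof (rule internal_energy_tendsto[OF u f(2) \<beta>0])
    show "AE T in umgw p P. (\<lambda>n. root_energy (f n) T) \<longlonglongrightarrow> root_energy \<beta> T"
      using AE_space d(1)
    proof eventually_elim
      case (elim T)
      then have T: "rooted_tree T" by (simp add: space_umgw)
      have ch: "?b \<le> card (children T v)" if "v \<in> T" for v
        using min_degree_le_children[OF T that] elim(2) by simp
      have "(\<lambda>n. plus_message (f n) T v) \<longlonglongrightarrow> plus_message \<beta> T v" for v
      proof (cases "v \<in> T")
        case True
        have "(\<lambda>n. max \<beta>\<^sub>1 (f n)) \<longlonglongrightarrow> max \<beta>\<^sub>1 \<beta>" by (intro tendsto_intros f)
        then have l: "(\<lambda>n. plus_message (max \<beta>\<^sub>1 (f n)) T v) \<longlonglongrightarrow> plus_message \<beta> T v"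
          using \<beta>1 f(3) b(2) ch by (intro plus_message_tendsto_left[OF T _ _ \<beta>1(1,3) bt _ _ _ True]) auto
        have "\<forall>\<^sub>F n in sequentially. \<beta>\<^sub>1 < f n" by (rule order_tendstoD(1)[OF f(1) \<beta>1(3)])
        then have "\<forall>\<^sub>F n in sequentially. plus_message (max \<beta>\<^sub>1 (f n)) T v = plus_message (f n) T v"
          by eventually_elim (simp add: max_absorb2)
        then show ?thesis by (rule Lim_transform_eventually[OF l])
      next
        case False
        then show ?thesis using plus_message_outside[OF T] f(2) \<beta>0 by simp
      qed
      then show ?case by (rule root_energy_tendsto[OF f(1) _ \<beta>0 T])
    qed
  qed
qed

lemma internal_energy_upto_critical:
  fixes P :: "'q::finite offspring_laws"
  assumes u: "umgw_parameters p P" and c: "critical_inverse_temperature (umgw p P) \<beta>\<^sub>c"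
    and \<beta>: "0 \<le> \<beta>" "\<beta> \<le> \<beta>\<^sub>c"
  shows "internal_energy (umgw p P) \<beta> = 1 / 2 * (\<integral>T. real (card (children T [])) * tanh \<beta> \<partial>umgw p P)"
proof -
  have "AE T in umgw p P. \<forall>c. [c] \<in> T \<longrightarrow> plus_message \<beta> T [c] = 0"
  proof (cases "\<beta> = 0")
    case True
    have "plus_message 0 T v = 0" if "rooted_tree T" for T :: "('q \<times> nat) list set" and v
      using plus_message_le[OF that, of 0 v] plus_message_nonneg[OF that, of 0 v] by simp
    then show ?thesis using True by (intro AE_I2) (simp add: space_umgw)
  next
    case False
    then show ?thesis
      using unmagnetized_at_critical[OF u c] unmagnetized_below_critical[OF u c, of \<beta>] \<beta> by (cases "\<beta> = \<beta>\<^sub>c") auto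
  qed
  with AE_space have "AE T in umgw p P. root_energy \<beta> T = real (card (children T [])) * tanh \<beta>"
  proof eventually_elim
    case (elim T)
    then show ?case by (intro root_energy_eq_tanh \<beta>(1)) (auto simp: space_umgw children_def)
  qed
  then have "(\<integral>T. root_energy \<beta> T \<partial>umgw p P) = (\<integral>T. real (card (children T [])) * tanh \<beta> \<partial>umgw p P)"
    using integrable_root_energy[OF u \<beta>(1)] integrable_root_degree[OF u]
    by (intro integral_cong_AE) auto
  then show ?thesis by (simp add: internal_energy_umgw[OF \<beta>(1)])
qed

lemma internal_energy_tendsto_left_upto_critical:
  fixes P :: "'q::finite offspring_laws"
  assumes u: "umgw_parameters p P" and c: "critical_inverse_temperature (umgw p P) \<beta>\<^sub>c"
    and \<beta>: "0 \<le> \<beta>" "\<beta> \<le> \<beta>\<^sub>c" and f: "f \<longlonglongrightarrow> \<beta>" "\<And>n. 0 \<le> f n" "\<And>n. f n \<le> \<beta>"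
  shows "(\<lambda>n. internal_energy (umgw p P) (f n)) \<longlonglongrightarrow> internal_energy (umgw p P) \<beta>"
proof -
  let ?I = "\<integral>T. real (card (children T [])) \<partial>umgw p P"
  have e: "internal_energy (umgw p P) b = 1 / 2 * (?I * tanh b)" if "0 \<le> b" "b \<le> \<beta>" for b
    using internal_energy_upto_critical[OF u c that(1)] that(2) \<beta>(2) by simp
  have "(\<lambda>n. 1 / 2 * (?I * tanh (f n))) \<longlonglongrightarrow> 1 / 2 * (?I * tanh \<beta>)"
    by (intro tendsto_intros f) auto
  then show ?thesis unfolding e[OF f(2,3)] e[OF \<beta>(1) order_refl] .
qed

theorem lemma1p15:
  fixes p :: "'q::finite pmf" and P :: "'q \<Rightarrow> ('q \<Rightarrow> nat) pmf"
    and \<mu> :: "('q \<times> nat) list set measure"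
    and d\<^sub>s :: nat and \<beta>\<^sub>c \<beta>\<^sub>s :: real
  assumes "umgw_parameters p P"
    and "\<mu> = umgw p P"
    and "AE T in \<mu>. min_degree T = d\<^sub>s"
    and "d\<^sub>s > 2"
    and "critical_inverse_temperature \<mu> \<beta>\<^sub>c"
    and "\<beta>\<^sub>s = artanh (1 / (real d\<^sub>s - 1))"
    and "D = {\<beta> \<in> {0..}. \<not> continuous (at \<beta> within {0..}) (internal_energy \<mu>)}"
  shows "countable D \<and> D \<subseteq> {\<beta>\<^sub>c<..\<beta>\<^sub>s}"
proof
  let ?U = "internal_energy \<mu>"
  note u = assms(1)
  have mono: "?U \<beta> \<le> ?U \<beta>'" if "0 \<le> \<beta>" "\<beta> \<le> \<beta>'" for \<beta> \<beta>'
    unfolding assms(2) by (rule internal_energy_mono[OF u that])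
  then have "mono_on {0..} ?U" by (auto intro: mono_onI)
  then show "countable D" unfolding assms(7) by (rule mono_on_ctble_discont)
  have "continuous (at \<beta> within {0..}) ?U" if \<beta>: "0 \<le> \<beta>" and out: "\<beta> \<le> \<beta>\<^sub>c \<or> \<beta>\<^sub>s < \<beta>" for \<beta>
    unfolding continuous_within_sequentially o_def
  proof (intro allI impI)
    fix f :: "nat \<Rightarrow> real" assume f: "(\<forall>n. f n \<in> {0..}) \<and> f \<longlonglongrightarrow> \<beta>"
    \<comment> \<open>by monotonicity, one-sided sequences squeeze \<open>f\<close>\<close>
    have "(\<lambda>n. min (f n) \<beta>) \<longlonglongrightarrow> min \<beta> \<beta>" "(\<lambda>n. max (f n) \<beta>) \<longlonglongrightarrow> max \<beta> \<beta>"
      using f by (intro tendsto_min tendsto_max tendsto_const; simp)+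
    then have mi: "(\<lambda>n. min (f n) \<beta>) \<longlonglongrightarrow> \<beta>" and ma: "(\<lambda>n. max (f n) \<beta>) \<longlonglongrightarrow> \<beta>" by simp_all
    have mi0: "0 \<le> min (f n) \<beta>" for n using f \<beta> by auto
    have left: "(\<lambda>n. ?U (min (f n) \<beta>)) \<longlonglongrightarrow> ?U \<beta>"
    proof (cases "\<beta> \<le> \<beta>\<^sub>c")
      case True
      show ?thesis unfolding assms(2)
        by (rule internal_energy_tendsto_left_upto_critical[OF u assms(5)[unfolded assms(2)] \<beta> True mi mi0]) simp
    next
      case False
      then have "artanh (1 / (real d\<^sub>s - 1)) < \<beta>" using out assms(6) by simp
      then show ?thesis unfolding assms(2)
        by (rule internal_energy_tendsto_left[OF u assms(3)[unfolded assms(2)] assms(4) _ mi mi0]) simp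
    qed
    have right: "(\<lambda>n. ?U (max (f n) \<beta>)) \<longlonglongrightarrow> ?U \<beta>"
      unfolding assms(2) by (rule internal_energy_tendsto_right[OF u \<beta> ma]) simp
    show "(\<lambda>n. ?U (f n)) \<longlonglongrightarrow> ?U \<beta>"
      by (rule tendsto_sandwich[OF _ _ left right]) (use f mi0 in \<open>auto intro!: always_eventually mono\<close>)
  qed
  then show "D \<subseteq> {\<beta>\<^sub>c<..\<beta>\<^sub>s}" unfolding assms(7) by force
qed

end
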